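(* Let $k\ge2$ be an integer, let $N'$ be a $C^k$ manifold, and let $N\subset N'$ be a (embedded) $C^1$ submanifold. If $N$ is $C^k$ homogeneous in $N'$, then $N$ is a $C^k$ submanifold of $N'$.
   Context: A subset $N$ of a $C^k$ manifold $N'$ is $C^k$ homogeneous in $N'$ if for any two points $p,q\in N$ there is a $C^k$ local diffeomorphism of $N'$ sending $p$ to $q$ and preserving $N$; that is, there are neighborhoods $U$ of $p$ and $V$ of $q$ in $N'$ and a $C^k$ diffeomorphism $H\colon U\to V$ with $H(p)=q$ and $H(U\cap N)=V\cap N$. *)

theory Defs
  imports "HOL-Analysis.Analysis"
begin

text \<open>
  Manifolds are modelled on a linear subspace \<open>E\<close> of a type of class \<open>euclidean_space\<close>,
  not on the whole type. Such types have positive dimension, so this is what makes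
  manifolds of dimension \<open>0\<close> available (\<open>E = {0}\<close>).
\<close>

text \<open>
  \<open>Ck_on k E S f\<close> is meant for \<open>S\<close> open in the subspace \<open>E\<close>: the function \<open>f\<close> is \<open>k\<close> times
  continuously differentiable on \<open>S\<close>. For such \<open>S\<close> the values \<open>f' x v\<close> with \<open>v \<in> E\<close> are the
  directional derivatives of \<open>f\<close> along \<open>E\<close>, and they are uniquely determined; off \<open>E\<close> the linear
  map \<open>f' x\<close> is arbitrary, which is why only directions in \<open>E\<close> occur in the recursion.
\<close>

primrec Ck_on ::
  "nat \<Rightarrow> 'e::euclidean_space set \<Rightarrow> 'e set \<Rightarrow> ('e \<Rightarrow> 'f::real_normed_vector) \<Rightarrow> bool"
where
  "Ck_on 0 E S f \<longleftrightarrow> continuous_on S f"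
| "Ck_on (Suc k) E S f \<longleftrightarrow>
     (\<exists>f'. (\<forall>x\<in>S. (f has_derivative f' x) (at x within S)) \<and>
           (\<forall>v\<in>E. Ck_on k E S (\<lambda>x. f' x v)))"

type_synonym ('m, 'e) chart = "'m set \<times> ('m \<Rightarrow> 'e)"

definition is_chart :: "'m topology \<Rightarrow> 'e::euclidean_space set \<Rightarrow> ('m, 'e) chart \<Rightarrow> bool" where
  "is_chart X E = (\<lambda>(U, \<phi>).
     openin X U \<and> openin (top_of_set E) (\<phi> ` U) \<and>
     homeomorphic_map (subtopology X U) (top_of_set (\<phi> ` U)) \<phi>)"

definition Ck_compatible ::
  "nat \<Rightarrow> 'e::euclidean_space set \<Rightarrow> ('m, 'e) chart \<Rightarrow> ('m, 'e) chart \<Rightarrow> bool"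
where
  "Ck_compatible k E = (\<lambda>(U, \<phi>) (V, \<psi>).
     Ck_on k E (\<phi> ` (U \<inter> V)) (\<psi> \<circ> inv_into U \<phi>) \<and>
     Ck_on k E (\<psi> ` (U \<inter> V)) (\<phi> \<circ> inv_into V \<psi>))"

text \<open>The set \<open>A\<close> is an atlas, not necessarily maximal; the dimension of the manifold is \<open>dim E\<close>.\<close>

definition Ck_manifold ::
  "nat \<Rightarrow> 'e::euclidean_space set \<Rightarrow> 'm topology \<Rightarrow> ('m, 'e) chart set \<Rightarrow> bool"
where
  "Ck_manifold k E X A \<longleftrightarrow>
     subspace E \<and> Hausdorff_space X \<and> second_countable X \<and>
     (\<forall>c\<in>A. is_chart X E c) \<and> topspace X = (\<Union>(U, \<phi>)\<in>A. U) \<and>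
     (\<forall>c\<in>A. \<forall>c'\<in>A. Ck_compatible k E c c')"

text \<open>The maximal \<open>C\<^sup>j\<close> atlas generated by \<open>A\<close>; used for all \<open>j\<close> up to the class of \<open>A\<close>.\<close>

definition Ck_charts ::
  "nat \<Rightarrow> 'e::euclidean_space set \<Rightarrow> 'm topology \<Rightarrow> ('m, 'e) chart set \<Rightarrow> ('m, 'e) chart set"
where
  "Ck_charts j E X A = {c. is_chart X E c \<and> (\<forall>c'\<in>A. Ck_compatible j E c c')}"

definition Ck_submanifold ::
  "nat \<Rightarrow> nat \<Rightarrow> 'e::euclidean_space set \<Rightarrow> 'm topology \<Rightarrow> ('m, 'e) chart set \<Rightarrow> 'm set \<Rightarrow> bool"
where
  "Ck_submanifold j d E X A N \<longleftrightarrow>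
     N \<subseteq> topspace X \<and>
     (\<forall>p\<in>N. \<exists>(U, \<phi>)\<in>Ck_charts j E X A. p \<in> U \<and>
        (\<exists>L. subspace L \<and> L \<subseteq> E \<and> dim L = d \<and> \<phi> ` (U \<inter> N) = \<phi> ` U \<inter> L))"

definition Ck_map ::
  "nat \<Rightarrow> 'e::euclidean_space set \<Rightarrow> 'm topology \<Rightarrow> ('m, 'e) chart set \<Rightarrow>
   'm set \<Rightarrow> 'm set \<Rightarrow> ('m \<Rightarrow> 'm) \<Rightarrow> bool"
where
  "Ck_map k E X A U V H \<longleftrightarrow>
     continuous_map (subtopology X U) (subtopology X V) H \<and>
     (\<forall>(W, \<phi>)\<in>A. \<forall>(W', \<psi>)\<in>A.
        Ck_on k E (\<phi> ` {x \<in> U \<inter> W. H x \<in> W'}) (\<psi> \<circ> H \<circ> inv_into W \<phi>))"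

definition Ck_diffeo ::
  "nat \<Rightarrow> 'e::euclidean_space set \<Rightarrow> 'm topology \<Rightarrow> ('m, 'e) chart set \<Rightarrow>
   'm set \<Rightarrow> 'm set \<Rightarrow> ('m \<Rightarrow> 'm) \<Rightarrow> bool"
where
  "Ck_diffeo k E X A U V H \<longleftrightarrow>
     bij_betw H U V \<and> Ck_map k E X A U V H \<and> Ck_map k E X A V U (inv_into U H)"

definition Ck_homogeneous ::
  "nat \<Rightarrow> 'e::euclidean_space set \<Rightarrow> 'm topology \<Rightarrow> ('m, 'e) chart set \<Rightarrow> 'm set \<Rightarrow> bool"
where
  "Ck_homogeneous k E X A N \<longleftrightarrow>
     N \<subseteq> topspace X \<and>
     (\<forall>p\<in>N. \<forall>q\<in>N. \<exists>U V H.
        openin X U \<and> openin X V \<and> p \<in> U \<and> q \<in> V \<and>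
        Ck_diffeo k E X A U V H \<and> H p = q \<and> H ` (U \<inter> N) = V \<inter> N)"

end

theory Submission
  imports Defs
begin

text \<open>
  In a \<open>C\<^sup>k\<close> chart \<open>N\<close> is locally the graph of a \<open>C\<^sup>1\<close> function \<open>f\<close>, and it has to be shown that
  \<open>f\<close> of class \<open>C\<^sup>j\<close> with \<open>j < k\<close> is of class \<open>C\<^sup>j\<^sup>+\<^sup>1\<close>. A local diffeomorphism \<open>H\<close> preserving the graph
  induces a base map \<open>a\<close>, and differentiating \<open>j\<close> times shows that, modulo \<open>C\<^sup>1\<close> terms, the
  derivatives of order \<open>j\<close> of \<open>f\<close> at \<open>a x\<close> depend in a \<open>C\<^sup>1\<close> way on those at \<open>x\<close>. So everything
  reduces to a finite family \<open>g\<close> of continuous functions whose graph is \<open>C\<^sup>1\<close> homogeneous.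

  For such a family, maximising \<open>g i - R |x - x\<^sub>0|\<^sup>2\<close> yields a dense set of points where \<open>g i\<close> is
  touched from above by a paraboloid. Homogeneity spreads such a one-sided estimate to all points,
  and the Baire category theorem turns it into a two-sided estimate between pairs of nearby points.
  A second use of Baire's theorem gives a point at which all \<open>g i\<close> are strictly differentiable; by
  homogeneity this holds at every point, which means that the \<open>g i\<close> are of class \<open>C\<^sup>1\<close>.
\<close>

subsection \<open>Expansions relative to a family of functions\<close>

text \<open>The obstacle is that the base map \<open>a\<close> is built from \<open>f\<close> and is
  only as smooth as \<open>f\<close>: differentiating the relation between \<open>f\<close> and
  \<open>a\<close> brings in the unknown top derivatives on both sides. Each of them at
  \<open>a x\<close> is governed by all of them at \<open>x\<close>, so they form one family, and
  contact of a single component with a paraboloid is transported to contact of some linear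
  combination. This is why general coefficients \<open>l\<close> appear. All expansions compare two
  moving points x and y, not a fixed and a moving one. Two-point estimates persist at nearby base
  points, as Baire's theorem requires, and strict differentiability at every point already makes the
  derivative continuous. Since the \<open>g i\<close> are not known to be Lipschitz, errors are
  measured by the distance of graph points, which includes the increments of all \<open>g i\<close>;
  only flatness makes it comparable to the norm of x - y. The initial C^1 regularity enters by
  making \<open>a\<close> strictly differentiable, so that base increments are controlled from the
  start.\<close>

definition negligible_wrt :: "'z filter \<Rightarrow> ('z \<Rightarrow> real) \<Rightarrow> ('z \<Rightarrow> 'b::real_normed_vector) \<Rightarrow> bool" where
  "negligible_wrt F m h \<longleftrightarrow> (\<forall>e>0. eventually (\<lambda>z. norm (h z) \<le> e * m z) F)"

definition bounded_wrt :: "'z filter \<Rightarrow> ('z \<Rightarrow> real) \<Rightarrow> ('z \<Rightarrow> 'b::real_normed_vector) \<Rightarrow> bool" where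
  "bounded_wrt F m h \<longleftrightarrow> (\<exists>K. eventually (\<lambda>z. norm (h z) \<le> K * m z) F)"

lemma negligible_wrtD:
  "negligible_wrt F m h \<Longrightarrow> e > 0 \<Longrightarrow> eventually (\<lambda>z. norm (h z) \<le> e * m z) F"
  by (simp add: negligible_wrt_def)

lemma negligible_wrt_zero [simp]:
  assumes "\<And>z. 0 \<le> m z"
  shows "negligible_wrt F m (\<lambda>z. 0)"
  using assms by (simp add: negligible_wrt_def)

lemma negligible_wrt_add:
  assumes "negligible_wrt F m h" "negligible_wrt F m h'"
  shows "negligible_wrt F m (\<lambda>z. h z + h' z)"
  unfolding negligible_wrt_def
proof (intro allI impI)
  fix e :: real assume "e > 0"
  then have "eventually (\<lambda>z. norm (h z) \<le> (e/2) * m z) F" "eventually (\<lambda>z. norm (h' z) \<le> (e/2) * m z) F"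
    using negligible_wrtD[OF assms(1), of "e/2"] negligible_wrtD[OF assms(2), of "e/2"] by auto
  then show "eventually (\<lambda>z. norm (h z + h' z) \<le> e * m z) F"
  proof eventually_elim
    case (elim z)
    then show ?case using norm_triangle_ineq[of "h z" "h' z"] by (simp add: field_simps)
  qed
qed

lemma negligible_wrt_le:
  assumes "negligible_wrt F m h" "eventually (\<lambda>z. norm (h' z) \<le> K * norm (h z)) F" "\<And>z. 0 \<le> m z"
  shows "negligible_wrt F m h'"
  unfolding negligible_wrt_def
proof (intro allI impI)
  fix e :: real assume e: "e > 0"
  then have "eventually (\<lambda>z. norm (h z) \<le> (e/(\<bar>K\<bar>+1)) * m z) F"
    by (intro negligible_wrtD[OF assms(1)]) (simp add: add_nonneg_pos)
  with assms(2) show "eventually (\<lambda>z. norm (h' z) \<le> e * m z) F"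
  proof eventually_elim
    case (elim z)
    have "norm (h' z) \<le> \<bar>K\<bar> * norm (h z)"
      using elim(1) mult_right_mono[OF abs_ge_self[of K] norm_ge_zero[of "h z"]] by linarith
    also have "\<dots> \<le> (\<bar>K\<bar>+1) * ((e/(\<bar>K\<bar>+1)) * m z)"
      using elim(2) by (intro mult_mono) auto
    also have "\<dots> = e * m z" by simp
    finally show ?case .
  qed
qed

lemma negligible_wrt_bounded_linear:
  assumes "negligible_wrt F m h" "bounded_linear L" "\<And>z. 0 \<le> m z"
  shows "negligible_wrt F m (\<lambda>z. L (h z))"
proof -
  obtain K where "\<And>x. norm (L x) \<le> norm x * K"
    using bounded_linear.bounded[OF assms(2)] by blast
  then show ?thesis
    by (intro negligible_wrt_le[OF assms(1) _ assms(3), where K=K])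
       (simp add: mult.commute)
qed

lemma negligible_wrt_bilinear:
  assumes "bounded_bilinear bl" "bounded_wrt F m h" "(V \<longlongrightarrow> 0) F" "\<And>z. 0 \<le> m z"
  shows "negligible_wrt F m (\<lambda>z. bl (h z) (V z))"
  unfolding negligible_wrt_def
proof (intro allI impI)
  fix e :: real assume e: "e > 0"
  obtain B where B: "B > 0" "\<And>x y. norm (bl x y) \<le> norm x * norm y * B"
    using bounded_bilinear.pos_bounded[OF assms(1)] by blast
  obtain K where K: "eventually (\<lambda>z. norm (h z) \<le> K * m z) F"
    using assms(2) by (auto simp: bounded_wrt_def)
  define d where "d = e / (B * (\<bar>K\<bar> + 1))"
  have d: "d > 0" using e B by (simp add: d_def add_pos_nonneg)
  have "eventually (\<lambda>z. norm (V z) < d) F"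
    using assms(3) d by (simp add: tendsto_iff dist_norm)
  with K show "eventually (\<lambda>z. norm (bl (h z) (V z)) \<le> e * m z) F"
  proof eventually_elim
    case (elim z)
    have "norm (h z) \<le> (\<bar>K\<bar> + 1) * m z"
      using elim(1) assms(4)[of z] mult_right_mono[of K "\<bar>K\<bar>+1" "m z"] by linarith
    then have "norm (h z) * norm (V z) * B \<le> ((\<bar>K\<bar> + 1) * m z) * d * B"
      using elim(2) B(1) assms(4)[of z] by (intro mult_right_mono mult_mono) auto
    also have "\<dots> = e * m z" using B by (simp add: d_def)
    finally show ?case using B(2)[of "h z" "V z"] by linarith
  qed
qed

lemma negligible_imp_bounded_wrt: "negligible_wrt F m h \<Longrightarrow> bounded_wrt F m h"
  unfolding negligible_wrt_def bounded_wrt_def by (meson zero_less_one)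

lemma bounded_wrt_add:
  assumes "bounded_wrt F m h" "bounded_wrt F m h'"
  shows "bounded_wrt F m (\<lambda>z. h z + h' z)"
proof -
  obtain K K' where "eventually (\<lambda>z. norm (h z) \<le> K * m z) F" "eventually (\<lambda>z. norm (h' z) \<le> K' * m z) F"
    using assms by (auto simp: bounded_wrt_def)
  then have "eventually (\<lambda>z. norm (h z + h' z) \<le> (K + K') * m z) F"
  proof eventually_elim
    case (elim z)
    then show ?case using norm_triangle_ineq[of "h z" "h' z"] by (simp add: distrib_right)
  qed
  then show ?thesis by (auto simp: bounded_wrt_def)
qed

lemma bounded_wrt_sum:
  assumes "\<And>i. i \<in> I \<Longrightarrow> bounded_wrt F m (h i)"
  shows "bounded_wrt F m (\<lambda>z. \<Sum>i\<in>I. h i z)"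
  using assms
proof (induction I rule: infinite_finite_induct)
  case (insert x F)
  then show ?case by (auto intro: bounded_wrt_add)
qed (auto simp: bounded_wrt_def intro: exI[of _ 0])

section \<open>Strict first-order expansions along a graph\<close>

text \<open>This is the l^1 distance of the graph points (x, g x) and (y, g y). For
  \<open>I = {}\<close> it is the norm of x - y, so that \<open>negligible_wrt\<close> then
  expresses ordinary strict differentiability.\<close>

definition osc :: "'i set \<Rightarrow> ('i \<Rightarrow> 'a::real_normed_vector \<Rightarrow> real) \<Rightarrow> 'a \<times> 'a \<Rightarrow> real" where
  "osc I g z = norm (fst z - snd z) + (\<Sum>i\<in>I. \<bar>g i (fst z) - g i (snd z)\<bar>)"

lemma osc_nonneg [simp]: "0 \<le> osc I g z"
  by (simp add: osc_def sum_nonneg)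

lemma osc_ge_norm: "norm (fst z - snd z) \<le> osc I g z"
  by (simp add: osc_def sum_nonneg)

lemma osc_ge_component: "finite I \<Longrightarrow> i \<in> I \<Longrightarrow> \<bar>g i (fst z) - g i (snd z)\<bar> \<le> osc I g z"
  using member_le_sum[of i I "\<lambda>i. \<bar>g i (fst z) - g i (snd z)\<bar>"] by (simp add: osc_def add_increasing)

text \<open>
  A first-order expansion of \<open>h (x, y)\<close> as \<open>x, y \<rightarrow> p\<close> in which the increments of the functions
  \<open>g i\<close>, which need not be differentiable, are allowed alongside the increment \<open>x - y\<close>.
\<close>

definition expands ::
  "'i set \<Rightarrow> ('i \<Rightarrow> 'a::real_normed_vector \<Rightarrow> real) \<Rightarrow> 'a \<Rightarrow> ('a \<times> 'a \<Rightarrow> 'b::real_normed_vector) \<Rightarrow> bool"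
where
  "expands I g p h \<longleftrightarrow> (\<exists>c l. bounded_linear c \<and>
     negligible_wrt (nhds (p, p)) (osc I g)
       (\<lambda>z. h z - (c (fst z - snd z) + (\<Sum>i\<in>I. (g i (fst z) - g i (snd z)) *\<^sub>R l i))))"

definition rel_diff ::
  "'i set \<Rightarrow> ('i \<Rightarrow> 'a::real_normed_vector \<Rightarrow> real) \<Rightarrow> ('a \<Rightarrow> 'b::real_normed_vector) \<Rightarrow> 'a \<Rightarrow> bool"
where
  "rel_diff I g u p \<longleftrightarrow> expands I g p (\<lambda>z. u (fst z) - u (snd z))"

lemma expands_cong:
  assumes "expands I g p h" "eventually (\<lambda>z. h z = h' z) (nhds (p, p))"
  shows "expands I g p h'"
proof -
  obtain c l where c: "bounded_linear c"
    and n: "negligible_wrt (nhds (p, p)) (osc I g)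
       (\<lambda>z. h z - (c (fst z - snd z) + (\<Sum>i\<in>I. (g i (fst z) - g i (snd z)) *\<^sub>R l i)))"
    using assms(1) by (auto simp: expands_def)
  have "negligible_wrt (nhds (p, p)) (osc I g)
       (\<lambda>z. h' z - (c (fst z - snd z) + (\<Sum>i\<in>I. (g i (fst z) - g i (snd z)) *\<^sub>R l i)))"
    by (rule negligible_wrt_le[OF n, where K=1]) (use assms(2) in eventually_elim, auto)
  with c show ?thesis unfolding expands_def by blast
qed

lemma expands_add:
  assumes "expands I g p h" "expands I g p h'"
  shows "expands I g p (\<lambda>z. h z + h' z)"
proof -
  obtain c l c' l' where c: "bounded_linear c" "bounded_linear c'"
    and n: "negligible_wrt (nhds (p, p)) (osc I g)
       (\<lambda>z. h z - (c (fst z - snd z) + (\<Sum>i\<in>I. (g i (fst z) - g i (snd z)) *\<^sub>R l i)))"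
       "negligible_wrt (nhds (p, p)) (osc I g)
       (\<lambda>z. h' z - (c' (fst z - snd z) + (\<Sum>i\<in>I. (g i (fst z) - g i (snd z)) *\<^sub>R l' i)))"
    using assms by (auto simp: expands_def)
  show ?thesis unfolding expands_def
  proof (intro exI conjI)
    show "bounded_linear (\<lambda>x. c x + c' x)"
      using c by (rule bounded_linear_add)
    show "negligible_wrt (nhds (p, p)) (osc I g)
       (\<lambda>z. h z + h' z - (c (fst z - snd z) + c' (fst z - snd z) + (\<Sum>i\<in>I. (g i (fst z) - g i (snd z)) *\<^sub>R (l i + l' i))))"
      using negligible_wrt_add[OF n] by (simp add: sum.distrib sum_subtractf algebra_simps)
  qed
qed

lemma expands_bounded_linear:
  assumes "expands I g p h" "bounded_linear L"
  shows "expands I g p (\<lambda>z. L (h z))"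
proof -
  obtain c l where c: "bounded_linear c"
    and n: "negligible_wrt (nhds (p, p)) (osc I g)
       (\<lambda>z. h z - (c (fst z - snd z) + (\<Sum>i\<in>I. (g i (fst z) - g i (snd z)) *\<^sub>R l i)))"
    using assms by (auto simp: expands_def)
  interpret L: bounded_linear L by fact
  show ?thesis unfolding expands_def
  proof (intro exI conjI)
    show "bounded_linear (\<lambda>x. L (c x))"
      using assms(2) c by (rule bounded_linear_compose)
    show "negligible_wrt (nhds (p, p)) (osc I g)
       (\<lambda>z. L (h z) - (L (c (fst z - snd z)) + (\<Sum>i\<in>I. (g i (fst z) - g i (snd z)) *\<^sub>R L (l i))))"
      using negligible_wrt_bounded_linear[OF n assms(2)] by (simp add: L.diff L.add L.sum L.scale)
  qed
qed

lemma expands_zero: "expands I g p (\<lambda>z. 0)"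
  unfolding expands_def
  by (rule exI[of _ "\<lambda>_. 0"], rule exI[of _ "\<lambda>_. 0"]) simp

lemma expands_sum:
  assumes "\<And>j. j \<in> J \<Longrightarrow> expands I g p (h j)"
  shows "expands I g p (\<lambda>z. \<Sum>j\<in>J. h j z)"
  using assms
  by (induction J rule: infinite_finite_induct) (auto intro: expands_add simp: expands_zero)

lemma expands_negligible:
  assumes "negligible_wrt (nhds (p, p)) (osc I g) h"
  shows "expands I g p h"
  unfolding expands_def
  by (rule exI[of _ "\<lambda>_. 0"], rule exI[of _ "\<lambda>_. 0"]) (simp add: assms)

lemma expands_imp_bounded:
  assumes "finite I" "expands I g p h"
  shows "bounded_wrt (nhds (p, p)) (osc I g) h"
proof -
  obtain c l where c: "bounded_linear c"
    and n: "negligible_wrt (nhds (p, p)) (osc I g)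
       (\<lambda>z. h z - (c (fst z - snd z) + (\<Sum>i\<in>I. (g i (fst z) - g i (snd z)) *\<^sub>R l i)))"
    using assms by (auto simp: expands_def)
  obtain K where K: "K \<ge> 0" "\<And>x. norm (c x) \<le> norm x * K"
    using bounded_linear.nonneg_bounded[OF c] by blast
  have 1: "bounded_wrt (nhds (p, p)) (osc I g) (\<lambda>z. c (fst z - snd z))"
    unfolding bounded_wrt_def
  proof (intro exI always_eventually allI)
    fix z show "norm (c (fst z - snd z)) \<le> K * osc I g z"
      using K(2)[of "fst z - snd z"] mult_left_mono[OF osc_ge_norm[of z I g] K(1)]
      by (simp add: mult.commute)
  qed
  have 2: "bounded_wrt (nhds (p, p)) (osc I g) (\<lambda>z. \<Sum>i\<in>I. (g i (fst z) - g i (snd z)) *\<^sub>R l i)"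
  proof (rule bounded_wrt_sum)
    fix i assume i: "i \<in> I"
    show "bounded_wrt (nhds (p, p)) (osc I g) (\<lambda>z. (g i (fst z) - g i (snd z)) *\<^sub>R l i)"
      unfolding bounded_wrt_def
    proof (intro exI always_eventually allI)
      fix z show "norm ((g i (fst z) - g i (snd z)) *\<^sub>R l i) \<le> norm (l i) * osc I g z"
        using mult_left_mono[OF osc_ge_component[OF assms(1) i, of g z], of "norm (l i)"]
        by (simp add: mult.commute)
    qed
  qed
  show ?thesis
    using bounded_wrt_add[OF negligible_imp_bounded_wrt[OF n] bounded_wrt_add[OF 1 2]] by simp
qed

text \<open>Replacing \<open>V\<close> by its limit costs a term bounded by \<open>osc\<close> times
  a null function, which is negligible. Hence the second factor needs a limit only, no expansion of
  its own.\<close>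

lemma expands_bilinear:
  assumes "finite I" "bounded_bilinear bl" "expands I g p h" "(V \<longlongrightarrow> V0) (nhds (p, p))"
  shows "expands I g p (\<lambda>z. bl (h z) (V z))"
proof -
  interpret bounded_bilinear bl by fact
  have "expands I g p (\<lambda>z. bl (h z) V0 + bl (h z) (V z - V0))"
  proof (rule expands_add)
    show "expands I g p (\<lambda>z. bl (h z) V0)"
      by (rule expands_bounded_linear[OF assms(3) bounded_linear_left])
    show "expands I g p (\<lambda>z. bl (h z) (V z - V0))"
      by (rule expands_negligible, rule negligible_wrt_bilinear[OF assms(2)])
         (use assms in \<open>auto intro: expands_imp_bounded simp: LIM_zero_iff\<close>)
  qed
  then show ?thesis by (simp add: diff_right)
qed

lemma expands_mono:
  assumes "finite I'" "expands I g p h" "I \<subseteq> I'"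
  shows "expands I' g p h"
proof -
  obtain c l where c: "bounded_linear c"
    and n: "negligible_wrt (nhds (p, p)) (osc I g)
       (\<lambda>z. h z - (c (fst z - snd z) + (\<Sum>i\<in>I. (g i (fst z) - g i (snd z)) *\<^sub>R l i)))"
    using assms by (auto simp: expands_def)
  have osc: "osc I g z \<le> osc I' g z" for z
    using assms by (auto simp: osc_def intro!: sum_mono2)
  have eq: "(\<Sum>i\<in>I. (g i (fst z) - g i (snd z)) *\<^sub>R l i)
      = (\<Sum>i\<in>I'. (g i (fst z) - g i (snd z)) *\<^sub>R (if i \<in> I then l i else 0))" for z
    using assms by (intro sum.mono_neutral_cong_left) auto
  have "negligible_wrt (nhds (p, p)) (osc I' g)
       (\<lambda>z. h z - (c (fst z - snd z) + (\<Sum>i\<in>I. (g i (fst z) - g i (snd z)) *\<^sub>R l i)))"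
    unfolding negligible_wrt_def
  proof (intro allI impI)
    fix e :: real assume e: "e > 0"
    show "\<forall>\<^sub>F z in nhds (p, p). norm (h z - (c (fst z - snd z) + (\<Sum>i\<in>I. (g i (fst z) - g i (snd z)) *\<^sub>R l i))) \<le> e * osc I' g z"
      by (rule eventually_mono[OF n[unfolded negligible_wrt_def, rule_format, OF e]])
         (use osc e in \<open>meson mult_left_mono order_trans less_imp_le\<close>)
  qed
  then show ?thesis unfolding expands_def eq
    by (intro exI[of _ c] exI[of _ "\<lambda>i. if i \<in> I then l i else 0"] conjI c)
qed

lemma rel_diff_cong:
  assumes "rel_diff I g u p" "eventually (\<lambda>x. u x = u' x) (nhds p)"
  shows "rel_diff I g u' p"
proof -
  have "eventually (\<lambda>z. u (fst z) = u' (fst z) \<and> u (snd z) = u' (snd z)) (nhds (p, p))"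
    unfolding nhds_prod eventually_prod_same using assms(2) by auto
  then show ?thesis
    using assms(1) unfolding rel_diff_def
    by (elim expands_cong eventually_mono) auto
qed

lemma rel_diff_const: "rel_diff I g (\<lambda>x. k) p"
  by (simp add: rel_diff_def expands_zero)

lemma rel_diff_add: "rel_diff I g u p \<Longrightarrow> rel_diff I g v p \<Longrightarrow> rel_diff I g (\<lambda>x. u x + v x) p"
  unfolding rel_diff_def by (drule (1) expands_add) (simp add: algebra_simps)

lemma rel_diff_bounded_linear: "rel_diff I g u p \<Longrightarrow> bounded_linear L \<Longrightarrow> rel_diff I g (\<lambda>x. L (u x)) p"
  unfolding rel_diff_def by (drule (1) expands_bounded_linear) (simp add: linear_simps)

lemma rel_diff_generator:
  assumes "finite I" "i \<in> I"
  shows "rel_diff I g (g i) p"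
proof -
  have "(\<Sum>j\<in>I. (g j (fst z) - g j (snd z)) *\<^sub>R (if j = i then 1 else 0)) = g i (fst z) - g i (snd z)" for z
    using assms by (simp add: if_distrib if_distribR sum.delta cong: if_cong)
  then show ?thesis
    unfolding rel_diff_def expands_def
    by (intro exI[of _ "\<lambda>_. 0"] exI[of _ "\<lambda>j. if j = i then 1 else 0"]) simp
qed

lemma tendsto_fst_snd_nhds:
  assumes "isCont u p"
  shows "((\<lambda>z. u (fst z)) \<longlongrightarrow> u p) (nhds (p, p))" "((\<lambda>z. u (snd z)) \<longlongrightarrow> u p) (nhds (p, p))"
proof -
  have u: "filterlim u (nhds (u p)) (nhds p)"
    using assms by (simp add: continuous_at tendsto_at_iff_tendsto_nhds)
  show "((\<lambda>z. u (fst z)) \<longlongrightarrow> u p) (nhds (p, p))" "((\<lambda>z. u (snd z)) \<longlongrightarrow> u p) (nhds (p, p))"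
    unfolding nhds_prod
    by (rule filterlim_compose[OF u] filterlim_fst filterlim_snd)+
qed

text \<open>The product rule for increments: the factor that is not differenced is evaluated at x in
  one term and at y in the other, and continuity supplies its limit.\<close>

lemma rel_diff_bilinear:
  assumes "finite I" "bounded_bilinear bl" "rel_diff I g u p" "rel_diff I g v p" "isCont u p" "isCont v p"
  shows "rel_diff I g (\<lambda>x. bl (u x) (v x)) p"
proof -
  interpret bounded_bilinear bl by fact
  have "expands I g p (\<lambda>z. bl (u (fst z) - u (snd z)) (v (fst z)))"
    using assms by (intro expands_bilinear[OF _ assms(2) _ tendsto_fst_snd_nhds(1)]) (auto simp: rel_diff_def)
  moreover have "expands I g p (\<lambda>z. bl (u (snd z)) (v (fst z) - v (snd z)))"
    using assms by (intro expands_bilinear[OF _ flip _ tendsto_fst_snd_nhds(2)]) (auto simp: rel_diff_def)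
  ultimately show ?thesis
    unfolding rel_diff_def by (auto dest: expands_add simp: diff_left diff_right)
qed

subsection \<open>Families that are homogeneous up to first order\<close>

text \<open>The centre lies in \<open>S j\<close> itself and not just in its closure, because the
  constants attached to that very point are used afterwards.\<close>

lemma Baire_countable_cover:
  fixes \<Omega> :: "'a::euclidean_space set" and S :: "'j \<Rightarrow> 'a set"
  assumes "open \<Omega>" "\<Omega> \<noteq> {}" "countable J" "\<Omega> \<subseteq> (\<Union>j\<in>J. S j)"
  obtains j p r where "j \<in> J" "p \<in> S j" "r > 0" "ball p r \<subseteq> \<Omega>" "ball p r \<subseteq> closure (S j)"
proof (rule ccontr)
  assume contr: "\<not> thesis"
  note found = that
  \<comment> \<open>The negated conclusion only excludes balls centred in \<open>S j\<close>; but a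
    ball inside the closure contains a point of \<open>S j\<close> together with a smaller ball
    around it.\<close>
  have nowhere: "\<not> (\<exists>p r. r > 0 \<and> ball p r \<subseteq> closure (S j \<inter> \<Omega>))" if j: "j \<in> J" for j
  proof
    assume "\<exists>p r. r > 0 \<and> ball p r \<subseteq> closure (S j \<inter> \<Omega>)"
    then obtain p r where pr: "r > 0" "ball p r \<subseteq> closure (S j \<inter> \<Omega>)" by blast
    then have "p \<in> closure (S j \<inter> \<Omega>)" by (auto simp: subset_eq)
    then obtain p' where p': "p' \<in> S j" "p' \<in> \<Omega>" "dist p' p < r"
      using pr(1) by (auto simp: closure_approachable)
    then have "open (ball p r \<inter> \<Omega>)" "p' \<in> ball p r \<inter> \<Omega>"
      using assms(1) by (auto simp: dist_commute)
    then obtain s where s: "s > 0" "ball p' s \<subseteq> ball p r \<inter> \<Omega>"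
      by (meson open_contains_ball)
    have "ball p' s \<subseteq> closure (S j)"
      using s(2) pr(2) closure_mono[of "S j \<inter> \<Omega>" "S j"] by blast
    then show False using contr found[OF j p'(1) s(1)] s(2) by blast
  qed
  define G where "G = (\<lambda>j. - closure (S j \<inter> \<Omega>)) ` J"
  have "UNIV \<subseteq> closure (\<Inter>G)"
  proof (rule Baire)
    show "countable G" using assms(3) by (simp add: G_def)
    fix T assume "T \<in> G"
    then obtain j where j: "j \<in> J" "T = - closure (S j \<inter> \<Omega>)" by (auto simp: G_def)
    have "x \<in> closure T" for x
      unfolding closure_approachable
    proof (intro allI impI)
      fix e :: real assume "e > 0"
      then have "\<not> ball x e \<subseteq> closure (S j \<inter> \<Omega>)" using nowhere[OF j(1)] by blast
      then show "\<exists>y\<in>T. dist y x < e" by (auto simp: j(2) subset_eq dist_commute)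
    qed
    then show "openin (top_of_set UNIV) T \<and> UNIV \<subseteq> closure T"
      by (auto simp: j(2))
  qed auto
  then have "\<Omega> \<inter> closure (\<Inter>G) \<noteq> {}" using assms(2) by auto
  then have "\<Omega> \<inter> \<Inter>G \<noteq> {}" by (simp only: open_Int_closure_eq_empty[OF assms(1)] simp_thms)
  then obtain x where x: "x \<in> \<Omega>" "x \<in> \<Inter>G" by blast
  obtain j where j: "j \<in> J" "x \<in> S j" using assms(4) x(1) by blast
  then have "x \<in> closure (S j \<inter> \<Omega>)" using x(1) by (intro subsetD[OF closure_subset]) simp
  then show False using x(2) j(1) by (auto simp: G_def)
qed

text \<open>Only the coordinates in \<open>I\<close> matter; rational values on \<open>I\<close>,
  extended by \<open>undefined\<close>, form a countable set.\<close>

lemma countable_dense_on_finite: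
  assumes "finite I"
  obtains D :: "('i \<Rightarrow> real) set"
  where "countable D" "\<And>l e. e > 0 \<Longrightarrow> \<exists>l'\<in>D. \<forall>i\<in>I. \<bar>l' i - l i\<bar> \<le> e"
proof
  show "countable (I \<rightarrow>\<^sub>E (\<rat>::real set))"
    using assms by (intro countable_PiE) (auto simp: countable_rat)
  fix l :: "'i \<Rightarrow> real" and e :: real assume e: "e > 0"
  have "\<exists>q\<in>\<rat>. \<bar>q - l i\<bar> \<le> e" for i
    using Rats_dense_in_real[of "l i" "l i + e"] e by force
  then obtain q where q: "\<And>i. q i \<in> \<rat>" "\<And>i. \<bar>q i - l i\<bar> \<le> e" by metis
  show "\<exists>l'\<in>I \<rightarrow>\<^sub>E \<rat>. \<forall>i\<in>I. \<bar>l' i - l i\<bar> \<le> e"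
    by (rule bexI[of _ "restrict q I"]) (auto simp: q)
qed

section \<open>One-sided and two-sided contact of the graph with hyperplanes\<close>

text \<open>The linear functional (l, -c) applied to the difference of two graph points; its kernel
  is a hyperplane in the space containing the graph of \<open>g\<close>.\<close>

definition lin ::
  "'i set \<Rightarrow> ('i \<Rightarrow> 'a::real_inner \<Rightarrow> real) \<Rightarrow> ('i \<Rightarrow> real) \<Rightarrow> 'a \<Rightarrow> 'a \<times> 'a \<Rightarrow> real"
where
  "lin I g l c z = (\<Sum>i\<in>I. l i * (g i (fst z) - g i (snd z))) - c \<bullet> (fst z - snd z)"

text \<open>The second point is fixed at \<open>p\<close>: the graph lies, to first order at
  \<open>p\<close>, on one side of the hyperplane.\<close>

definition touched_above ::
  "'i set \<Rightarrow> ('i \<Rightarrow> 'a::real_inner \<Rightarrow> real) \<Rightarrow> 'a \<Rightarrow> ('i \<Rightarrow> real) \<Rightarrow> 'a \<Rightarrow> bool"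
where
  "touched_above I g p l c \<longleftrightarrow>
     (\<forall>e>0. eventually (\<lambda>x. lin I g l c (x, p) \<le> e * osc I g (x, p)) (nhds p))"

text \<open>Here both points move and the accuracy \<open>e\<close> is fixed. This makes the
  condition open in \<open>p\<close>, and exchanging the two points makes sense.\<close>

definition flat_at ::
  "'i set \<Rightarrow> ('i \<Rightarrow> 'a::real_inner \<Rightarrow> real) \<Rightarrow> 'a \<Rightarrow> real \<Rightarrow> ('i \<Rightarrow> real) \<Rightarrow> 'a \<Rightarrow> bool"
where
  "flat_at I g p e l c \<longleftrightarrow> eventually (\<lambda>z. \<bar>lin I g l c z\<bar> \<le> e * osc I g z) (nhds (p, p))"

text \<open>The base map is expanded relative to the empty family, that is, strictly differentiable,
  whereas \<open>g i\<close> after \<open>a\<close> may involve the increments of all members of the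
  family.\<close>

definition carries ::
  "'i set \<Rightarrow> ('i \<Rightarrow> 'a::real_inner \<Rightarrow> real) \<Rightarrow> 'a \<Rightarrow> 'a \<Rightarrow> ('a \<Rightarrow> 'a) \<Rightarrow> bool"
where
  "carries I g p q a \<longleftrightarrow> a p = q \<and> isCont a p \<and> rel_diff {} g a p \<and>
     (\<forall>i\<in>I. rel_diff I g (\<lambda>x. g i (a x)) p)"

lemma lin_swap: "lin I g l c (y, x) = - lin I g l c (x, y)"
  by (simp add: lin_def inner_diff_right sum_negf[symmetric] right_diff_distrib sum_subtractf)

lemma osc_swap: "osc I g (y, x) = osc I g (x, y)"
  by (simp add: osc_def norm_minus_commute abs_minus_commute)

text \<open>Duality of the sup norm on the coefficients with the l^1 distance
  \<open>osc\<close>.\<close>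

lemma lin_approx:
  assumes "finite I" "\<And>i. i \<in> I \<Longrightarrow> \<bar>l' i - l i\<bar> \<le> e" "norm (c' - c) \<le> e"
  shows "\<bar>lin I g l' c' z - lin I g l c z\<bar> \<le> e * osc I g z"
proof -
  have "lin I g l' c' z - lin I g l c z
      = (\<Sum>i\<in>I. (l' i - l i) * (g i (fst z) - g i (snd z))) - (c' - c) \<bullet> (fst z - snd z)"
    by (simp add: lin_def inner_diff_left sum_subtractf left_diff_distrib)
  also have "\<bar>\<dots>\<bar> \<le> \<bar>\<Sum>i\<in>I. (l' i - l i) * (g i (fst z) - g i (snd z))\<bar> + \<bar>(c' - c) \<bullet> (fst z - snd z)\<bar>"
    by (rule abs_triangle_ineq4)
  also have "\<dots> \<le> (\<Sum>i\<in>I. e * \<bar>g i (fst z) - g i (snd z)\<bar>) + e * norm (fst z - snd z)"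
  proof (rule add_mono)
    have "\<bar>\<Sum>i\<in>I. (l' i - l i) * (g i (fst z) - g i (snd z))\<bar> \<le> (\<Sum>i\<in>I. \<bar>(l' i - l i) * (g i (fst z) - g i (snd z))\<bar>)"
      by (rule sum_abs)
    also have "\<dots> \<le> (\<Sum>i\<in>I. e * \<bar>g i (fst z) - g i (snd z)\<bar>)"
      by (rule sum_mono) (simp add: abs_mult assms mult_right_mono)
    finally show "\<bar>\<Sum>i\<in>I. (l' i - l i) * (g i (fst z) - g i (snd z))\<bar> \<le> (\<Sum>i\<in>I. e * \<bar>g i (fst z) - g i (snd z)\<bar>)" .
    have "\<bar>(c' - c) \<bullet> (fst z - snd z)\<bar> \<le> norm (c' - c) * norm (fst z - snd z)"
      by (rule Cauchy_Schwarz_ineq2)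
    also have "\<dots> \<le> e * norm (fst z - snd z)"
      by (rule mult_right_mono) (auto simp: assms)
    finally show "\<bar>(c' - c) \<bullet> (fst z - snd z)\<bar> \<le> e * norm (fst z - snd z)" .
  qed
  also have "\<dots> = e * osc I g z"
    by (simp add: osc_def sum_distrib_left distrib_left)
  finally show ?thesis .
qed

lemma filterlim_diag_map:
  assumes "isCont a p" "a p = q"
  shows "filterlim (\<lambda>z. (a (fst z), a (snd z))) (nhds (q, q)) (nhds (p, p))"
  using tendsto_Pair[OF tendsto_fst_snd_nhds[OF assms(1)]] by (simp add: assms(2))

lemma filterlim_slice: "filterlim (\<lambda>x. (x, p)) (nhds (p, p)) (nhds p)"
  by (rule tendsto_Pair) (auto intro: filterlim_ident)

text \<open>A relative expansion is bounded by a multiple of \<open>osc\<close>, so the induced map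
  of graph points is Lipschitz near \<open>p\<close> in the graph distance.\<close>

lemma osc_pullback:
  assumes "finite I" "carries I g p q a"
  obtains K where "K > 0" "eventually (\<lambda>z. osc I g (a (fst z), a (snd z)) \<le> K * osc I g z) (nhds (p, p))"
proof -
  have "bounded_wrt (nhds (p, p)) (osc I g) (\<lambda>z. norm (a (fst z) - a (snd z)))"
    using assms expands_imp_bounded[OF _ expands_mono, of I "{}" g p "\<lambda>z. a (fst z) - a (snd z)"]
    by (simp add: carries_def rel_diff_def bounded_wrt_def)
  moreover have "bounded_wrt (nhds (p, p)) (osc I g) (\<lambda>z. \<Sum>i\<in>I. \<bar>g i (a (fst z)) - g i (a (snd z))\<bar>)"
  proof (rule bounded_wrt_sum)
    fix i assume "i \<in> I"
    then have "expands I g p (\<lambda>z. g i (a (fst z)) - g i (a (snd z)))"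
      using assms by (simp add: carries_def rel_diff_def)
    then show "bounded_wrt (nhds (p, p)) (osc I g) (\<lambda>z. \<bar>g i (a (fst z)) - g i (a (snd z))\<bar>)"
      using expands_imp_bounded[OF assms(1)] by (fastforce simp: bounded_wrt_def)
  qed
  ultimately have "bounded_wrt (nhds (p, p)) (osc I g) (\<lambda>z. osc I g (a (fst z), a (snd z)))"
    by (auto dest: bounded_wrt_add simp: osc_def)
  then obtain K where "eventually (\<lambda>z. osc I g (a (fst z), a (snd z)) \<le> K * osc I g z) (nhds (p, p))"
    by (auto simp: bounded_wrt_def)
  then have "eventually (\<lambda>z. osc I g (a (fst z), a (snd z)) \<le> (\<bar>K\<bar> + 1) * osc I g z) (nhds (p, p))"
  proof eventually_elim
    case (elim z)
    then show ?case using mult_right_mono[of K "\<bar>K\<bar> + 1" "osc I g z"] by fastforce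
  qed
  then show thesis by (intro that[of "\<bar>K\<bar> + 1"]) auto
qed

text \<open>Transport mixes the components: even a functional that sees one \<open>g i\<close> turns
  into one with arbitrary coefficients, but it stays in the same class up to a negligible
  error.\<close>

lemma lin_pullback:
  fixes g :: "'i \<Rightarrow> 'a::euclidean_space \<Rightarrow> real"
  assumes "finite I" "carries I g p q a"
  obtains l' c' where "negligible_wrt (nhds (p, p)) (osc I g)
     (\<lambda>z. lin I g l c (a (fst z), a (snd z)) - lin I g l' c' z)"
proof -
  have "expands I g p (\<lambda>z. (\<Sum>i\<in>I. l i * (g i (a (fst z)) - g i (a (snd z)))) + (- c) \<bullet> (a (fst z) - a (snd z)))"
  proof (intro expands_add expands_sum)
    fix i assume "i \<in> I"
    then show "expands I g p (\<lambda>z. l i * (g i (a (fst z)) - g i (a (snd z))))"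
      using assms by (intro expands_bounded_linear[OF _ bounded_linear_mult_right])
        (auto simp: carries_def rel_diff_def)
  next
    show "expands I g p (\<lambda>z. (- c) \<bullet> (a (fst z) - a (snd z)))"
      using assms by (intro expands_bounded_linear[OF _ bounded_linear_inner_right] expands_mono[of I "{}"])
        (auto simp: carries_def rel_diff_def)
  qed
  then obtain c1 l1 where c1: "bounded_linear c1"
    and n: "negligible_wrt (nhds (p, p)) (osc I g) (\<lambda>z. lin I g l c (a (fst z), a (snd z)) -
              (c1 (fst z - snd z) + (\<Sum>i\<in>I. (g i (fst z) - g i (snd z)) *\<^sub>R l1 i)))"
    by (auto simp: expands_def lin_def)
  \<comment> \<open>The Riesz vector of the linear form \<open>c1\<close>; its sign is reversed
    below because \<open>lin\<close> subtracts the inner product.\<close>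
  have "c1 x = adjoint c1 1 \<bullet> x" for x
    using adjoint_works[OF bounded_linear.linear[OF c1], of x 1] by (simp add: inner_commute)
  then have "c1 (fst z - snd z) + (\<Sum>i\<in>I. (g i (fst z) - g i (snd z)) *\<^sub>R l1 i)
      = lin I g l1 (- adjoint c1 1) z" for z
    by (simp add: lin_def mult.commute)
  with n show thesis by (intro that[of l1 "- adjoint c1 1"]) simp
qed

lemma touched_above_pullback:
  assumes "finite I" "carries I g p q a" "touched_above I g q l c"
    and n: "negligible_wrt (nhds (p, p)) (osc I g) (\<lambda>z. lin I g l c (a (fst z), a (snd z)) - lin I g l' c' z)"
  shows "touched_above I g p l' c'"
  unfolding touched_above_def
proof (intro allI impI)
  fix e :: real assume e: "e > 0"
  obtain K where K: "K > 0" "eventually (\<lambda>z. osc I g (a (fst z), a (snd z)) \<le> K * osc I g z) (nhds (p, p))"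
    using osc_pullback[OF assms(1,2)] by blast
  have a: "a p = q" "isCont a p" using assms(2) by (auto simp: carries_def)
  then have al: "filterlim a (nhds q) (nhds p)"
    by (auto simp: continuous_at tendsto_at_iff_tendsto_nhds)
  \<comment> \<open>Half of \<open>e\<close> pays for the contact at \<open>q\<close>, stretched by
    \<open>K\<close> under \<open>a\<close>; the other half pays for the remainder of the
    pullback.\<close>
  have "eventually (\<lambda>y. lin I g l c (y, q) \<le> e/(2*K) * osc I g (y, q)) (nhds q)"
    using assms(3)[unfolded touched_above_def, rule_format, of "e/(2*K)"] e K(1) by simp
  then have "eventually (\<lambda>x. lin I g l c (a x, q) \<le> e/(2*K) * osc I g (a x, q)) (nhds p)"
    using al by (rule eventually_compose_filterlim)
  moreover have "eventually (\<lambda>x. osc I g (a x, q) \<le> K * osc I g (x, p)) (nhds p)"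
    using eventually_compose_filterlim[OF K(2) filterlim_slice] by (simp add: a)
  moreover have "eventually (\<lambda>x. norm (lin I g l c (a x, q) - lin I g l' c' (x, p)) \<le> e/2 * osc I g (x, p)) (nhds p)"
    using eventually_compose_filterlim[OF negligible_wrtD[OF n, of "e/2"] filterlim_slice] e by (simp add: a)
  ultimately show "eventually (\<lambda>x. lin I g l' c' (x, p) \<le> e * osc I g (x, p)) (nhds p)"
  proof eventually_elim
    case (elim x)
    have "e/(2*K) * osc I g (a x, q) \<le> e/(2*K) * (K * osc I g (x, p))"
      using elim(2) e K(1) by (intro mult_left_mono) auto
    also have "\<dots> = e/2 * osc I g (x, p)" using K(1) by simp
    finally have "lin I g l c (a x, q) \<le> e/2 * osc I g (x, p)" using elim(1) by linarith
    moreover have "lin I g l' c' (x, p) \<le> lin I g l c (a x, q) + e/2 * osc I g (x, p)"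
      using elim(3) unfolding real_norm_def abs_le_iff by linarith
    ultimately show ?case by simp
  qed
qed

text \<open>Flatness travels in the direction opposite to contact, by writing points near
  \<open>q\<close> as \<open>a (b y)\<close>. One \<open>e\<close> is the flatness at
  \<open>p\<close>, the second one the remainder of the pullback, and \<open>K\<close> is the
  stretching by \<open>b\<close>.\<close>

lemma flat_at_pushforward:
  assumes "finite I" "carries I g p q a" "carries I g q p b" "eventually (\<lambda>y. a (b y) = y) (nhds q)"
    and n: "negligible_wrt (nhds (p, p)) (osc I g) (\<lambda>z. lin I g l c (a (fst z), a (snd z)) - lin I g l' c' z)"
    and K: "eventually (\<lambda>z. osc I g (b (fst z), b (snd z)) \<le> K * osc I g z) (nhds (q, q))"
    and flat: "flat_at I g p e l' c'" and e: "e > 0"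
  shows "flat_at I g q (2 * e * K) l c"
proof -
  have b: "filterlim (\<lambda>z. (b (fst z), b (snd z))) (nhds (p, p)) (nhds (q, q))"
    using assms(3) by (intro filterlim_diag_map) (auto simp: carries_def)
  have "eventually (\<lambda>z. a (b (fst z)) = fst z \<and> a (b (snd z)) = snd z) (nhds (q, q))"
    unfolding nhds_prod eventually_prod_same using assms(4) by auto
  moreover note K
  moreover have "eventually (\<lambda>z. \<bar>lin I g l' c' (b (fst z), b (snd z))\<bar> \<le> e * osc I g (b (fst z), b (snd z))) (nhds (q, q))"
    using eventually_compose_filterlim[OF flat[unfolded flat_at_def] b] by simp
  moreover have "eventually (\<lambda>z. \<bar>lin I g l c (a (b (fst z)), a (b (snd z))) - lin I g l' c' (b (fst z), b (snd z))\<bar>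
       \<le> e * osc I g (b (fst z), b (snd z))) (nhds (q, q))"
    using eventually_compose_filterlim[OF negligible_wrtD[OF n e] b] by simp
  ultimately show ?thesis unfolding flat_at_def
  proof eventually_elim
    case (elim z)
    have "\<bar>lin I g l c z\<bar> \<le> 2 * e * osc I g (b (fst z), b (snd z))"
      using elim(1,3,4) by simp
    also have "\<dots> \<le> 2 * e * (K * osc I g z)"
      using elim(2) e by (intro mult_left_mono) auto
    finally show ?case by simp
  qed
qed

lemma continuous_on_lin:
  assumes "\<And>i. i \<in> I \<Longrightarrow> continuous_on \<Omega> (g i)"
  shows "continuous_on \<Omega> (\<lambda>p. lin I g l c (x, p))" "continuous_on \<Omega> (\<lambda>p. osc I g (x, p))"
  unfolding lin_def osc_def
  by (intro continuous_intros | simp add: assms)+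

text \<open>
  One-sided information at a single point becomes two-sided: transported to every point, it holds
  with uniform constants on a set that is dense in a ball, hence on the ball, where the two points
  of the estimate may be exchanged.
\<close>

lemma touched_above_imp_flat:
  fixes g :: "'i \<Rightarrow> 'a::euclidean_space \<Rightarrow> real"
  assumes "open \<Omega>" "finite I" and cont: "\<And>i. i \<in> I \<Longrightarrow> continuous_on \<Omega> (g i)"
    and hom: "\<And>p. p \<in> \<Omega> \<Longrightarrow> \<exists>a b. carries I g p q a \<and> carries I g q p b \<and> eventually (\<lambda>y. a (b y) = y) (nhds q)"
    and "q \<in> \<Omega>" and touch: "touched_above I g q l c" and e: "e > 0"
  shows "flat_at I g q e l c"
proof -
  \<comment> \<open>The constant \<open>K\<close> does not depend on the accuracy \<open>d\<close>,
    so a sufficiently small \<open>d\<close> at \<open>p\<close> can compensate for it.\<close>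
  have "\<exists>l' c' K. K > 0 \<and> touched_above I g p l' c' \<and>
      (\<forall>d>0. flat_at I g p d l' c' \<longrightarrow> flat_at I g q (2 * d * K) l c)" if p: "p \<in> \<Omega>" for p
  proof -
    obtain a b where ab: "carries I g p q a" "carries I g q p b" "eventually (\<lambda>y. a (b y) = y) (nhds q)"
      using hom[OF p] by blast
    obtain l' c' where n: "negligible_wrt (nhds (p, p)) (osc I g) (\<lambda>z. lin I g l c (a (fst z), a (snd z)) - lin I g l' c' z)"
      using lin_pullback[OF assms(2) ab(1)] by blast
    obtain K where K: "K > 0" "eventually (\<lambda>z. osc I g (b (fst z), b (snd z)) \<le> K * osc I g z) (nhds (q, q))"
      using osc_pullback[OF assms(2) ab(2)] by blast
    show ?thesis
      using K(1) touched_above_pullback[OF assms(2) ab(1) touch n]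
        flat_at_pushforward[OF assms(2) ab n K(2)] by blast
  qed
  then obtain lp cp Kp where P: "\<And>p. p \<in> \<Omega> \<Longrightarrow> Kp p > 0"
      "\<And>p. p \<in> \<Omega> \<Longrightarrow> touched_above I g p (lp p) (cp p)"
      "\<And>p d. p \<in> \<Omega> \<Longrightarrow> d > 0 \<Longrightarrow> flat_at I g p d (lp p) (cp p) \<Longrightarrow> flat_at I g q (2 * d * Kp p) l c"
    by metis
  obtain D :: "('i \<Rightarrow> real) set" where D: "countable D"
    "\<And>l e. e > 0 \<Longrightarrow> \<exists>l'\<in>D. \<forall>i\<in>I. \<bar>l' i - l i\<bar> \<le> e"
    using countable_dense_on_finite[OF assms(2)] by blast
  obtain C :: "'a set" where C: "countable C" "\<And>X. open X \<Longrightarrow> X \<noteq> {} \<Longrightarrow> \<exists>d\<in>C. d \<in> X"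
    using countable_dense_exists by blast
  \<comment> \<open>On a piece with index \<open>n\<close> the stretching is at most n + 1 and
    flatness holds with error \<open>3 * d n\<close>; the pushforward then gives error at most 6 (n
    + 1) times \<open>d n\<close>, which is \<open>e\<close>.\<close>
  define d where "d = (\<lambda>n::nat. e / (6 * real (Suc n)))"
  have d: "d n > 0" for n using e by (simp add: d_def)
  \<comment> \<open>Countably many pieces make the data uniform: stretching at most n + 1, slopes
    close to one pair from a countable dense set, and one radius 1 / (m + 1) for the one-sided
    estimate.\<close>
  define S where "S = (\<lambda>(n::nat, l', c', m::nat). {p \<in> \<Omega>. Kp p \<le> real (Suc n) \<and>
      (\<forall>i\<in>I. \<bar>l' i - lp p i\<bar> \<le> d n) \<and> norm (c' - cp p) \<le> d n \<and>
      (\<forall>x\<in>\<Omega>. dist x p < inverse (real (Suc m)) \<longrightarrow> lin I g l' c' (x, p) \<le> 2 * d n * osc I g (x, p))})"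
  have cover: "\<Omega> \<subseteq> (\<Union>j \<in> UNIV \<times> D \<times> C \<times> UNIV. S j)"
  proof
    fix p assume p: "p \<in> \<Omega>"
    obtain n where n: "Kp p < real n" using reals_Archimedean2 by blast
    obtain l' where l': "l' \<in> D" "\<forall>i\<in>I. \<bar>l' i - lp p i\<bar> \<le> d n" using D(2)[OF d] by blast
    obtain c' where c': "c' \<in> C" "c' \<in> ball (cp p) (d n)" using C(2)[of "ball (cp p) (d n)"] d[of n] by (metis ball_eq_empty not_le open_ball)
    have nc: "norm (c' - cp p) \<le> d n" using c'(2) by (simp add: dist_norm norm_minus_commute)
    have "eventually (\<lambda>x. lin I g (lp p) (cp p) (x, p) \<le> d n * osc I g (x, p)) (nhds p)"
      using P(2)[OF p] d by (simp add: touched_above_def)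
    then obtain r where r: "r > 0" "\<And>x. dist x p < r \<Longrightarrow> lin I g (lp p) (cp p) (x, p) \<le> d n * osc I g (x, p)"
      by (auto simp: eventually_nhds_metric)
    obtain m where m: "inverse (real (Suc m)) < r" using reals_Archimedean[OF r(1)] by blast
    have "lin I g l' c' (x, p) \<le> 2 * d n * osc I g (x, p)" if "dist x p < inverse (real (Suc m))" for x
      using r(2)[of x] that m lin_approx[OF assms(2), of l' "lp p" "d n" c' "cp p" g "(x, p)"] l'(2) nc
      by simp
    then have "p \<in> S (n, l', c', m)" using p n l'(2) nc by (auto simp: S_def)
    then show "p \<in> (\<Union>j \<in> UNIV \<times> D \<times> C \<times> UNIV. S j)" using l'(1) c'(1) by blast
  qed
  have "\<Omega> \<noteq> {}" "countable ((UNIV::nat set) \<times> D \<times> C \<times> (UNIV::nat set))"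
    using \<open>q \<in> \<Omega>\<close> D(1) C(1) by auto
  then obtain j p r where "p \<in> S j" "r > 0" "ball p r \<subseteq> \<Omega>" "ball p r \<subseteq> closure (S j)"
    using Baire_countable_cover[OF assms(1) _ _ cover] by metis
  moreover obtain n l' c' m where "j = (n, l', c', m)" by (cases j)
  ultimately have B: "p \<in> S (n, l', c', m)" "r > 0" "ball p r \<subseteq> \<Omega>" "ball p r \<subseteq> closure (S (n, l', c', m))"
    by simp_all
  have pS: "p \<in> \<Omega>" "Kp p \<le> real (Suc n)" "\<And>i. i \<in> I \<Longrightarrow> \<bar>l' i - lp p i\<bar> \<le> d n" "norm (c' - cp p) \<le> d n"
    using B(1) by (auto simp: S_def)
  \<comment> \<open>Half the radius, so that any two points of the ball are within the common radius
    of each other.\<close>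
  define s where "s = min r (inverse (real (Suc m)) / 2)"
  have s: "s > 0" "s \<le> r" using B(2) by (auto simp: s_def)
  \<comment> \<open>The second point lies only in the closure of the piece; the inequality for fixed
    slopes and fixed radius passes to the limit since the \<open>g i\<close> are continuous.\<close>
  have one_sided: "lin I g l' c' (x, y) \<le> 2 * d n * osc I g (x, y)" if "x \<in> ball p s" "y \<in> ball p s" for x y
  proof -
    have xy: "x \<in> \<Omega>" "y \<in> \<Omega>" "y \<in> closure (S (n, l', c', m))" using that s B(3,4) by auto
    have "dist x y < inverse (real (Suc m))"
    proof -
      have "dist x y \<le> dist p x + dist p y" by (rule dist_triangle3)
      also have "\<dots> < s + s" using that by simp
      also have "\<dots> \<le> inverse (real (Suc m))" by (simp add: s_def)
      finally show ?thesis .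
    qed
    obtain w where w: "\<And>k. w k \<in> S (n, l', c', m)" "w \<longlonglongrightarrow> y"
      using xy(3) by (auto simp: closure_sequential)
    have w\<Omega>: "w k \<in> \<Omega>" for k using w(1)[of k] by (auto simp: S_def)
    have "(\<lambda>k. dist x (w k)) \<longlonglongrightarrow> dist x y" by (intro tendsto_intros w)
    then have "\<forall>\<^sub>F k in sequentially. dist x (w k) < inverse (real (Suc m))"
      using \<open>dist x y < _\<close> by (rule order_tendstoD)
    then have ev: "\<forall>\<^sub>F k in sequentially. lin I g l' c' (x, w k) \<le> 2 * d n * osc I g (x, w k)"
      by eventually_elim (use w(1) xy(1) in \<open>auto simp: S_def\<close>)
    have "(\<lambda>k. lin I g l' c' (x, w k)) \<longlonglongrightarrow> lin I g l' c' (x, y)"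
      by (rule continuous_on_tendsto_compose[OF continuous_on_lin(1)[OF cont] w(2) xy(2)]) (auto simp: w\<Omega>)
    moreover have "(\<lambda>k. 2 * d n * osc I g (x, w k)) \<longlonglongrightarrow> 2 * d n * osc I g (x, y)"
      by (intro tendsto_intros continuous_on_tendsto_compose[OF continuous_on_lin(2)[OF cont] w(2) xy(2)]) (auto simp: w\<Omega>)
    ultimately show ?thesis using ev by (intro tendsto_le[OF sequentially_bot])
  qed
  \<comment> \<open>Exchanging the points changes the sign of \<open>lin\<close> and leaves
    \<open>osc\<close> alone. The third \<open>d n\<close> pays for returning from the dense pair to
    the true slopes at the centre, which is possible because the centre belongs to the
    piece.\<close>
  have two_sided: "\<bar>lin I g (lp p) (cp p) (x, y)\<bar> \<le> 3 * d n * osc I g (x, y)" if "x \<in> ball p s" "y \<in> ball p s" for x y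
    using one_sided[OF that] one_sided[OF that(2,1)]
      lin_approx[OF assms(2), of l' "lp p" "d n" c' "cp p" g "(x, y)"] pS(3,4)
    by (simp add: lin_swap[of I g l' c' y x] osc_swap[of I g y x])
  have "flat_at I g p (3 * d n) (lp p) (cp p)"
    unfolding flat_at_def nhds_prod eventually_prod_same
    by (rule exI[of _ "\<lambda>x. x \<in> ball p s"])
       (use two_sided s eventually_nhds_in_open[of "ball p s" p] in auto)
  then have "flat_at I g q (2 * (3 * d n) * Kp p) l c"
    using d[of n] by (intro P(3)[OF pS(1)]) auto
  moreover have "2 * (3 * d n) * Kp p \<le> e"
  proof -
    have "2 * (3 * d n) * Kp p \<le> 2 * (3 * d n) * real (Suc n)"
      using d[of n] pS(2) by (intro mult_left_mono) auto
    also have "\<dots> = e" by (simp add: d_def del: of_nat_Suc)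
    finally show ?thesis .
  qed
  ultimately show ?thesis unfolding flat_at_def
    by (elim eventually_mono) (meson mult_right_mono order_trans osc_nonneg)
qed

lemma exists_touched_above:
  fixes g :: "'i \<Rightarrow> 'a::euclidean_space \<Rightarrow> real"
  assumes "open \<Omega>" "finite I" "i \<in> I" "continuous_on \<Omega> (g i)" "x0 \<in> \<Omega>" "r > 0"
  obtains q c where "q \<in> \<Omega>" "dist x0 q < r" "touched_above I g q (\<lambda>j. if j = i then 1 else 0) c"
proof -
  obtain s where s: "s > 0" "cball x0 s \<subseteq> \<Omega>" using assms(1,5) open_contains_cball by blast
  define t where "t = min s (r/2)"
  have t: "t > 0" "cball x0 t \<subseteq> \<Omega>" "t < r" using s assms(6) by (auto simp: t_def)
  have cont: "continuous_on (cball x0 t) (g i)" using assms(4) t(2) continuous_on_subset by blast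
  have "bounded (g i ` cball x0 t)"
    by (intro compact_imp_bounded compact_continuous_image cont) simp
  then obtain M where "\<forall>x\<in>cball x0 t. \<bar>g i x\<bar> \<le> M" by (auto simp: bounded_iff)
  then have M: "\<And>x. x \<in> cball x0 t \<Longrightarrow> \<bar>g i x\<bar> \<le> M" by blast
  have M0: "M \<ge> 0" using M[of x0] t(1) by force
  \<comment> \<open>On the sphere of radius \<open>t\<close> the penalty equals 2 M + 1, more than
    the largest possible gain 2 M of \<open>g i\<close>, so the maximum is attained in the
    interior.\<close>
  define R where "R = (2 * M + 1) / t\<^sup>2"
  have R: "R > 0" using M0 t(1) by (simp add: R_def add_nonneg_pos)
  define h where "h = (\<lambda>x. g i x - R * (dist x0 x)\<^sup>2)"
  have "continuous_on (cball x0 t) h" unfolding h_def by (intro continuous_intros cont)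
  then obtain q where q: "q \<in> cball x0 t" "\<And>x. x \<in> cball x0 t \<Longrightarrow> h x \<le> h q"
    using continuous_attains_sup[of "cball x0 t" h] t(1) by auto
  have "dist x0 q < t"
  proof (rule ccontr)
    assume "\<not> dist x0 q < t"
    then have "dist x0 q = t" using q(1) by simp
    then have "h q = g i q - (2 * M + 1)" using t(1) by (simp add: h_def R_def)
    then show False using q(2)[of x0] M[OF q(1)] M[of x0] t(1) by (simp add: h_def)
  qed
  have sum_delta: "(\<Sum>j\<in>I. (if j = i then 1 else 0) * (g j x - g j q)) = g i x - g i q" for x
    using assms(2,3) by (simp add: if_distrib if_distribR sum.delta cong: if_cong)
  \<comment> \<open>The slope is the gradient of the paraboloid at \<open>q\<close>; what remains is
    the quadratic error \<open>R\<close> times the squared distance.\<close>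
  have "touched_above I g q (\<lambda>j. if j = i then 1 else 0) ((2 * R) *\<^sub>R (q - x0))"
    unfolding touched_above_def
  proof (intro allI impI)
    fix e :: real assume e: "e > 0"
    have "eventually (\<lambda>x. x \<in> ball x0 t) (nhds q)" "eventually (\<lambda>x. x \<in> ball q (e / R)) (nhds q)"
      using \<open>dist x0 q < t\<close> e R by (intro eventually_nhds_in_open; simp)+
    then show "eventually (\<lambda>x. lin I g (\<lambda>j. if j = i then 1 else 0) ((2 * R) *\<^sub>R (q - x0)) (x, q) \<le> e * osc I g (x, q)) (nhds q)"
    proof eventually_elim
      case (elim x)
      have "g i x - g i q \<le> R * ((dist x0 x)\<^sup>2 - (dist x0 q)\<^sup>2)"
        using q(2)[of x] elim(1) by (simp add: h_def algebra_simps)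
      also have "(dist x0 x)\<^sup>2 - (dist x0 q)\<^sup>2 = 2 * ((q - x0) \<bullet> (x - q)) + (norm (x - q))\<^sup>2"
        by (simp add: dist_norm power2_norm_eq_inner inner_diff_left inner_diff_right inner_commute)
      finally have "lin I g (\<lambda>j. if j = i then 1 else 0) ((2 * R) *\<^sub>R (q - x0)) (x, q) \<le> R * (norm (x - q))\<^sup>2"
        unfolding lin_def fst_conv snd_conv sum_delta by (simp add: algebra_simps)
      also have "\<dots> = (R * norm (x - q)) * norm (x - q)" by (simp add: power2_eq_square)
      also have "\<dots> \<le> e * osc I g (x, q)"
      proof (rule mult_mono)
        show "R * norm (x - q) \<le> e" using elim(2) R by (simp add: dist_norm norm_minus_commute field_simps)
        show "norm (x - q) \<le> osc I g (x, q)" using osc_ge_norm[of "(x, q)"] by simp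
      qed (use e in auto)
      finally show ?case .
    qed
  qed
  moreover have "q \<in> \<Omega>" "dist x0 q < r" using q(1) t(2,3) by auto
  ultimately show thesis using that by blast
qed

section \<open>From approximate flatness to strict differentiability and C^1\<close>

text \<open>The slope may depend on the accuracy, but two slopes that both fit near \<open>q\<close>
  are close to each other. So the slopes for accuracies 1 / (n + 1) form a Cauchy sequence, and
  their limit fits for every accuracy.\<close>

lemma rel_diff_of_approx:
  fixes u :: "'a::euclidean_space \<Rightarrow> real"
  assumes "\<And>e. e > 0 \<Longrightarrow> \<exists>c. eventually (\<lambda>z. \<bar>u (fst z) - u (snd z) - c \<bullet> (fst z - snd z)\<bar> \<le> e * norm (fst z - snd z)) (nhds (q, q))"
  shows "rel_diff {} g u q"
proof -
  have "\<forall>n. \<exists>c. eventually (\<lambda>z. \<bar>u (fst z) - u (snd z) - c \<bullet> (fst z - snd z)\<bar> \<le> inverse (real (Suc n)) * norm (fst z - snd z)) (nhds (q, q))"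
    by (intro allI assms) simp
  from choice[OF this] obtain c where c: "\<And>n. eventually (\<lambda>z. \<bar>u (fst z) - u (snd z) - c n \<bullet> (fst z - snd z)\<bar> \<le> inverse (real (Suc n)) * norm (fst z - snd z)) (nhds (q, q))"
    by blast
  have dist_c: "norm (c n - c m) \<le> inverse (real (Suc n)) + inverse (real (Suc m))" for n m
  proof (cases "c n = c m")
    case False
    \<comment> \<open>Both estimates are tested in the direction of the difference itself, where the
      two linear forms differ by the square of its norm.\<close>
    define h where "h = c n - c m"
    have h: "norm h > 0" using False by (simp add: h_def)
    have "((\<lambda>t. q + t *\<^sub>R h) \<longlongrightarrow> q + 0 *\<^sub>R h) (at_right (0::real))" by (intro tendsto_intros)
    then have "filterlim (\<lambda>t. (q + t *\<^sub>R h, q)) (nhds (q, q)) (at_right (0::real))"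
      by (intro tendsto_Pair) auto
    from eventually_compose_filterlim[OF eventually_conj[OF c[of n] c[of m]] this]
    have "eventually (\<lambda>t. \<bar>u (q + t *\<^sub>R h) - u q - c n \<bullet> (t *\<^sub>R h)\<bar> \<le> inverse (real (Suc n)) * norm (t *\<^sub>R h) \<and>
      \<bar>u (q + t *\<^sub>R h) - u q - c m \<bullet> (t *\<^sub>R h)\<bar> \<le> inverse (real (Suc m)) * norm (t *\<^sub>R h)) (at_right 0)"
      by simp
    moreover have "eventually (\<lambda>t::real. t > 0) (at_right 0)" by (simp add: eventually_at_right_less)
    ultimately have "eventually (\<lambda>t. norm h \<le> inverse (real (Suc n)) + inverse (real (Suc m))) (at_right (0::real))"
    proof eventually_elim
      case (elim t)
      have "h \<bullet> (t *\<^sub>R h) = c n \<bullet> (t *\<^sub>R h) - c m \<bullet> (t *\<^sub>R h)" by (simp add: h_def inner_diff_left right_diff_distrib)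
      also have "\<dots> \<le> (inverse (real (Suc n)) + inverse (real (Suc m))) * norm (t *\<^sub>R h)"
        using elim(1) unfolding distrib_right abs_le_iff by linarith
      finally have "t * (norm h * norm h) \<le> t * ((inverse (real (Suc n)) + inverse (real (Suc m))) * norm h)"
        using elim(2) by (simp add: power2_norm_eq_inner[symmetric] power2_eq_square algebra_simps)
      then show ?case using elim(2) h by simp
    qed
    then show ?thesis by (simp add: h_def)
  qed (simp add: add_nonneg_nonneg)
  have "Cauchy c"
  proof (rule metric_CauchyI)
    fix e :: real assume "e > 0"
    then obtain N where N: "inverse (real (Suc N)) < e/2" using reals_Archimedean[of "e/2"] by auto
    have "dist (c m) (c n) < e" if "m \<ge> N" "n \<ge> N" for m n
    proof -
      have "inverse (real (Suc m)) \<le> inverse (real (Suc N))" "inverse (real (Suc n)) \<le> inverse (real (Suc N))"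
        using that by (auto intro!: le_imp_inverse_le simp del: of_nat_Suc)
      then show ?thesis using dist_c[of m n] N unfolding dist_norm by linarith
    qed
    then show "\<exists>M. \<forall>m\<ge>M. \<forall>n\<ge>M. dist (c m) (c n) < e" by blast
  qed
  then obtain C where C: "c \<longlonglongrightarrow> C" using Cauchy_convergent convergent_def by blast
  have "norm (c n - C) \<le> inverse (real (Suc n))" for n
  proof (rule tendsto_le[OF sequentially_bot])
    show "(\<lambda>m. norm (c n - c m)) \<longlonglongrightarrow> norm (c n - C)" by (intro tendsto_intros C)
    show "(\<lambda>m. inverse (real (Suc n)) + inverse (real (Suc m))) \<longlonglongrightarrow> inverse (real (Suc n))"
      using tendsto_add[OF tendsto_const LIMSEQ_inverse_real_of_nat] by simp
  qed (use dist_c in auto)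
  note C_bound = this
  have "negligible_wrt (nhds (q, q)) (osc {} g) (\<lambda>z. u (fst z) - u (snd z) - C \<bullet> (fst z - snd z))"
    unfolding negligible_wrt_def
  proof (intro allI impI)
    fix e :: real assume "e > 0"
    then obtain N where N: "inverse (real (Suc N)) < e/2" using reals_Archimedean[of "e/2"] by auto
    show "eventually (\<lambda>z. norm (u (fst z) - u (snd z) - C \<bullet> (fst z - snd z)) \<le> e * osc {} g z) (nhds (q, q))"
      using c[of N]
    proof eventually_elim
      case (elim z)
      have "\<bar>(c N - C) \<bullet> (fst z - snd z)\<bar> \<le> norm (c N - C) * norm (fst z - snd z)"
        by (rule Cauchy_Schwarz_ineq2)
      also have "\<dots> \<le> inverse (real (Suc N)) * norm (fst z - snd z)"
        by (intro mult_right_mono C_bound) auto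
      finally have "\<bar>u (fst z) - u (snd z) - C \<bullet> (fst z - snd z)\<bar> \<le> (2 * inverse (real (Suc N))) * norm (fst z - snd z)"
        using elim unfolding inner_diff_left abs_le_iff by linarith
      also have "\<dots> \<le> e * norm (fst z - snd z)"
        using N by (intro mult_right_mono) auto
      finally show ?case by (simp add: osc_def)
    qed
  qed
  then show ?thesis unfolding rel_diff_def expands_def
    by (intro exI[of _ "\<lambda>x. C \<bullet> x"] exI) (simp add: bounded_linear_inner_right)
qed

text \<open>Flatness of all components with one small accuracy makes the family Lipschitz near
  \<open>q\<close>: the increments of the \<open>g i\<close> on the right are absorbed on the left.
  After that, \<open>osc\<close> is bounded by the norm of x - y, and flatness with arbitrary
  accuracy is approximate strict differentiability.\<close>

lemma rel_diff_of_flat: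
  fixes g :: "'i \<Rightarrow> 'a::euclidean_space \<Rightarrow> real"
  assumes "finite I"
    and flat: "\<And>i e. i \<in> I \<Longrightarrow> e > 0 \<Longrightarrow> \<exists>c. flat_at I g q e (\<lambda>j. if j = i then 1 else 0) c"
    and "i \<in> I"
  shows "rel_diff {} g (g i) q"
proof -
  have lin_eq: "lin I g (\<lambda>j. if j = i then 1 else 0) c z = g i (fst z) - g i (snd z) - c \<bullet> (fst z - snd z)"
    if "i \<in> I" for i c z
    using assms(1) that by (simp add: lin_def if_distrib if_distribR sum.delta cong: if_cong)
  \<comment> \<open>Summing over \<open>I\<close> gives \<open>card I * d\<close> times
    \<open>osc\<close>, at most half of \<open>osc\<close>, which can be absorbed; the absorption
    doubles the remaining terms and produces the factor 2 in \<open>K\<close>.\<close>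
  define d where "d = inverse (2 * real (card I) + 1)"
  have "card I * d \<le> 1/2" "d > 0" by (auto simp: d_def field_simps)
  obtain c where c: "\<And>i. i \<in> I \<Longrightarrow> flat_at I g q d (\<lambda>j. if j = i then 1 else 0) (c i)"
    using flat[OF _ \<open>d > 0\<close>] by metis
  define K where "K = 2 * (1 + (\<Sum>i\<in>I. norm (c i)))"
  have K: "K > 0" unfolding K_def by (simp add: add_pos_nonneg sum_nonneg)
  have "eventually (\<lambda>z. \<forall>i\<in>I. \<bar>lin I g (\<lambda>j. if j = i then 1 else 0) (c i) z\<bar> \<le> d * osc I g z) (nhds (q, q))"
    using c by (simp add: eventually_ball_finite_distrib[OF assms(1)] flat_at_def)
  then have lip: "eventually (\<lambda>z. osc I g z \<le> K * norm (fst z - snd z)) (nhds (q, q))"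
  proof eventually_elim
    case (elim z)
    have "(\<Sum>i\<in>I. \<bar>g i (fst z) - g i (snd z)\<bar>) \<le> (\<Sum>i\<in>I. norm (c i) * norm (fst z - snd z) + d * osc I g z)"
    proof (rule sum_mono)
      fix i assume i: "i \<in> I"
      have "\<bar>c i \<bullet> (fst z - snd z)\<bar> \<le> norm (c i) * norm (fst z - snd z)" by (rule Cauchy_Schwarz_ineq2)
      then show "\<bar>g i (fst z) - g i (snd z)\<bar> \<le> norm (c i) * norm (fst z - snd z) + d * osc I g z"
        using bspec[OF elim i] unfolding lin_eq[OF i] by linarith
    qed
    also have "\<dots> = (\<Sum>i\<in>I. norm (c i)) * norm (fst z - snd z) + card I * d * osc I g z"
      by (simp add: sum.distrib sum_distrib_right)
    also have "card I * d * osc I g z \<le> 1/2 * osc I g z"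
      using \<open>card I * d \<le> 1/2\<close> by (intro mult_right_mono) auto
    finally have "osc I g z \<le> norm (fst z - snd z) + (\<Sum>i\<in>I. norm (c i)) * norm (fst z - snd z) + 1/2 * osc I g z"
      unfolding osc_def[of I g z] by linarith
    then show ?case unfolding K_def by (simp add: algebra_simps)
  qed
  show ?thesis
  proof (rule rel_diff_of_approx)
    fix e :: real assume e: "e > 0"
    obtain c where "flat_at I g q (e / K) (\<lambda>j. if j = i then 1 else 0) c"
      using flat[OF \<open>i \<in> I\<close>, of "e / K"] e K by auto
    then have "eventually (\<lambda>z. \<bar>g i (fst z) - g i (snd z) - c \<bullet> (fst z - snd z)\<bar> \<le> e / K * osc I g z) (nhds (q, q))"
      by (simp add: flat_at_def lin_eq[OF \<open>i \<in> I\<close>])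
    with lip have "eventually (\<lambda>z. \<bar>g i (fst z) - g i (snd z) - c \<bullet> (fst z - snd z)\<bar> \<le> e * norm (fst z - snd z)) (nhds (q, q))"
    proof eventually_elim
      case (elim z)
      have "e / K * osc I g z \<le> e / K * (K * norm (fst z - snd z))"
        using elim(1) e K by (intro mult_left_mono) auto
      also have "\<dots> = e * norm (fst z - snd z)" using K by simp
      finally show ?case using elim(2) by linarith
    qed
    then show "\<exists>c. eventually (\<lambda>z. \<bar>g i (fst z) - g i (snd z) - c \<bullet> (fst z - snd z)\<bar> \<le> e * norm (fst z - snd z)) (nhds (q, q))"
      by blast
  qed
qed

lemma flat_at_nearby:
  assumes "flat_at I g q e l c"
  shows "eventually (\<lambda>q'. flat_at I g q' e l c) (nhds q)"
proof -
  obtain Q where Q: "eventually Q (nhds q)" "\<And>x y. Q x \<Longrightarrow> Q y \<Longrightarrow> \<bar>lin I g l c (x, y)\<bar> \<le> e * osc I g (x, y)"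
    using assms unfolding flat_at_def nhds_prod eventually_prod_same by auto
  have "eventually (\<lambda>q'. eventually Q (nhds q')) (nhds q)"
    using Q(1) by (simp add: eventually_eventually)
  then show ?thesis
    by eventually_elim (use Q(2) in \<open>auto simp: flat_at_def nhds_prod eventually_prod_same\<close>)
qed

text \<open>Once the generators are strictly differentiable, their increments are themselves linear
  up to a negligible error, and an expansion relative to them becomes an ordinary strict
  one.\<close>

lemma expands_absorb:
  assumes "finite I" "\<And>i. i \<in> I \<Longrightarrow> rel_diff {} g (g i) q" "expands I g q h"
  shows "expands {} g q h"
proof -
  obtain c l where c: "bounded_linear c"
    and n: "negligible_wrt (nhds (q, q)) (osc I g)
       (\<lambda>z. h z - (c (fst z - snd z) + (\<Sum>i\<in>I. (g i (fst z) - g i (snd z)) *\<^sub>R l i)))"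
      (is "negligible_wrt _ _ ?r")
    using assms(3) by (auto simp: expands_def)
  have gi: "expands {} g q (\<lambda>z. g i (fst z) - g i (snd z))" if "i \<in> I" for i
    using assms(2)[OF that] by (simp add: rel_diff_def)
  have lin: "expands {} g q (\<lambda>z. c (fst z - snd z))"
    unfolding expands_def by (intro exI[of _ c] exI) (simp add: c)
  have "bounded_wrt (nhds (q, q)) (osc {} g) (\<lambda>z. \<Sum>i\<in>I. \<bar>g i (fst z) - g i (snd z)\<bar>)"
    by (rule bounded_wrt_sum) (use expands_imp_bounded[OF _ gi] in \<open>fastforce simp: bounded_wrt_def\<close>)
  then obtain K where K: "eventually (\<lambda>z. (\<Sum>i\<in>I. \<bar>g i (fst z) - g i (snd z)\<bar>) \<le> K * osc {} g z) (nhds (q, q))"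
    by (auto simp: bounded_wrt_def sum_nonneg)
  have "negligible_wrt (nhds (q, q)) (osc {} g) ?r"
    unfolding negligible_wrt_def
  proof (intro allI impI)
    fix e :: real assume e: "e > 0"
    define d where "d = e / (\<bar>K\<bar> + 1)"
    have d: "d > 0" using e by (simp add: d_def add_nonneg_pos)
    from K negligible_wrtD[OF n d] show "eventually (\<lambda>z. norm (?r z) \<le> e * osc {} g z) (nhds (q, q))"
    proof eventually_elim
      case (elim z)
      have "osc I g z \<le> (\<bar>K\<bar> + 1) * osc {} g z"
        using elim(1) mult_right_mono[OF abs_ge_self[of K] osc_nonneg[of "{}" g z]]
        by (simp add: osc_def distrib_right)
      then have "d * osc I g z \<le> d * ((\<bar>K\<bar> + 1) * osc {} g z)"
        using d by (intro mult_left_mono) auto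
      also have "\<dots> = e * osc {} g z" by (simp add: d_def)
      finally show ?case using elim(2) by linarith
    qed
  qed
  then have "expands {} g q (\<lambda>z. ?r z + (c (fst z - snd z) + (\<Sum>i\<in>I. (g i (fst z) - g i (snd z)) *\<^sub>R l i)))"
    by (intro expands_add[OF expands_negligible] expands_add[OF lin] expands_sum
        expands_bounded_linear[OF gi bounded_linear_scaleR_left])
  then show ?thesis by simp
qed

lemma rel_diff_strict_compose:
  assumes "rel_diff {} g u q" "rel_diff {} g b p" "b p = q" "isCont b p"
  shows "rel_diff {} g (\<lambda>x. u (b x)) p"
proof -
  obtain c where c: "bounded_linear c"
    and n: "negligible_wrt (nhds (q, q)) (osc {} g) (\<lambda>z. u (fst z) - u (snd z) - c (fst z - snd z))"
    using assms(1) by (auto simp: expands_def rel_diff_def)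
  obtain K where K: "eventually (\<lambda>z. norm (b (fst z) - b (snd z)) \<le> K * osc {} g z) (nhds (p, p))"
    using expands_imp_bounded[of "{}" g p "\<lambda>z. b (fst z) - b (snd z)"] assms(2)
    by (auto simp: rel_diff_def bounded_wrt_def)
  have "negligible_wrt (nhds (p, p)) (osc {} g) (\<lambda>z. u (b (fst z)) - u (b (snd z)) - c (b (fst z) - b (snd z)))"
    unfolding negligible_wrt_def
  proof (intro allI impI)
    fix e :: real assume e: "e > 0"
    define d where "d = e / (\<bar>K\<bar> + 1)"
    have d: "d > 0" using e by (simp add: d_def add_nonneg_pos)
    from K eventually_compose_filterlim[OF negligible_wrtD[OF n d] filterlim_diag_map[OF assms(4,3)]]
    show "eventually (\<lambda>z. norm (u (b (fst z)) - u (b (snd z)) - c (b (fst z) - b (snd z))) \<le> e * osc {} g z) (nhds (p, p))"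
    proof eventually_elim
      case (elim z)
      have "norm (b (fst z) - b (snd z)) \<le> (\<bar>K\<bar> + 1) * osc {} g z"
        using elim(1) mult_right_mono[OF abs_ge_self[of K] osc_nonneg[of "{}" g z]] osc_nonneg[of "{}" g z]
        unfolding distrib_right by linarith
      then have "d * norm (b (fst z) - b (snd z)) \<le> d * ((\<bar>K\<bar> + 1) * osc {} g z)"
        using d by (intro mult_left_mono) auto
      also have "\<dots> = e * osc {} g z" by (simp add: d_def)
      finally show ?case using elim(2) by (simp add: osc_def)
    qed
  qed
  then have "expands {} g p (\<lambda>z. (u (b (fst z)) - u (b (snd z)) - c (b (fst z) - b (snd z))) + c (b (fst z) - b (snd z)))"
    using assms(2) by (intro expands_add[OF expands_negligible expands_bounded_linear[OF _ c]]) (auto simp: rel_diff_def)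
  then show ?thesis by (simp add: rel_diff_def)
qed

text \<open>The estimate defining the derivative at \<open>p\<close> holds for all pairs near
  \<open>p\<close>, hence also for pairs around a nearby x, where it forces the derivative at x to
  be close to that at \<open>p\<close>.\<close>

lemma strict_diff_imp_C1:
  fixes u :: "'a::real_normed_vector \<Rightarrow> 'b::real_normed_vector"
  assumes "open \<Omega>" "\<And>x. x \<in> \<Omega> \<Longrightarrow> rel_diff {} g u x"
  shows "\<exists>u'. (\<forall>x\<in>\<Omega>. (u has_derivative u' x) (at x)) \<and> (\<forall>h. continuous_on \<Omega> (\<lambda>x. u' x h))"
proof -
  have "\<forall>x\<in>\<Omega>. \<exists>c. bounded_linear c \<and> negligible_wrt (nhds (x, x)) (osc {} g) (\<lambda>z. u (fst z) - u (snd z) - c (fst z - snd z))"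
    using assms(2) by (auto simp: rel_diff_def expands_def)
  from bchoice[OF this] obtain c where c: "\<And>x. x \<in> \<Omega> \<Longrightarrow> bounded_linear (c x)"
    and "\<And>x. x \<in> \<Omega> \<Longrightarrow> negligible_wrt (nhds (x, x)) (osc {} g) (\<lambda>z. u (fst z) - u (snd z) - c x (fst z - snd z))"
    by blast
  then have n: "\<And>x e. x \<in> \<Omega> \<Longrightarrow> e > 0 \<Longrightarrow> \<exists>Q. eventually Q (nhds x) \<and>
      (\<forall>y y'. Q y \<longrightarrow> Q y' \<longrightarrow> norm (u y - u y' - c x (y - y')) \<le> e * norm (y - y'))"
    unfolding negligible_wrt_def nhds_prod eventually_prod_same by (simp add: osc_def)
  \<comment> \<open>Both linear maps approximate the increment from x to x + t h with error e/2;
    subtracting, dividing by t and letting t tend to 0 from above compares them.\<close>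
  have near: "norm (c x h - c p h) \<le> e * norm h"
    if p: "p \<in> \<Omega>" and Q: "eventually Q (nhds x)" "x \<in> \<Omega>" "e > 0"
      "\<And>y y'. Q y \<Longrightarrow> Q y' \<Longrightarrow> norm (u y - u y' - c p (y - y')) \<le> (e/2) * norm (y - y')" for p x e h Q
  proof -
    have e: "e/2 > 0" using Q(3) by simp
    obtain R where R: "eventually R (nhds x)"
      "\<And>y y'. R y \<Longrightarrow> R y' \<Longrightarrow> norm (u y - u y' - c x (y - y')) \<le> (e/2) * norm (y - y')"
      using n[OF Q(2) e] by blast
    have x: "Q x" "R x" using Q(1) R(1) by (auto dest: eventually_nhds_x_imp_x)
    have "((\<lambda>t. x + t *\<^sub>R h) \<longlongrightarrow> x + 0 *\<^sub>R h) (at_right (0::real))" by (intro tendsto_intros)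
    then have lim: "filterlim (\<lambda>t. x + t *\<^sub>R h) (nhds x) (at_right (0::real))" by simp
    have "eventually (\<lambda>t. norm (c x h - c p h) \<le> e * norm h) (at_right (0::real))"
      using eventually_compose_filterlim[OF Q(1) lim] eventually_compose_filterlim[OF R(1) lim]
        eventually_at_right_less[of "0::real"]
    proof eventually_elim
      case (elim t)
      interpret cx: bounded_linear "c x" by (rule c[OF Q(2)])
      interpret cp: bounded_linear "c p" by (rule c[OF p])
      have "t *\<^sub>R (c x h - c p h) = (u (x + t *\<^sub>R h) - u x - c p (x + t *\<^sub>R h - x)) - (u (x + t *\<^sub>R h) - u x - c x (x + t *\<^sub>R h - x))"
        by (simp add: cx.scaleR cp.scaleR scaleR_diff_right)
      also have "norm \<dots> \<le> (e/2) * norm (x + t *\<^sub>R h - x) + (e/2) * norm (x + t *\<^sub>R h - x)"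
        by (rule norm_triangle_le_diff[OF add_mono[OF Q(4)[OF elim(1) x(1)] R(2)[OF elim(2) x(2)]]])
      finally have "t * norm (c x h - c p h) \<le> t * (e * norm h)" using elim(3) by simp
      then show ?case using elim(3) by simp
    qed
    then show ?thesis by simp
  qed
  have "(u has_derivative c x) (at x)" if x: "x \<in> \<Omega>" for x
    unfolding has_derivative_at_alt
  proof (intro conjI allI impI c[OF x])
    fix e :: real assume "e > 0"
    then obtain Q where Q: "eventually Q (nhds x)"
      "\<And>y y'. Q y \<Longrightarrow> Q y' \<Longrightarrow> norm (u y - u y' - c x (y - y')) \<le> e * norm (y - y')"
      using n[OF x] by blast
    then show "\<exists>d>0. \<forall>y. norm (y - x) < d \<longrightarrow> norm (u y - u x - c x (y - x)) \<le> e * norm (y - x)"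
      using eventually_nhds_x_imp_x[OF Q(1)] by (auto simp: eventually_nhds_metric dist_norm)
  qed
  moreover have "continuous_on \<Omega> (\<lambda>x. c x h)" for h
    unfolding continuous_on_eq_continuous_at[OF assms(1)]
  proof
    fix p assume p: "p \<in> \<Omega>"
    show "isCont (\<lambda>x. c x h) p"
      unfolding isCont_def tendsto_iff dist_norm
    proof (intro allI impI)
      fix e :: real assume e: "e > 0"
      define d where "d = e / (norm h + 1)"
      have d: "d > 0" "d/2 > 0" using e by (auto simp: d_def add_nonneg_pos)
      have dh: "d * norm h < e" using e by (simp add: d_def pos_divide_less_eq add_nonneg_pos distrib_left)
      obtain Q where Q: "eventually Q (nhds p)"
        "\<And>y y'. Q y \<Longrightarrow> Q y' \<Longrightarrow> norm (u y - u y' - c p (y - y')) \<le> d/2 * norm (y - y')"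
        using n[OF p d(2)] by blast
      have "eventually (\<lambda>x. eventually Q (nhds x)) (nhds p)"
        using Q(1) by (simp add: eventually_eventually)
      moreover have "eventually (\<lambda>x. x \<in> \<Omega>) (nhds p)"
        using assms(1) p by (rule eventually_nhds_in_open)
      ultimately have "eventually (\<lambda>x. norm (c x h - c p h) < e) (nhds p)"
        by eventually_elim (rule le_less_trans[OF near[OF p _ _ d(1) Q(2)] dh])
      then show "eventually (\<lambda>x. norm (c x h - c p h) < e) (at p)"
        by (simp add: eventually_nhds_conv_at)
    qed
  qed
  ultimately show ?thesis by blast
qed

theorem homogeneous_family_C1:
  fixes g :: "'i \<Rightarrow> 'a::euclidean_space \<Rightarrow> real"
  assumes "open \<Omega>" "finite I" and cont: "\<And>i. i \<in> I \<Longrightarrow> continuous_on \<Omega> (g i)"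
    and hom: "\<And>p q. p \<in> \<Omega> \<Longrightarrow> q \<in> \<Omega> \<Longrightarrow> \<exists>a b. carries I g p q a \<and> carries I g q p b \<and>
        eventually (\<lambda>x. b (a x) = x) (nhds p) \<and> eventually (\<lambda>y. a (b y) = y) (nhds q)"
    and "i \<in> I"
  shows "\<exists>u'. (\<forall>x\<in>\<Omega>. (g i has_derivative u' x) (at x)) \<and> (\<forall>h. continuous_on \<Omega> (\<lambda>x. u' x h))"
proof (cases "\<Omega> = {}")
  case False
  define W where "W = (\<lambda>(i, n). {q \<in> \<Omega>. \<exists>c. flat_at I g q (inverse (real (Suc n))) (\<lambda>j. if j = i then 1 else 0) c})"
  \<comment> \<open>Adding the exterior of \<open>\<Omega>\<close> makes the sets dense in the whole
    space; on \<open>\<Omega>\<close> nothing changes.\<close>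
  define G where "G = (\<lambda>j. W j \<union> - closure \<Omega>) ` (I \<times> UNIV)"
  have "UNIV \<subseteq> closure (\<Inter>G)"
  proof (rule Baire)
    show "countable G" unfolding G_def using countable_finite[OF assms(2)] by simp
    fix T assume "T \<in> G"
    then obtain i n where T: "i \<in> I" "T = W (i, n) \<union> - closure \<Omega>" by (auto simp: G_def)
    have "open (W (i, n))"
      unfolding open_subopen[of "W (i, n)"]
    proof
      fix q assume "q \<in> W (i, n)"
      then obtain c where q: "q \<in> \<Omega>" "flat_at I g q (inverse (real (Suc n))) (\<lambda>j. if j = i then 1 else 0) c"
        by (auto simp: W_def)
      have "eventually (\<lambda>q'. q' \<in> W (i, n)) (nhds q)"
        using flat_at_nearby[OF q(2)] eventually_nhds_in_open[OF assms(1) q(1)]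
        by eventually_elim (auto simp: W_def)
      then show "\<exists>T. open T \<and> q \<in> T \<and> T \<subseteq> W (i, n)"
        by (auto simp: eventually_nhds)
    qed
    moreover have "x \<in> closure T" for x
    proof -
      \<comment> \<open>Points of one-sided contact are dense for each continuous
        \<open>g i\<close>, and homogeneity upgrades each of them to a point of flatness with the
        same slope.\<close>
      have dense: "p \<in> closure (W (i, n))" if p: "p \<in> \<Omega>" for p
        unfolding closure_approachable
      proof (intro allI impI)
        fix r :: real assume "r > 0"
        then obtain q c where q: "q \<in> \<Omega>" "dist p q < r" "touched_above I g q (\<lambda>j. if j = i then 1 else 0) c"
          using exists_touched_above[where g=g and i=i, OF assms(1,2) T(1) cont[OF T(1)] p] by blast
        have "\<exists>a b. carries I g p q a \<and> carries I g q p b \<and> eventually (\<lambda>y. a (b y) = y) (nhds q)"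
          if "p \<in> \<Omega>" for p using hom[OF that q(1)] by blast
        then have "flat_at I g q (inverse (real (Suc n))) (\<lambda>j. if j = i then 1 else 0) c"
          by (intro touched_above_imp_flat[OF assms(1,2) cont _ q(1,3)]) auto
        then show "\<exists>y\<in>W (i, n). dist y p < r" using q(1,2) by (auto simp: W_def dist_commute)
      qed
      then have "closure \<Omega> \<subseteq> closure (W (i, n))" by (simp add: closure_minimal subsetI)
      then show ?thesis
        using closure_subset[of "- closure \<Omega>"] unfolding T(2) closure_Un by blast
    qed
    ultimately show "openin (top_of_set UNIV) T \<and> UNIV \<subseteq> closure T"
      by (auto simp: T(2))
  qed auto
  then have "\<Omega> \<inter> closure (\<Inter>G) \<noteq> {}" using False by auto
  then have "\<Omega> \<inter> \<Inter>G \<noteq> {}" by (simp only: open_Int_closure_eq_empty[OF assms(1)] simp_thms)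
  then obtain q where q: "q \<in> \<Omega>" "q \<in> \<Inter>G" by blast
  have "q \<in> W (i, n)" if "i \<in> I" for i n
  proof -
    have "q \<in> W (i, n) \<union> - closure \<Omega>" using q(2) that by (auto simp: G_def)
    then show ?thesis using q(1) subsetD[OF closure_subset q(1)] by blast
  qed
  then have flat: "\<exists>c. flat_at I g q (inverse (real (Suc n))) (\<lambda>j. if j = i then 1 else 0) c" if "i \<in> I" for i n
    using that by (auto simp: W_def)
  have strict: "rel_diff {} g (g i) q" if i: "i \<in> I" for i
  proof (rule rel_diff_of_flat[OF assms(2) _ i])
    fix i e assume ie: "i \<in> I" "(e::real) > 0"
    then obtain n where n: "inverse (real (Suc n)) < e" using reals_Archimedean by blast
    obtain c where c: "flat_at I g q (inverse (real (Suc n))) (\<lambda>j. if j = i then 1 else 0) c"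
      using flat[OF ie(1)] by blast
    have "flat_at I g q e (\<lambda>j. if j = i then 1 else 0) c"
      unfolding flat_at_def
      by (rule eventually_mono[OF c[unfolded flat_at_def]])
         (meson n less_imp_le mult_right_mono order_trans osc_nonneg)
    then show "\<exists>c. flat_at I g q e (\<lambda>j. if j = i then 1 else 0) c" by blast
  qed
  \<comment> \<open>Near \<open>p\<close> one has \<open>g i y = g i (a (b y))\<close>. The inner
    composite with \<open>a\<close> is strictly differentiable at \<open>q\<close> after absorbing
    the generators, and \<open>b\<close> is strictly differentiable at \<open>p\<close>.\<close>
  have "rel_diff {} g (g i) p" if p: "p \<in> \<Omega>" for p
  proof -
    obtain a b where ab: "carries I g q p a" "carries I g p q b" "eventually (\<lambda>y. a (b y) = y) (nhds p)"
      using hom[OF q(1) p] by blast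
    have "rel_diff {} g (\<lambda>x. g i (a x)) q"
      using ab(1) \<open>i \<in> I\<close> expands_absorb[OF assms(2) strict] by (auto simp: carries_def rel_diff_def)
    then have "rel_diff {} g (\<lambda>y. g i (a (b y))) p"
      by (rule rel_diff_strict_compose) (use ab(2) in \<open>auto simp: carries_def\<close>)
    then show ?thesis
      by (rule rel_diff_cong) (use ab(3) in eventually_elim, simp)
  qed
  then show ?thesis using strict_diff_imp_C1[OF assms(1)] by blast
qed auto

subsection \<open>Calculus of functions of class \<open>C\<^sup>k\<close>\<close>

lemma Ck_on_cong:
  assumes "Ck_on k E S f" "\<And>x. x \<in> S \<Longrightarrow> f x = g x"
  shows "Ck_on k E S g"
proof (cases k)
  case 0
  then show ?thesis using assms continuous_on_eq by auto
next
  case (Suc n)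
  then obtain f' where "\<And>x. x \<in> S \<Longrightarrow> (f has_derivative f' x) (at x within S)" "\<And>v. v \<in> E \<Longrightarrow> Ck_on n E S (\<lambda>x. f' x v)"
    using assms(1) by auto
  moreover from this have "\<And>x. x \<in> S \<Longrightarrow> (g has_derivative f' x) (at x within S)"
    using assms(2) by (metis has_derivative_transform)
  ultimately show ?thesis using Suc by auto
qed

lemma Ck_on_subset:
  assumes "Ck_on k E S f" "T \<subseteq> S"
  shows "Ck_on k E T f"
  using assms
proof (induction k arbitrary: f)
  case 0
  then show ?case using continuous_on_subset by auto
next
  case (Suc k)
  then show ?case by simp (meson has_derivative_subset subsetD)
qed

lemma Ck_on_continuous: "Ck_on k E S f \<Longrightarrow> continuous_on S f"
  by (cases k) (auto simp: continuous_on_eq_continuous_within intro: has_derivative_continuous)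

lemma Ck_on_pred: "Ck_on (Suc k) E S f \<Longrightarrow> Ck_on k E S f"
proof (induction k arbitrary: f)
  case 0
  then show ?case by (metis Ck_on.simps(1) Ck_on_continuous)
next
  case (Suc k)
  from Suc.prems obtain f' where
    "\<forall>x\<in>S. (f has_derivative f' x) (at x within S)" "\<forall>v\<in>E. Ck_on (Suc k) E S (\<lambda>x. f' x v)"
    by (subst (asm) Ck_on.simps(2)) blast
  with Suc.IH show ?case by (subst Ck_on.simps(2)) blast
qed

lemma Ck_on_mono: "Ck_on k E S f \<Longrightarrow> j \<le> k \<Longrightarrow> Ck_on j E S f"
  by (induction k) (auto simp: le_Suc_eq dest: Ck_on_pred simp del: Ck_on.simps)

lemma Ck_on_Suc_open:
  "open S \<Longrightarrow> Ck_on (Suc k) UNIV S f \<longleftrightarrow>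
     (\<exists>f'. (\<forall>x\<in>S. (f has_derivative f' x) (at x)) \<and> (\<forall>v. Ck_on k UNIV S (\<lambda>x. f' x v)))"
proof -
  assume "open S"
  then have "at x within S = at x" if "x \<in> S" for x using that by (intro at_within_open)
  then have "(\<forall>x\<in>S. (f has_derivative f' x) (at x within S)) \<longleftrightarrow> (\<forall>x\<in>S. (f has_derivative f' x) (at x))" for f'
    by simp
  then show ?thesis by simp
qed

lemma Ck_on_const: "Ck_on k E S (\<lambda>x. c)"
proof (induction k arbitrary: c)
  case (Suc k)
  then show ?case by (auto intro!: exI[of _ "\<lambda>_ _. 0"])
qed simp

lemma Ck_on_bounded_linear: "bounded_linear L \<Longrightarrow> Ck_on k E S L"
proof (cases k)
  case (Suc n)
  assume "bounded_linear L"
  then show ?thesis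
    unfolding Suc by (auto intro!: exI[of _ "\<lambda>_. L"] Ck_on_const bounded_linear_imp_has_derivative)
qed (auto intro: linear_continuous_on)

lemma Ck_on_bounded_linear_compose:
  assumes "Ck_on k E S f" "bounded_linear L"
  shows "Ck_on k E S (\<lambda>x. L (f x))"
  using assms(1)
proof (induction k arbitrary: f)
  case 0
  then show ?case using bounded_linear.continuous_on[OF assms(2)] by simp
next
  case (Suc k)
  then obtain f' where f': "\<forall>x\<in>S. (f has_derivative f' x) (at x within S)" "\<forall>v\<in>E. Ck_on k E S (\<lambda>x. f' x v)"
    by auto
  then have "\<forall>v\<in>E. Ck_on k E S (\<lambda>x. L (f' x v))" using Suc.IH by blast
  with f'(1) show ?case
    by (auto intro!: exI[of _ "\<lambda>x v. L (f' x v)"] bounded_linear.has_derivative[OF assms(2)])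
qed

lemma Ck_on_add:
  assumes "Ck_on k E S f" "Ck_on k E S g"
  shows "Ck_on k E S (\<lambda>x. f x + g x)"
  using assms
proof (induction k arbitrary: f g)
  case 0
  then show ?case by (auto intro: continuous_on_add)
next
  case (Suc k)
  then obtain f' g' where
    "\<forall>x\<in>S. (f has_derivative f' x) (at x within S)" "\<forall>v\<in>E. Ck_on k E S (\<lambda>x. f' x v)"
    "\<forall>x\<in>S. (g has_derivative g' x) (at x within S)" "\<forall>v\<in>E. Ck_on k E S (\<lambda>x. g' x v)"
    by auto
  with Suc.IH show ?case
    by (auto intro!: exI[of _ "\<lambda>x v. f' x v + g' x v"] has_derivative_add)
qed

lemma Ck_on_diff: "Ck_on k E S f \<Longrightarrow> Ck_on k E S g \<Longrightarrow> Ck_on k E S (\<lambda>x. f x - g x)"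
  using Ck_on_add[of k E S f "\<lambda>x. - g x"] Ck_on_bounded_linear_compose[of k E S g uminus]
  by (simp add: bounded_linear_minus bounded_linear_ident)

lemma Ck_on_sum:
  assumes "\<And>i. i \<in> I \<Longrightarrow> Ck_on k E S (f i)"
  shows "Ck_on k E S (\<lambda>x. \<Sum>i\<in>I. f i x)"
  using assms
  by (induction I rule: infinite_finite_induct) (auto intro: Ck_on_add Ck_on_const simp del: Ck_on.simps)

lemma Ck_on_bilinear:
  assumes "bounded_bilinear bl" "Ck_on k E S f" "Ck_on k E S g"
  shows "Ck_on k E S (\<lambda>x. bl (f x) (g x))"
  using assms(2,3)
proof (induction k arbitrary: f g)
  case 0
  then show ?case using bounded_bilinear.continuous_on[OF assms(1)] by auto
next
  case (Suc k)
  then obtain f' g' where f'g':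
    "\<forall>x\<in>S. (f has_derivative f' x) (at x within S)" "\<forall>v\<in>E. Ck_on k E S (\<lambda>x. f' x v)"
    "\<forall>x\<in>S. (g has_derivative g' x) (at x within S)" "\<forall>v\<in>E. Ck_on k E S (\<lambda>x. g' x v)"
    by auto
  have "Ck_on k E S f" "Ck_on k E S g" using Suc.prems Ck_on_pred by blast+
  then have "\<forall>v\<in>E. Ck_on k E S (\<lambda>x. bl (f x) (g' x v) + bl (f' x v) (g x))"
    using f'g' by (intro ballI Ck_on_add Suc.IH) auto
  with f'g'(1,3) show ?case
    by (auto intro!: exI[of _ "\<lambda>x v. bl (f x) (g' x v) + bl (f' x v) (g x)"] bounded_bilinear.FDERIV[OF assms(1)])
qed

lemma linear_euclidean_expand:
  fixes L :: "'a::euclidean_space \<Rightarrow> 'b::real_normed_vector"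
  assumes "linear L"
  shows "L v = (\<Sum>b\<in>Basis. (v \<bullet> b) *\<^sub>R L b)"
proof -
  interpret linear L by fact
  have "L v = L (\<Sum>b\<in>Basis. (v \<bullet> b) *\<^sub>R b)" by (simp add: euclidean_representation)
  then show ?thesis by (simp only: sum scale)
qed

lemma Ck_on_SucI_Basis:
  fixes f :: "'a::euclidean_space \<Rightarrow> 'b::real_normed_vector"
  assumes "open S" "\<And>x. x \<in> S \<Longrightarrow> (f has_derivative f' x) (at x)"
    "\<And>b. b \<in> Basis \<Longrightarrow> Ck_on k UNIV S (\<lambda>x. f' x b)"
  shows "Ck_on (Suc k) UNIV S f"
  unfolding Ck_on_Suc_open[OF assms(1)]
proof (intro exI[of _ f'] conjI ballI allI)
  fix v
  have "Ck_on k UNIV S (\<lambda>x. \<Sum>b\<in>Basis. (v \<bullet> b) *\<^sub>R f' x b)"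
    by (intro Ck_on_sum Ck_on_bounded_linear_compose[OF _ bounded_linear_scaleR_right] assms(3))
  then show "Ck_on k UNIV S (\<lambda>x. f' x v)"
    by (rule Ck_on_cong) (metis assms(2) has_derivative_linear linear_euclidean_expand)
qed (use assms in auto)

lemma Ck_on_compose:
  fixes f :: "'a::euclidean_space \<Rightarrow> 'b::euclidean_space" and g :: "'b \<Rightarrow> 'c::real_normed_vector"
  assumes "open S" "open T" "f ` S \<subseteq> T" "Ck_on k UNIV S f" "Ck_on k UNIV T g"
  shows "Ck_on k UNIV S (\<lambda>x. g (f x))"
  using assms(4,5)
proof (induction k arbitrary: g)
  case 0
  then show ?case using continuous_on_compose2 assms(3) by auto
next
  case (Suc k)
  obtain f' where f': "\<forall>x\<in>S. (f has_derivative f' x) (at x)" "\<forall>v. Ck_on k UNIV S (\<lambda>x. f' x v)"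
    using Suc.prems(1) unfolding Ck_on_Suc_open[OF assms(1)] by blast
  obtain g' where g': "\<forall>x\<in>T. (g has_derivative g' x) (at x)" "\<forall>v. Ck_on k UNIV T (\<lambda>x. g' x v)"
    using Suc.prems(2) unfolding Ck_on_Suc_open[OF assms(2)] by blast
  show ?case unfolding Ck_on_Suc_open[OF assms(1)]
  proof (intro exI[of _ "\<lambda>x v. g' (f x) (f' x v)"] conjI ballI allI)
    fix x assume "x \<in> S"
    then show "((\<lambda>x. g (f x)) has_derivative (\<lambda>v. g' (f x) (f' x v))) (at x)"
      using f'(1) g'(1) assms(3) has_derivative_compose[of f "f' x" x UNIV g "g' (f x)"] by blast
  next
    fix v
    have "Ck_on k UNIV S (\<lambda>x. \<Sum>b\<in>Basis. (f' x v \<bullet> b) *\<^sub>R g' (f x) b)"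
      using f'(2) g'(2) Suc.IH Ck_on_pred[OF Suc.prems(1)]
      by (intro Ck_on_sum Ck_on_bilinear[OF bounded_bilinear_scaleR]
          Ck_on_bounded_linear_compose[OF _ bounded_linear_inner_left]) auto
    then show "Ck_on k UNIV S (\<lambda>x. g' (f x) (f' x v))"
      by (rule Ck_on_cong) (metis assms(3) g'(1) has_derivative_linear image_subset_iff linear_euclidean_expand)
  qed
qed

text \<open>The mean value inequality for \<open>u\<close> minus its linearisation at
  \<open>p\<close>, on a small ball around \<open>p\<close>. The derivative is continuous only in
  each direction, so its operator norm is bounded by the sum over the basis.\<close>

lemma C1_imp_negligible_remainder:
  fixes u :: "'a::euclidean_space \<Rightarrow> 'b::real_normed_vector"
  assumes "open S" "\<And>x. x \<in> S \<Longrightarrow> (u has_derivative u' x) (at x)"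
    "\<And>b. b \<in> Basis \<Longrightarrow> continuous_on S (\<lambda>x. u' x b)" "p \<in> S"
  shows "negligible_wrt (nhds (p, p)) (osc {} g) (\<lambda>z. u (fst z) - u (snd z) - u' p (fst z - snd z))"
  unfolding negligible_wrt_def
proof (intro allI impI)
    fix e :: real assume e: "e > 0"
    define N where "N = (\<lambda>x. \<Sum>b\<in>Basis. norm (u' x b - u' p b))"
    have "isCont N p"
      unfolding N_def using assms(1,3,4)
      by (intro continuous_intros) (auto simp: continuous_on_eq_continuous_at)
    then have "(N \<longlongrightarrow> N p) (nhds p)"
      by (simp add: continuous_at tendsto_at_iff_tendsto_nhds)
    then have "((\<lambda>x. \<Sum>b\<in>Basis. norm (u' x b - u' p b)) \<longlongrightarrow> 0) (nhds p)"
      by (simp add: N_def)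
    then have "eventually (\<lambda>x. (\<Sum>b\<in>Basis. norm (u' x b - u' p b)) < e) (nhds p)"
      using e by (rule order_tendstoD)
    then have "eventually (\<lambda>x. x \<in> S \<and> (\<Sum>b\<in>Basis. norm (u' x b - u' p b)) < e) (nhds p)"
      using eventually_nhds_in_open[OF assms(1,4)] by eventually_elim simp
    then obtain r where r: "r > 0" "\<And>x. dist x p < r \<Longrightarrow> x \<in> S \<and> (\<Sum>b\<in>Basis. norm (u' x b - u' p b)) < e"
      by (auto simp: eventually_nhds_metric)
    have lp: "bounded_linear (u' p)" by (rule has_derivative_bounded_linear[OF assms(2)[OF assms(4)]])
    have mv: "norm (u x - u y - u' p (x - y)) \<le> e * norm (x - y)" if xy: "x \<in> ball p r" "y \<in> ball p r" for x y
    proof -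
      have "norm ((u x - u' p x) - (u y - u' p y)) \<le> e * norm (x - y)"
      proof (rule differentiable_bound[OF convex_ball _ _ xy(1,2), where f = "\<lambda>x. u x - u' p x" and f' = "\<lambda>x h. u' x h - u' p h"])
        fix x assume x: "x \<in> ball p r"
        then have xS: "x \<in> S" "(\<Sum>b\<in>Basis. norm (u' x b - u' p b)) < e" using r(2)[of x] by (auto simp: dist_commute)
        have lx: "bounded_linear (u' x)" by (rule has_derivative_bounded_linear[OF assms(2)[OF xS(1)]])
        show "((\<lambda>x. u x - u' p x) has_derivative (\<lambda>h. u' x h - u' p h)) (at x within ball p r)"
          by (rule has_derivative_diff[OF has_derivative_at_withinI[OF assms(2)[OF xS(1)]]
                bounded_linear_imp_has_derivative[OF lp]])
        show "onorm (\<lambda>h. u' x h - u' p h) \<le> e"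
        proof (rule onorm_bound)
          fix h
          have "linear (\<lambda>h. u' x h - u' p h)" using bounded_linear_sub[OF lx lp] by (rule bounded_linear.linear)
          then have "u' x h - u' p h = (\<Sum>b\<in>Basis. (h \<bullet> b) *\<^sub>R (u' x b - u' p b))"
            by (rule linear_euclidean_expand)
          also have "norm \<dots> \<le> (\<Sum>b\<in>Basis. norm ((h \<bullet> b) *\<^sub>R (u' x b - u' p b)))" by (rule norm_sum)
          also have "\<dots> \<le> (\<Sum>b\<in>Basis. norm h * norm (u' x b - u' p b))"
            by (intro sum_mono) (auto intro!: mult_right_mono Basis_le_norm)
          also have "\<dots> = norm h * (\<Sum>b\<in>Basis. norm (u' x b - u' p b))" by (simp add: sum_distrib_left)
          also have "\<dots> \<le> norm h * e" using xS(2) by (intro mult_left_mono) auto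
          finally show "norm (u' x h - u' p h) \<le> e * norm h" by (simp add: mult.commute)
        qed (use e in simp)
      qed
      also have "(u x - u' p x) - (u y - u' p y) = u x - u y - u' p (x - y)"
        by (simp add: linear_simps[OF lp])
      finally show ?thesis .
    qed
    show "eventually (\<lambda>z. norm (u (fst z) - u (snd z) - u' p (fst z - snd z)) \<le> e * osc {} g z) (nhds (p, p))"
      unfolding nhds_prod eventually_prod_same
      by (rule exI[of _ "\<lambda>x. x \<in> ball p r"])
         (use mv r(1) eventually_nhds_in_open[of "ball p r" p] in \<open>auto simp: osc_def\<close>)
  qed

lemma C1_imp_strict_diff:
  fixes u :: "'a::euclidean_space \<Rightarrow> 'b::real_normed_vector"
  assumes "open S" "\<And>x. x \<in> S \<Longrightarrow> (u has_derivative u' x) (at x)"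
    "\<And>b. b \<in> Basis \<Longrightarrow> continuous_on S (\<lambda>x. u' x b)" "p \<in> S"
  shows "rel_diff {} g u p"
  using C1_imp_negligible_remainder[OF assms, of g] has_derivative_bounded_linear[OF assms(2)[OF assms(4)]]
  unfolding rel_diff_def expands_def by (intro exI[of _ "u' p"] exI) auto

lemma Ck_on_1_strict_diff:
  fixes u :: "'a::euclidean_space \<Rightarrow> 'b::real_normed_vector"
  assumes "open S" "Ck_on (Suc k) UNIV S u" "p \<in> S"
  shows "rel_diff {} g u p"
proof -
  obtain u' where "\<forall>x\<in>S. (u has_derivative u' x) (at x)" "\<forall>v. Ck_on k UNIV S (\<lambda>x. u' x v)"
    using assms(2) unfolding Ck_on_Suc_open[OF assms(1)] by blast
  then show ?thesis using C1_imp_strict_diff[OF assms(1) _ _ assms(3)] Ck_on_continuous by blast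
qed

lemma rel_diff_of_strict: "finite I \<Longrightarrow> rel_diff {} g u p \<Longrightarrow> rel_diff I g u p"
  unfolding rel_diff_def by (rule expands_mono) auto

text \<open>
  The analogue of \<open>Ck_on\<close> in which the derivatives of order \<open>k\<close>, instead of being merely
  continuous, have to be differentiable relative to the functions \<open>g i\<close>.
\<close>

primrec rel_Ck ::
  "'i set \<Rightarrow> ('i \<Rightarrow> 'a::euclidean_space \<Rightarrow> real) \<Rightarrow> nat \<Rightarrow> 'a set \<Rightarrow> ('a \<Rightarrow> 'b::real_normed_vector) \<Rightarrow> bool"
where
  "rel_Ck I g 0 S u \<longleftrightarrow> continuous_on S u \<and> (\<forall>x\<in>S. rel_diff I g u x)"
| "rel_Ck I g (Suc k) S u \<longleftrightarrow>
     (\<exists>u'. (\<forall>x\<in>S. (u has_derivative u' x) (at x)) \<and> (\<forall>b\<in>Basis. rel_Ck I g k S (\<lambda>x. u' x b)))"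

lemma rel_Ck_continuous: "rel_Ck I g k S u \<Longrightarrow> continuous_on S u"
  by (cases k) (auto intro!: continuous_at_imp_continuous_on dest: has_derivative_continuous)

lemma rel_Ck_cong:
  assumes "open S" "rel_Ck I g k S u" "\<And>x. x \<in> S \<Longrightarrow> u x = v x"
  shows "rel_Ck I g k S v"
proof -
  have ev: "eventually (\<lambda>y. u y = v y) (nhds x)" if "x \<in> S" for x
    using eventually_nhds_in_open[OF assms(1) that] by eventually_elim (rule assms(3))
  show ?thesis
  proof (cases k)
    case 0
    then show ?thesis using assms(2,3) continuous_on_eq ev rel_diff_cong by fastforce
  next
    case (Suc n)
    then obtain u' where u': "\<forall>x\<in>S. (u has_derivative u' x) (at x)" "\<forall>b\<in>Basis. rel_Ck I g n S (\<lambda>x. u' x b)"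
      using assms(2) by auto
    then have "\<forall>x\<in>S. (v has_derivative u' x) (at x)"
      using has_derivative_transform_within_open[OF _ assms(1)] assms(3) by blast
    then show ?thesis using u'(2) Suc by auto
  qed
qed

lemma rel_Ck_subset: "rel_Ck I g k S u \<Longrightarrow> T \<subseteq> S \<Longrightarrow> rel_Ck I g k T u"
proof (induction k arbitrary: u)
  case 0
  then show ?case using continuous_on_subset by auto
next
  case (Suc k)
  then show ?case by simp blast
qed

lemma Ck_on_imp_rel_Ck:
  assumes "finite I" "open S" "Ck_on (Suc k) UNIV S u"
  shows "rel_Ck I g k S u"
  using assms(3)
proof (induction k arbitrary: u)
  case 0
  have "continuous_on S u" by (rule Ck_on_continuous[OF 0])
  moreover have "rel_diff I g u x" if "x \<in> S" for x
    by (rule rel_diff_of_strict[OF assms(1) Ck_on_1_strict_diff[OF assms(2) 0 that]])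
  ultimately show ?case by simp
next
  case (Suc k)
  then show ?case unfolding Ck_on_Suc_open[OF assms(2), of "Suc k"] by auto
qed

lemma rel_Ck_imp_C1:
  assumes "open S" "rel_Ck I g (Suc k) S u"
  shows "Ck_on (Suc 0) UNIV S u"
proof -
  obtain u' where "\<And>x. x \<in> S \<Longrightarrow> (u has_derivative u' x) (at x)" "\<And>b. b \<in> Basis \<Longrightarrow> rel_Ck I g k S (\<lambda>x. u' x b)"
    using assms(2) by auto
  then show ?thesis
    by (intro Ck_on_SucI_Basis[OF assms(1)]) (auto intro: rel_Ck_continuous)
qed

lemma rel_Ck_pred: "finite I \<Longrightarrow> open S \<Longrightarrow> rel_Ck I g (Suc k) S u \<Longrightarrow> rel_Ck I g k S u"
proof (induction k arbitrary: u)
  case 0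
  \<comment> \<open>With a continuous derivative \<open>u\<close> is C^1, hence strictly
    differentiable, and so differentiable relative to any finite family.\<close>
  show ?case by (rule Ck_on_imp_rel_Ck[OF 0(1,2) rel_Ck_imp_C1[OF 0(2,3)]])
next
  case (Suc k)
  from Suc.prems(3) obtain u' where
    "\<forall>x\<in>S. (u has_derivative u' x) (at x)" "\<forall>b\<in>Basis. rel_Ck I g (Suc k) S (\<lambda>x. u' x b)"
    by (subst (asm) rel_Ck.simps(2)) blast
  with Suc show ?case by (subst rel_Ck.simps(2)) blast
qed

lemma rel_Ck_mono: "finite I \<Longrightarrow> open S \<Longrightarrow> rel_Ck I g k S u \<Longrightarrow> j \<le> k \<Longrightarrow> rel_Ck I g j S u"
  by (induction k) (auto simp: le_Suc_eq dest: rel_Ck_pred simp del: rel_Ck.simps)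

lemma rel_Ck_add: "rel_Ck I g k S u \<Longrightarrow> rel_Ck I g k S v \<Longrightarrow> rel_Ck I g k S (\<lambda>x. u x + v x)"
proof (induction k arbitrary: u v)
  case 0
  then show ?case by (auto intro: continuous_on_add rel_diff_add)
next
  case (Suc k)
  then obtain u' v' where
    "\<forall>x\<in>S. (u has_derivative u' x) (at x)" "\<forall>b\<in>Basis. rel_Ck I g k S (\<lambda>x. u' x b)"
    "\<forall>x\<in>S. (v has_derivative v' x) (at x)" "\<forall>b\<in>Basis. rel_Ck I g k S (\<lambda>x. v' x b)"
    by auto
  with Suc.IH show ?case
    by (auto intro!: exI[of _ "\<lambda>x h. u' x h + v' x h"] has_derivative_add)
qed

lemma rel_Ck_bounded_linear: "rel_Ck I g k S u \<Longrightarrow> bounded_linear L \<Longrightarrow> rel_Ck I g k S (\<lambda>x. L (u x))"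
proof (induction k arbitrary: u)
  case 0
  then show ?case by (auto intro: bounded_linear.continuous_on rel_diff_bounded_linear)
next
  case (Suc k)
  then obtain u' where
    "\<forall>x\<in>S. (u has_derivative u' x) (at x)" "\<forall>b\<in>Basis. rel_Ck I g k S (\<lambda>x. u' x b)"
    by auto
  with Suc show ?case
    by (auto intro!: exI[of _ "\<lambda>x h. L (u' x h)"] bounded_linear.has_derivative[of L])
qed

lemma rel_Ck_const: "rel_Ck I g k S (\<lambda>x. c)"
proof (induction k arbitrary: c)
  case 0
  show ?case by (simp add: rel_diff_const)
next
  case (Suc k)
  then show ?case by (auto intro!: exI[of _ "\<lambda>_ _. 0"])
qed

lemma rel_Ck_sum:
  assumes "\<And>j. j \<in> J \<Longrightarrow> rel_Ck I g k S (u j)"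
  shows "rel_Ck I g k S (\<lambda>x. \<Sum>j\<in>J. u j x)"
  using assms
  by (induction J rule: infinite_finite_induct) (auto intro: rel_Ck_add rel_Ck_const simp del: rel_Ck.simps)

lemma rel_Ck_bilinear:
  assumes "bounded_bilinear bl" "finite I" "open S" "rel_Ck I g k S u" "rel_Ck I g k S v"
  shows "rel_Ck I g k S (\<lambda>x. bl (u x) (v x))"
  using assms(4,5)
proof (induction k arbitrary: u v)
  case 0
  have c: "continuous_on S u" "continuous_on S v" using 0 by auto
  have "rel_diff I g (\<lambda>x. bl (u x) (v x)) x" if "x \<in> S" for x
    using 0 c that assms(3)
    by (intro rel_diff_bilinear[OF assms(2,1)]) (auto simp: continuous_on_eq_continuous_at)
  then show ?case using bounded_bilinear.continuous_on[OF assms(1) c] by simp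
next
  case (Suc k)
  then obtain u' v' where u'v':
    "\<forall>x\<in>S. (u has_derivative u' x) (at x)" "\<forall>b\<in>Basis. rel_Ck I g k S (\<lambda>x. u' x b)"
    "\<forall>x\<in>S. (v has_derivative v' x) (at x)" "\<forall>b\<in>Basis. rel_Ck I g k S (\<lambda>x. v' x b)"
    by auto
  have "rel_Ck I g k S u" "rel_Ck I g k S v" using Suc.prems rel_Ck_pred[OF assms(2,3)] by blast+
  then have "\<forall>b\<in>Basis. rel_Ck I g k S (\<lambda>x. bl (u x) (v' x b) + bl (u' x b) (v x))"
    using u'v' by (intro ballI rel_Ck_add Suc.IH) auto
  with u'v'(1,3) show ?case
    by (auto intro!: exI[of _ "\<lambda>x b. bl (u x) (v' x b) + bl (u' x b) (v x)"] bounded_bilinear.FDERIV[OF assms(1)])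
qed

text \<open>The spare derivative of \<open>F\<close> makes its derivatives relatively smooth to the
  order required. As \<open>s\<close> is C^1, the induction starts from the ordinary chain rule, and
  relative differentiability is propagated by sums and products only.\<close>

lemma rel_Ck_compose:
  fixes s :: "'a::euclidean_space \<Rightarrow> 'b::euclidean_space" and F :: "'b \<Rightarrow> 'c::real_normed_vector"
  assumes "finite I" "open S" "open T" "s ` S \<subseteq> T" "Ck_on (Suc 0) UNIV S s"
    "rel_Ck I g k S s" "Ck_on (Suc k) UNIV T F"
  shows "rel_Ck I g k S (\<lambda>x. F (s x))"
  using assms(6,7)
proof (induction k arbitrary: F)
  case 0
  show ?case
    by (intro Ck_on_imp_rel_Ck[OF assms(1,2)] Ck_on_compose[OF assms(2,3,4,5)] 0)
next
  case (Suc k)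
  obtain s' where s': "\<forall>x\<in>S. (s has_derivative s' x) (at x)" "\<forall>b\<in>Basis. rel_Ck I g k S (\<lambda>x. s' x b)"
    using Suc.prems(1) by auto
  obtain F' where F': "\<forall>x\<in>T. (F has_derivative F' x) (at x)" "\<forall>v. Ck_on (Suc k) UNIV T (\<lambda>x. F' x v)"
    using Suc.prems(2) unfolding Ck_on_Suc_open[OF assms(3), of "Suc k"] by blast
  have "rel_Ck I g k S (\<lambda>x. F' (s x) (s' x b))" if b: "b \<in> Basis" for b
  proof -
    have "rel_Ck I g k S (\<lambda>x. \<Sum>e\<in>Basis. (s' x b \<bullet> e) *\<^sub>R F' (s x) e)"
      using s'(2) F'(2) Suc.IH[OF rel_Ck_pred[OF assms(1,2) Suc.prems(1)]] b
      by (intro rel_Ck_sum rel_Ck_bilinear[OF bounded_bilinear_scaleR assms(1,2)]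
          rel_Ck_bounded_linear[OF _ bounded_linear_inner_left]) (auto simp del: Ck_on.simps)
    then show ?thesis
      by (rule rel_Ck_cong[OF assms(2)]) (metis assms(4) F'(1) has_derivative_linear image_subset_iff linear_euclidean_expand)
  qed
  moreover have "((\<lambda>x. F (s x)) has_derivative (\<lambda>v. F' (s x) (s' x v))) (at x)" if "x \<in> S" for x
    using s'(1) F'(1) assms(4) that has_derivative_compose[of s "s' x" x UNIV F "F' (s x)"] by blast
  ultimately show ?case by (auto intro!: exI[of _ "\<lambda>x v. F' (s x) (s' x v)"])
qed

declare Ck_on.simps(2) [simp del] rel_Ck.simps(2) [simp del]

section \<open>Iterated partial derivatives\<close>

text \<open>Words rather than multi-indices are used, so the order of differentiation never has to
  be exchanged. The head of the word is the direction differentiated last.\<close>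

primrec partial_deriv :: "'a list \<Rightarrow> ('a::real_normed_vector \<Rightarrow> 'b::real_normed_vector) \<Rightarrow> 'a \<Rightarrow> 'b" where
  "partial_deriv [] f = f"
| "partial_deriv (e # w) f = (\<lambda>x. frechet_derivative (partial_deriv w f) (at x) e)"

lemma Ck_on_frechet_derivative:
  assumes "open S" "Ck_on (Suc k) UNIV S u"
  shows "x \<in> S \<Longrightarrow> (u has_derivative frechet_derivative u (at x)) (at x)"
    and "Ck_on k UNIV S (\<lambda>x. frechet_derivative u (at x) e)"
proof -
  obtain u' where u': "\<forall>x\<in>S. (u has_derivative u' x) (at x)" "\<forall>v. Ck_on k UNIV S (\<lambda>x. u' x v)"
    using assms(2) unfolding Ck_on_Suc_open[OF assms(1)] by blast
  then have eq: "u' x = frechet_derivative u (at x)" if "x \<in> S" for x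
    using frechet_derivative_at that by blast
  show "x \<in> S \<Longrightarrow> (u has_derivative frechet_derivative u (at x)) (at x)"
    using u'(1) eq by metis
  show "Ck_on k UNIV S (\<lambda>x. frechet_derivative u (at x) e)"
    by (rule Ck_on_cong[OF u'(2)[rule_format, of e]]) (simp add: eq)
qed

lemma Ck_on_partial_deriv:
  "open S \<Longrightarrow> Ck_on (length w + i) UNIV S f \<Longrightarrow> Ck_on i UNIV S (partial_deriv w f)"
proof (induction w arbitrary: i)
  case (Cons e w)
  then have "Ck_on (Suc i) UNIV S (partial_deriv w f)" by simp
  then show ?case using Ck_on_frechet_derivative(2)[OF Cons.prems(1)] by simp
qed simp

text \<open>Descent from the words of length \<open>j\<close>: each shorter word gains its
  smoothness from its one-letter extensions. The empty word gives the gain of one class for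
  \<open>f\<close> itself.\<close>

lemma Ck_on_Suc_of_partial_deriv:
  fixes f :: "'a::euclidean_space \<Rightarrow> 'b::real_normed_vector"
  assumes "open S" "Ck_on j UNIV S f"
    and top: "\<And>w. set w \<subseteq> Basis \<Longrightarrow> length w = j \<Longrightarrow> Ck_on (Suc 0) UNIV S (partial_deriv w f)"
  shows "set w \<subseteq> Basis \<Longrightarrow> length w + i = j \<Longrightarrow> Ck_on (Suc i) UNIV S (partial_deriv w f)"
proof (induction i arbitrary: w)
  case 0
  then show ?case using top by simp
next
  case (Suc i)
  have w: "Ck_on (Suc i) UNIV S (partial_deriv w f)"
    using Suc.prems assms(2) by (intro Ck_on_partial_deriv[OF assms(1)]) simp
  show ?case
  proof (rule Ck_on_SucI_Basis[OF assms(1)])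
    fix b :: 'a assume "b \<in> Basis"
    then have "Ck_on (Suc i) UNIV S (partial_deriv (b # w) f)"
      using Suc.prems by (intro Suc.IH) auto
    then show "Ck_on (Suc i) UNIV S (\<lambda>x. frechet_derivative (partial_deriv w f) (at x) b)"
      by simp
  qed (rule Ck_on_frechet_derivative(1)[OF assms(1) w])
qed

lemma rel_Ck_partial_deriv:
  fixes f :: "'a::euclidean_space \<Rightarrow> 'b::real_normed_vector"
  assumes "open S" "Ck_on j UNIV S f"
    and top: "\<And>w x. set w \<subseteq> Basis \<Longrightarrow> length w = j \<Longrightarrow> x \<in> S \<Longrightarrow> rel_diff I g (partial_deriv w f) x"
  shows "set w \<subseteq> Basis \<Longrightarrow> length w + i = j \<Longrightarrow> rel_Ck I g i S (partial_deriv w f)"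
proof (induction i arbitrary: w)
  case 0
  have "Ck_on 0 UNIV S (partial_deriv w f)"
    using 0 assms(2) by (intro Ck_on_partial_deriv[OF assms(1)]) simp
  then show ?case using top 0 by simp
next
  case (Suc i)
  have w: "Ck_on (Suc i) UNIV S (partial_deriv w f)"
    using Suc.prems assms(2) by (intro Ck_on_partial_deriv[OF assms(1)]) simp
  have "rel_Ck I g i S (\<lambda>x. frechet_derivative (partial_deriv w f) (at x) b)" if "b \<in> Basis" for b
    using Suc.IH[of "b # w"] Suc.prems that by simp
  then show ?case
    using Ck_on_frechet_derivative(1)[OF assms(1) w] unfolding rel_Ck.simps
    by (intro exI[of _ "\<lambda>x. frechet_derivative (partial_deriv w f) (at x)"]) blast
qed

text \<open>Where one factor vanishes, the product rule needs only continuity of the other. This is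
  what lets the inverse of a differentiable family be differentiated from its increment
  formula.\<close>

lemma has_derivative_scaleR_vanishing:
  fixes \<phi> :: "'a::real_normed_vector \<Rightarrow> real"
  assumes "(\<phi> has_derivative \<phi>') (at x)" "\<phi> x = 0" "isCont V x"
  shows "((\<lambda>y. \<phi> y *\<^sub>R V y) has_derivative (\<lambda>h. \<phi>' h *\<^sub>R V x)) (at x)"
proof -
  have bl: "bounded_linear \<phi>'" using assms(1) by (rule has_derivative_bounded_linear)
  obtain K where K: "\<And>h. norm (\<phi>' h) \<le> norm h * K" using bounded_linear.bounded[OF bl] by blast
  obtain d where d: "d > 0" "\<And>y. norm (y - x) < d \<Longrightarrow> norm (\<phi> y - \<phi> x - \<phi>' (y - x)) \<le> 1 * norm (y - x)"
    using assms(1) unfolding has_derivative_at_alt by (metis zero_less_one)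
  have "bounded_wrt (nhds x) (\<lambda>y. norm (y - x)) \<phi>"
    unfolding bounded_wrt_def eventually_nhds_metric
  proof (intro exI conjI allI impI)
    fix y assume "dist y x < d"
    then have "norm (\<phi> y - \<phi>' (y - x)) \<le> norm (y - x)" using d(2)[of y] by (simp add: dist_norm assms(2))
    then show "norm (\<phi> y) \<le> (1 + K) * norm (y - x)"
      using K[of "y - x"] norm_triangle_ineq2[of "\<phi> y" "\<phi>' (y - x)"] by (simp add: algebra_simps)
  qed (rule d(1))
  moreover have "((\<lambda>y. V y - V x) \<longlongrightarrow> 0) (nhds x)"
    using assms(3) by (simp add: LIM_zero_iff continuous_at tendsto_at_iff_tendsto_nhds)
  ultimately have n: "negligible_wrt (nhds x) (\<lambda>y. norm (y - x)) (\<lambda>y. \<phi> y *\<^sub>R (V y - V x))"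
    by (intro negligible_wrt_bilinear[OF bounded_bilinear_scaleR]) auto
  have "((\<lambda>y. \<phi> y *\<^sub>R (V y - V x)) has_derivative (\<lambda>h. 0)) (at x)"
    unfolding has_derivative_at_alt
    using negligible_wrtD[OF n] by (auto simp: eventually_nhds_metric dist_norm)
  then have "((\<lambda>y. \<phi> y *\<^sub>R V x + \<phi> y *\<^sub>R (V y - V x)) has_derivative (\<lambda>h. \<phi>' h *\<^sub>R V x + 0)) (at x)"
    by (intro has_derivative_add has_derivative_scaleR_left assms(1))
  then show ?thesis by (simp add: scaleR_diff_right)
qed

text \<open>Everything rests on the identity \<open>C x - C y = - C x (A x - A y) C y\<close> for \<open>C = A\<inverse>\<close>.\<close>

lemma rel_Ck_inverse:
  fixes A C :: "'a::euclidean_space \<Rightarrow> 'a \<Rightarrow> 'a"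
  assumes fin: "finite I" and S: "open S"
    and lin: "\<And>x. x \<in> S \<Longrightarrow> linear (A x)" "\<And>x. x \<in> S \<Longrightarrow> linear (C x)"
    and inv: "\<And>x h. x \<in> S \<Longrightarrow> A x (C x h) = h" "\<And>x h. x \<in> S \<Longrightarrow> C x (A x h) = h"
    and cont: "\<And>e. e \<in> Basis \<Longrightarrow> continuous_on S (\<lambda>x. C x e)"
    and "\<And>e. e \<in> Basis \<Longrightarrow> rel_Ck I g k S (\<lambda>x. A x e)"
    and "e \<in> Basis"
  shows "rel_Ck I g k S (\<lambda>x. C x e)"
proof -
  \<comment> \<open>\<open>V\<close> collects the coefficients in the expansion of
    \<open>C x e - C y e\<close>: they depend on \<open>C\<close> alone, while the increments of
    \<open>A\<close> stand apart as scalar factors.\<close>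
  define V where "V = (\<lambda>e e' d x y. - ((C y e \<bullet> e') *\<^sub>R C x d))"
  have increment: "C x e - C y e = (\<Sum>e'\<in>Basis. \<Sum>d\<in>Basis. ((A x e' - A y e') \<bullet> d) *\<^sub>R V e e' d x y)"
    if "x \<in> S" "y \<in> S" for x y e
  proof -
    interpret Ax: linear "A x" by (rule lin(1)[OF that(1)])
    interpret Ay: linear "A y" by (rule lin(1)[OF that(2)])
    interpret Cx: linear "C x" by (rule lin(2)[OF that(1)])
    have "C x e - C y e = C x (A y (C y e) - A x (C y e))"
      by (simp add: Cx.diff inv that)
    also have "A y (C y e) - A x (C y e) = (\<Sum>e'\<in>Basis. (C y e \<bullet> e') *\<^sub>R (A y e' - A x e'))"
      by (subst linear_euclidean_expand[OF Ax.linear_axioms], subst linear_euclidean_expand[OF Ay.linear_axioms])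
         (simp add: sum_subtractf scaleR_diff_right)
    also have "C x \<dots> = (\<Sum>e'\<in>Basis. (C y e \<bullet> e') *\<^sub>R C x (A y e' - A x e'))"
      by (simp add: Cx.sum Cx.scale)
    also have "\<dots> = (\<Sum>e'\<in>Basis. (C y e \<bullet> e') *\<^sub>R (\<Sum>d\<in>Basis. ((A y e' - A x e') \<bullet> d) *\<^sub>R C x d))"
      by (subst linear_euclidean_expand[OF Cx.linear_axioms]) (rule refl)
    also have "\<dots> = (\<Sum>e'\<in>Basis. \<Sum>d\<in>Basis. ((A x e' - A y e') \<bullet> d) *\<^sub>R V e e' d x y)"
      by (simp add: V_def scaleR_sum_right inner_diff_left algebra_simps)
    finally show ?thesis .
  qed
  have contC: "isCont (\<lambda>x. C x e) x" if "x \<in> S" "e \<in> Basis" for x e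
    using cont S that by (simp add: continuous_on_eq_continuous_at)
  show ?thesis
    using assms(8,9)
  proof (induction k arbitrary: e)
    case 0
    have "rel_diff I g (\<lambda>x. C x e) p" if p: "p \<in> S" for p
    proof -
      have "expands I g p (\<lambda>z. \<Sum>e'\<in>Basis. \<Sum>d\<in>Basis. ((A (fst z) e' - A (snd z) e') \<bullet> d) *\<^sub>R V e e' d (fst z) (snd z))"
      proof (intro expands_sum expands_bilinear[OF fin bounded_bilinear_scaleR] expands_bounded_linear[OF _ bounded_linear_inner_left])
        fix e' d :: 'a assume ed: "e' \<in> Basis" "d \<in> Basis"
        show "expands I g p (\<lambda>z. A (fst z) e' - A (snd z) e')"
          using 0(1)[OF ed(1)] p by (simp add: rel_diff_def)
        show "((\<lambda>z. V e e' d (fst z) (snd z)) \<longlongrightarrow> V e e' d p p) (nhds (p, p))"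
          unfolding V_def
          by (intro tendsto_intros tendsto_fst_snd_nhds(1)[OF contC[OF p]] tendsto_fst_snd_nhds(2)[OF contC[OF p]] ed 0)
      qed
      moreover have "eventually (\<lambda>z. fst z \<in> S \<and> snd z \<in> S) (nhds (p, p))"
        unfolding nhds_prod eventually_prod_same using eventually_nhds_in_open[OF S p] by auto
      then have "eventually (\<lambda>z. (\<Sum>e'\<in>Basis. \<Sum>d\<in>Basis. ((A (fst z) e' - A (snd z) e') \<bullet> d) *\<^sub>R V e e' d (fst z) (snd z))
          = C (fst z) e - C (snd z) e) (nhds (p, p))"
        by eventually_elim (simp add: increment)
      ultimately show ?thesis unfolding rel_diff_def by (rule expands_cong)
    qed
    then show ?case using cont 0 by simp
  next
    case (Suc k)
    have "\<forall>e\<in>Basis. \<exists>A'. (\<forall>x\<in>S. ((\<lambda>x. A x e) has_derivative A' x) (at x)) \<and> (\<forall>b\<in>Basis. rel_Ck I g k S (\<lambda>x. A' x b))"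
      using Suc.prems(1) by (simp add: rel_Ck.simps(2))
    from bchoice[OF this] obtain A' where A': "\<And>e x. e \<in> Basis \<Longrightarrow> x \<in> S \<Longrightarrow> ((\<lambda>x. A x e) has_derivative A' e x) (at x)"
      "\<And>e b. e \<in> Basis \<Longrightarrow> b \<in> Basis \<Longrightarrow> rel_Ck I g k S (\<lambda>x. A' e x b)" by blast
    have C_k: "rel_Ck I g k S (\<lambda>x. C x e)" if "e \<in> Basis" for e
      using Suc.prems(1) rel_Ck_pred[OF fin S] that by (intro Suc.IH) blast
    have "((\<lambda>y. C y e) has_derivative (\<lambda>h. \<Sum>e'\<in>Basis. \<Sum>d\<in>Basis. (A' e' x h \<bullet> d) *\<^sub>R V e e' d x x)) (at x)"
      if x: "x \<in> S" for x
    proof -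
      \<comment> \<open>The increment formula is used with the base point x frozen. Its scalar
        factors vanish at y = x, so continuity of \<open>V\<close> suffices, and the resulting
        derivative contains only \<open>C\<close> and the derivative of \<open>A\<close>.\<close>
      have "((\<lambda>y. C x e + (\<Sum>e'\<in>Basis. \<Sum>d\<in>Basis. ((A y e' - A x e') \<bullet> d) *\<^sub>R V e e' d y x))
          has_derivative (\<lambda>h. 0 + (\<Sum>e'\<in>Basis. \<Sum>d\<in>Basis. (A' e' x h \<bullet> d) *\<^sub>R V e e' d x x))) (at x)"
      proof (intro has_derivative_add has_derivative_const has_derivative_sum has_derivative_scaleR_vanishing)
        fix e' d :: 'a assume ed: "e' \<in> Basis" "d \<in> Basis"
        have "((\<lambda>y. A y e' - A x e') has_derivative A' e' x) (at x)"
          using has_derivative_diff[OF A'(1)[OF ed(1) x] has_derivative_const] by simp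
        then show "((\<lambda>y. (A y e' - A x e') \<bullet> d) has_derivative (\<lambda>h. A' e' x h \<bullet> d)) (at x)"
          by (rule has_derivative_inner_left)
        show "isCont (\<lambda>y. V e e' d y x) x"
          unfolding V_def by (intro continuous_intros contC[OF x] ed)
      qed simp
      then have "((\<lambda>y. C x e + (\<Sum>e'\<in>Basis. \<Sum>d\<in>Basis. ((A y e' - A x e') \<bullet> d) *\<^sub>R V e e' d y x))
          has_derivative (\<lambda>h. \<Sum>e'\<in>Basis. \<Sum>d\<in>Basis. (A' e' x h \<bullet> d) *\<^sub>R V e e' d x x)) (at x)"
        by simp
      then show ?thesis
        by (rule has_derivative_transform_within_open[OF _ S x]) (simp add: increment[OF _ x, symmetric])
    qed
    moreover have "rel_Ck I g k S (\<lambda>x. \<Sum>e'\<in>Basis. \<Sum>d\<in>Basis. (A' e' x b \<bullet> d) *\<^sub>R V e e' d x x)"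
      if "b \<in> Basis" for b
      unfolding V_def
      by (intro rel_Ck_sum rel_Ck_bilinear[OF bounded_bilinear_scaleR fin S]
          rel_Ck_bounded_linear[OF _ bounded_linear_inner_left]
          rel_Ck_bounded_linear[OF _ bounded_linear_minus[OF bounded_linear_ident]] A'(2) C_k that Suc.prems(2))
    ultimately show ?case unfolding rel_Ck.simps
      by (intro exI[of _ "\<lambda>x h. \<Sum>e'\<in>Basis. \<Sum>d\<in>Basis. (A' e' x h \<bullet> d) *\<^sub>R V e e' d x x"]) blast
  qed
qed

text \<open>Derivatives of \<open>f\<close> at \<open>a x\<close> are read off from the known
  function \<open>f (a x)\<close> by solving the chain rule: differentiate in x and multiply by the
  inverse of the derivative of \<open>a\<close>. Every letter of the word costs one level, and words
  of length \<open>Suc j\<close> end at level 0.\<close>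

lemma rel_Ck_partial_deriv_transport:
  fixes f :: "'a::euclidean_space \<Rightarrow> 'b::real_normed_vector" and a b :: "'a \<Rightarrow> 'a"
  assumes fin: "finite I" and A: "open A" and B: "open B"
    and f: "Ck_on (Suc j) UNIV B f"
    and ab: "a ` A \<subseteq> B" "b ` B \<subseteq> A" "\<And>x. x \<in> A \<Longrightarrow> b (a x) = x" "\<And>y. y \<in> B \<Longrightarrow> a (b y) = y"
    and b: "Ck_on (Suc 0) UNIV B b"
    and a: "rel_Ck I g (Suc j) A a" and fa: "rel_Ck I g (Suc j) A (\<lambda>x. f (a x))"
  shows "length w + i = Suc j \<Longrightarrow> rel_Ck I g i A (\<lambda>x. partial_deriv w f (a x))"
proof -
  obtain a' where a': "\<forall>x\<in>A. (a has_derivative a' x) (at x)" "\<forall>e\<in>Basis. rel_Ck I g j A (\<lambda>x. a' x e)"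
    using a by (auto simp: rel_Ck.simps(2))
  obtain b' where b': "\<forall>y\<in>B. (b has_derivative b' y) (at y)" "\<forall>v. continuous_on B (\<lambda>y. b' y v)"
    using b by (auto simp: Ck_on_Suc_open[OF B])
  \<comment> \<open>The inverse of the derivative of \<open>a\<close>. Through \<open>b\<close> it
    is only known to be continuous; its relative smoothness comes from that of
    \<open>a'\<close>.\<close>
  define C where "C = (\<lambda>x. b' (a x))"
  have inv: "a' x (C x h) = h" "C x (a' x h) = h" if x: "x \<in> A" for x h
  proof -
    have ax: "a x \<in> B" using ab(1) x by blast
    have "((\<lambda>x. b (a x)) has_derivative (\<lambda>h. b' (a x) (a' x h))) (at x)"
      using has_derivative_compose[of a "a' x" x UNIV b "b' (a x)"] a'(1) b'(1) x ax by blast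
    then have "((\<lambda>x. x) has_derivative (\<lambda>h. b' (a x) (a' x h))) (at x)"
      by (rule has_derivative_transform_within_open[OF _ A x]) (rule ab(3))
    then have "(\<lambda>h. b' (a x) (a' x h)) = (\<lambda>h. h)"
      by (rule has_derivative_unique[OF _ has_derivative_ident])
    then show "C x (a' x h) = h" unfolding C_def by meson
    have "(a has_derivative a' x) (at (b (a x)))" using a'(1) x ab(3) by simp
    then have "((\<lambda>y. a (b y)) has_derivative (\<lambda>h. a' x (b' (a x) h))) (at (a x))"
      using has_derivative_compose[of b "b' (a x)" "a x" UNIV a "a' x"] b'(1) ax by blast
    then have "((\<lambda>y. y) has_derivative (\<lambda>h. a' x (b' (a x) h))) (at (a x))"
      by (rule has_derivative_transform_within_open[OF _ B ax]) (rule ab(4))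
    then have "(\<lambda>h. a' x (b' (a x) h)) = (\<lambda>h. h)"
      by (rule has_derivative_unique[OF _ has_derivative_ident])
    then show "a' x (C x h) = h" unfolding C_def by meson
  qed
  have C: "rel_Ck I g j A (\<lambda>x. C x e)" if "e \<in> Basis" for e
  proof (rule rel_Ck_inverse[OF fin A _ _ inv _ _ that])
    show "linear (a' x)" if "x \<in> A" for x using a'(1) that has_derivative_linear by blast
    show "linear (C x)" if "x \<in> A" for x
      using b'(1) ab(1) that has_derivative_linear unfolding C_def by blast
    show "continuous_on A (\<lambda>x. C x e)" for e
      unfolding C_def
      by (rule continuous_on_compose2[OF b'(2)[rule_format] rel_Ck_continuous[OF a] ab(1)])
    show "rel_Ck I g j A (\<lambda>x. a' x e)" if "e \<in> Basis" for e using a'(2) that by blast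
  qed
  show "length w + i = Suc j \<Longrightarrow> rel_Ck I g i A (\<lambda>x. partial_deriv w f (a x))"
  proof (induction w arbitrary: i)
    case Nil
    then show ?case using fa by simp
  next
    case (Cons e w)
    define u where "u = partial_deriv w f"
    have u_C1: "Ck_on (Suc i) UNIV B u" unfolding u_def
      using Cons.prems f by (intro Ck_on_partial_deriv[OF B]) simp
    have "rel_Ck I g (Suc i) A (\<lambda>x. u (a x))"
      unfolding u_def using Cons.prems by (intro Cons.IH) simp
    then obtain U where U: "\<forall>x\<in>A. ((\<lambda>x. u (a x)) has_derivative U x) (at x)" "\<forall>e\<in>Basis. rel_Ck I g i A (\<lambda>x. U x e)"
      by (auto simp: rel_Ck.simps(2))
    have U_eq: "U x (C x e) = frechet_derivative u (at (a x)) e" if x: "x \<in> A" for x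
    proof -
      have "a x \<in> B" using ab(1) x by blast
      then have "(u has_derivative frechet_derivative u (at (a x))) (at (a x))"
        by (rule Ck_on_frechet_derivative(1)[OF B u_C1])
      then have "((\<lambda>x. u (a x)) has_derivative (\<lambda>h. frechet_derivative u (at (a x)) (a' x h))) (at x)"
        using has_derivative_compose[of a "a' x" x UNIV u] a'(1) x by blast
      then have "U x = (\<lambda>h. frechet_derivative u (at (a x)) (a' x h))"
        using U(1) x has_derivative_unique by blast
      then show ?thesis by (simp add: inv x)
    qed
    \<comment> \<open>The word is nonempty here, hence i is at most \<open>j\<close>, the level
      available for \<open>C\<close>.\<close>
    have C_i: "rel_Ck I g i A (\<lambda>x. C x e)" if "e \<in> Basis" for e
      using rel_Ck_mono[OF fin A C[OF that]] Cons.prems by simp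
    have C_e: "rel_Ck I g i A (\<lambda>x. C x e)"
    proof (rule rel_Ck_cong[OF A])
      show "rel_Ck I g i A (\<lambda>x. \<Sum>b\<in>Basis. (e \<bullet> b) *\<^sub>R C x b)"
        by (intro rel_Ck_sum rel_Ck_bounded_linear[OF _ bounded_linear_scaleR_right] C_i)
      show "(\<Sum>b\<in>Basis. (e \<bullet> b) *\<^sub>R C x b) = C x e" if "x \<in> A" for x
        using b'(1) ab(1) that has_derivative_linear unfolding C_def
        by (intro linear_euclidean_expand[symmetric]) blast
    qed
    have "rel_Ck I g i A (\<lambda>x. \<Sum>d\<in>Basis. (C x e \<bullet> d) *\<^sub>R U x d)"
      using U(2) by (intro rel_Ck_sum rel_Ck_bilinear[OF bounded_bilinear_scaleR fin A]
          rel_Ck_bounded_linear[OF C_e bounded_linear_inner_left]) blast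
    then have "rel_Ck I g i A (\<lambda>x. frechet_derivative u (at (a x)) e)"
    proof (rule rel_Ck_cong[OF A])
      fix x assume x: "x \<in> A"
      have "linear (U x)" using U(1) x has_derivative_linear by blast
      then show "(\<Sum>d\<in>Basis. (C x e \<bullet> d) *\<^sub>R U x d) = frechet_derivative u (at (a x)) e"
        using linear_euclidean_expand[of "U x" "C x e"] U_eq[OF x] by simp
    qed
    then show ?case by (simp add: u_def)
  qed
qed

subsection \<open>Homogeneous graphs\<close>

definition Ck_inverse_pair ::
  "nat \<Rightarrow> 'a::euclidean_space set \<Rightarrow> 'a set \<Rightarrow> ('a \<Rightarrow> 'a) \<Rightarrow> ('a \<Rightarrow> 'a) \<Rightarrow> bool"
where
  "Ck_inverse_pair k U V H K \<longleftrightarrow> open U \<and> open V \<and> Ck_on k UNIV U H \<and> Ck_on k UNIV V K \<and>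
     H ` U \<subseteq> V \<and> K ` V \<subseteq> U \<and> (\<forall>z\<in>U. K (H z) = z) \<and> (\<forall>z\<in>V. H (K z) = z)"

lemma Ck_inverse_pair_sym: "Ck_inverse_pair k U V H K \<Longrightarrow> Ck_inverse_pair k V U K H"
  by (auto simp: Ck_inverse_pair_def)

text \<open>
  The graph of \<open>f\<close> over the range of the projection \<open>P\<close>. Extending \<open>f\<close> to be constant along the
  kernel of \<open>P\<close> gives it an open domain \<open>\<Omega>\<close> in the ambient space.
\<close>

locale graph_over =
  fixes P :: "'a::euclidean_space \<Rightarrow> 'a" and f :: "'a \<Rightarrow> 'a" and \<Omega> :: "'a set"
  assumes P: "bounded_linear P" and PP [simp]: "P (P x) = P x"
    and open_\<Omega>: "open \<Omega>" and P_in_\<Omega>: "P x \<in> \<Omega> \<longleftrightarrow> x \<in> \<Omega>"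
    and f_P [simp]: "f (P x) = f x" and P_f: "x \<in> \<Omega> \<Longrightarrow> P (f x) = 0"
begin

definition graph_pt :: "'a \<Rightarrow> 'a" where
  "graph_pt x = P x + f x"

text \<open>The true base map lives on the range of \<open>P\<close>. On the kernel of
  \<open>P\<close> it is completed by a translation, chosen so that \<open>p\<close> goes to
  \<open>q\<close>; the completion stays invertible, and \<open>f\<close> does not see it.\<close>

definition base_map :: "('a \<Rightarrow> 'a) \<Rightarrow> 'a \<Rightarrow> 'a \<Rightarrow> 'a \<Rightarrow> 'a" where
  "base_map H p q x = P (H (graph_pt x)) + (x - P x) + ((q - P q) - (p - P p))"

sublocale P: bounded_linear P by (rule P)

lemma P_graph_pt: "x \<in> \<Omega> \<Longrightarrow> P (graph_pt x) = P x"
  by (simp add: graph_pt_def P.add P_f)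

lemma P_base_map: "P (base_map H p q x) = P (H (graph_pt x))"
  by (simp add: base_map_def P.add P.diff)

lemma base_map_graph:
  assumes "H (graph_pt x) \<in> graph_pt ` \<Omega>"
  shows "base_map H p q x \<in> \<Omega>" "graph_pt (base_map H p q x) = H (graph_pt x)"
    "f (base_map H p q x) = H (graph_pt x) - P (H (graph_pt x))"
proof -
  obtain x' where x': "x' \<in> \<Omega>" "H (graph_pt x) = graph_pt x'" using assms by blast
  have eq: "P (base_map H p q x) = P x'" by (simp add: P_base_map x' P_graph_pt)
  have f: "f (base_map H p q x) = f x'" by (metis eq f_P)
  show "base_map H p q x \<in> \<Omega>" using eq x'(1) P_in_\<Omega> by metis
  show "graph_pt (base_map H p q x) = H (graph_pt x)"
    by (simp only: x'(2)) (simp only: graph_pt_def eq f)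
  show "f (base_map H p q x) = H (graph_pt x) - P (H (graph_pt x))"
    by (simp only: f x'(2) P_graph_pt[OF x'(1)]) (simp add: graph_pt_def)
qed

lemma base_map_inverse:
  assumes "x \<in> \<Omega>" "H (graph_pt x) \<in> graph_pt ` \<Omega>" "K (H (graph_pt x)) = graph_pt x"
  shows "base_map K q p (base_map H p q x) = x"
proof -
  have "base_map K q p (base_map H p q x)
      = P (K (H (graph_pt x))) + (base_map H p q x - P (base_map H p q x)) + ((p - P p) - (q - P q))"
    by (simp add: base_map_def[of K] base_map_graph[of H x, OF assms(2)])
  also have "\<dots> = P x + (base_map H p q x - P (H (graph_pt x))) + ((p - P p) - (q - P q))"
    by (simp add: assms P_graph_pt P_base_map)
  also have "\<dots> = x" by (simp add: base_map_def)
  finally show ?thesis .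
qed

lemma base_map_base: "q \<in> \<Omega> \<Longrightarrow> H (graph_pt p) = graph_pt q \<Longrightarrow> base_map H p q p = q"
  by (simp add: base_map_def P_graph_pt)

lemma Ck_on_graph_pt: "Ck_on k UNIV \<Omega> f \<Longrightarrow> Ck_on k UNIV \<Omega> graph_pt"
  unfolding graph_pt_def by (rule Ck_on_add[OF Ck_on_bounded_linear[OF P]])

lemma open_graph_preimage:
  assumes "Ck_on k UNIV \<Omega> f" "open U"
  shows "open {x \<in> \<Omega>. graph_pt x \<in> U}"
proof -
  have "open (\<Omega> \<inter> graph_pt -` U)"
    using Ck_on_continuous[OF Ck_on_graph_pt[OF assms(1)]] open_\<Omega> assms(2)
    by (rule continuous_open_preimage)
  then show ?thesis by (simp add: vimage_def Int_def)
qed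

lemma Ck_on_base_map:
  assumes f: "Ck_on k UNIV \<Omega> f" and U: "open U" and H: "Ck_on k UNIV U H"
  shows "Ck_on k UNIV {x \<in> \<Omega>. graph_pt x \<in> U} (base_map H p q)"
proof -
  have "Ck_on k UNIV {x \<in> \<Omega>. graph_pt x \<in> U} (\<lambda>x. H (graph_pt x))"
    using Ck_on_subset[OF Ck_on_graph_pt[OF f]]
    by (intro Ck_on_compose[OF open_graph_preimage[OF f U] U _ _ H]) auto
  then show ?thesis
    unfolding base_map_def
    by (intro Ck_on_add Ck_on_diff Ck_on_const Ck_on_bounded_linear_compose[OF _ P]
        Ck_on_bounded_linear[OF P] Ck_on_bounded_linear[OF bounded_linear_ident])
qed

text \<open>With \<open>f\<close> of class C^(j+1) and \<open>H\<close> of class C^(j+2), the family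
  \<open>g\<close> consists of all components of the derivatives of \<open>f\<close> of order
  \<open>Suc j\<close>. Everything formed from \<open>f\<close> and \<open>H\<close> is then
  relatively smooth of level \<open>Suc j\<close>.\<close>

lemma carries_base_map:
  fixes j :: nat
  defines "I \<equiv> {w. set w \<subseteq> (Basis::'a set) \<and> length w = Suc j} \<times> (Basis::'a set)"
    and "g \<equiv> \<lambda>(w, c) x. partial_deriv w f x \<bullet> c"
  assumes f: "Ck_on (Suc j) UNIV \<Omega> f"
    and HK: "Ck_inverse_pair (Suc (Suc j)) U V H K"
    and pq: "p \<in> \<Omega>" "q \<in> \<Omega>" "graph_pt p \<in> U" "H (graph_pt p) = graph_pt q"
    and graph: "\<And>x. x \<in> \<Omega> \<Longrightarrow> graph_pt x \<in> U \<Longrightarrow> H (graph_pt x) \<in> graph_pt ` \<Omega>"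
      "\<And>y. y \<in> \<Omega> \<Longrightarrow> graph_pt y \<in> V \<Longrightarrow> K (graph_pt y) \<in> graph_pt ` \<Omega>"
  shows "carries I g p q (base_map H p q)"
    and "eventually (\<lambda>x. base_map K q p (base_map H p q x) = x) (nhds p)"
proof -
  define A where "A = {x \<in> \<Omega>. graph_pt x \<in> U}"
  define B where "B = {y \<in> \<Omega>. graph_pt y \<in> V}"
  define a where "a = base_map H p q"
  define b where "b = base_map K q p"
  have U: "open U" "open V" and H: "Ck_on (Suc (Suc j)) UNIV U H" and K: "Ck_on (Suc (Suc j)) UNIV V K"
    and maps: "\<And>z. z \<in> U \<Longrightarrow> H z \<in> V" "\<And>z. z \<in> V \<Longrightarrow> K z \<in> U"
    and KH: "\<And>z. z \<in> U \<Longrightarrow> K (H z) = z" "\<And>z. z \<in> V \<Longrightarrow> H (K z) = z"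
    using HK by (auto simp: Ck_inverse_pair_def)
  have A: "open A" and B: "open B"
    unfolding A_def B_def using open_graph_preimage[OF f] U by blast+
  have fin: "finite I"
    unfolding I_def by (intro finite_cartesian_product finite_lists_length_eq) auto
  have ab: "a ` A \<subseteq> B" "b ` B \<subseteq> A" "\<And>x. x \<in> A \<Longrightarrow> b (a x) = x" "\<And>y. y \<in> B \<Longrightarrow> a (b y) = y"
    using graph maps KH
    by (auto simp: a_def b_def A_def B_def base_map_graph base_map_inverse)
  have pA: "p \<in> A" using pq by (simp add: A_def)
  have "A \<subseteq> \<Omega>" "B \<subseteq> \<Omega>" by (auto simp: A_def B_def)
  \<comment> \<open>Tautological at the top: the derivatives of order \<open>Suc j\<close> are
    combinations of the generators themselves.\<close>
  have rel_f: "rel_Ck I g (Suc j) \<Omega> f"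
  proof -
    have "rel_diff I g (partial_deriv w f) x" if w: "set w \<subseteq> Basis" "length w = Suc j" for w x
    proof -
      have "rel_diff I g (\<lambda>x. (\<lambda>t. t *\<^sub>R c) (partial_deriv w f x \<bullet> c)) x" if "c \<in> Basis" for c
        using rel_diff_generator[OF fin, of "(w, c)" g x] w that
        by (intro rel_diff_bounded_linear[OF _ bounded_linear_scaleR_left]) (simp add: I_def g_def)
      then have "rel_diff I g (\<lambda>x. \<Sum>c\<in>Basis. (partial_deriv w f x \<bullet> c) *\<^sub>R c) x"
        unfolding rel_diff_def sum_subtractf[symmetric] by (intro expands_sum) simp
      then show ?thesis by (simp add: euclidean_representation)
    qed
    then show ?thesis
      using rel_Ck_partial_deriv[OF open_\<Omega> f, of I g "[]" "Suc j"] by simp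
  qed
  have rel_graph: "rel_Ck I g (Suc j) A graph_pt"
    unfolding graph_pt_def
    by (intro rel_Ck_add rel_Ck_subset[OF rel_f \<open>A \<subseteq> \<Omega>\<close>] Ck_on_imp_rel_Ck[OF fin A] Ck_on_bounded_linear P)
  have C1_graph: "Ck_on (Suc 0) UNIV A graph_pt"
    by (rule Ck_on_subset[OF Ck_on_graph_pt \<open>A \<subseteq> \<Omega>\<close>]) (rule Ck_on_mono[OF f], simp)
  have rel_H: "rel_Ck I g (Suc j) A (\<lambda>x. H (graph_pt x))"
    by (rule rel_Ck_compose[OF fin A U(1) _ C1_graph rel_graph H]) (auto simp: A_def)
  have rel_a: "rel_Ck I g (Suc j) A a"
  proof -
    have "Ck_on (Suc (Suc j)) UNIV A (\<lambda>x. x - P x + ((q - P q) - (p - P p)))"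
      by (intro Ck_on_add Ck_on_diff Ck_on_const Ck_on_bounded_linear[OF P] Ck_on_bounded_linear[OF bounded_linear_ident])
    then have "rel_Ck I g (Suc j) A (\<lambda>x. P (H (graph_pt x)) + (x - P x + ((q - P q) - (p - P p))))"
      by (intro rel_Ck_add rel_Ck_bounded_linear[OF rel_H P] Ck_on_imp_rel_Ck[OF fin A])
    then show ?thesis by (simp add: a_def base_map_def[abs_def] add.assoc)
  qed
  \<comment> \<open>The graph condition gives \<open>f (a x)\<close> as the part of
    \<open>H (graph_pt x)\<close> killed by \<open>P\<close>, so \<open>f\<close> is never composed
    with \<open>a\<close> directly.\<close>
  have "rel_Ck I g (Suc j) A (\<lambda>x. H (graph_pt x) + (- P (H (graph_pt x))))"
    by (intro rel_Ck_add rel_H rel_Ck_bounded_linear[OF rel_H bounded_linear_minus[OF P]])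
  then have rel_fa: "rel_Ck I g (Suc j) A (\<lambda>x. f (a x))"
    by (rule rel_Ck_cong[OF A]) (simp add: a_def A_def base_map_graph graph)
  have C1_b: "Ck_on (Suc 0) UNIV B b"
    unfolding B_def b_def
    by (intro Ck_on_base_map U Ck_on_mono[OF f] Ck_on_mono[OF K]) auto
  have C1_a: "Ck_on (Suc 0) UNIV A a"
    by (rule rel_Ck_imp_C1[OF A rel_a])
  have transport: "rel_Ck I g 0 A (\<lambda>x. partial_deriv w f (a x))" if "length w = Suc j" for w
    by (rule rel_Ck_partial_deriv_transport[OF fin A B Ck_on_subset[OF f \<open>B \<subseteq> \<Omega>\<close>] ab C1_b rel_a rel_fa])
       (simp_all add: that)
  have "rel_diff I g (\<lambda>x. g i (a x)) p" if iI: "i \<in> I" for i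
  proof -
    obtain w c where i: "i = (w, c)" "length w = Suc j" using iI by (auto simp: I_def)
    have "rel_diff I g (\<lambda>x. partial_deriv w f (a x)) p" using transport[OF i(2)] pA by simp
    then show ?thesis
      unfolding i(1) g_def using rel_diff_bounded_linear[OF _ bounded_linear_inner_left] by fastforce
  qed
  moreover have "isCont a p"
    using rel_Ck_continuous[OF rel_a] A pA by (simp add: continuous_on_eq_continuous_at)
  moreover have "rel_diff {} g a p" by (rule Ck_on_1_strict_diff[OF A C1_a pA])
  moreover have "a p = q" using base_map_base pq by (simp add: a_def)
  ultimately show "carries I g p q (base_map H p q)" by (simp add: carries_def a_def)
  show "eventually (\<lambda>x. base_map K q p (base_map H p q x) = x) (nhds p)"
    using eventually_nhds_in_open[OF A pA] by eventually_elim (use ab(3) in \<open>simp add: a_def b_def\<close>)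
qed

text \<open>Bootstrapping one class at a time from C^1. Passing from class \<open>Suc j\<close> to
  \<open>Suc (Suc j)\<close> uses \<open>H\<close> of class \<open>Suc (Suc j)\<close>, so the gain
  stops exactly at \<open>k\<close>.\<close>

theorem homogeneous_graph_Ck:
  assumes C1: "Ck_on (Suc 0) UNIV \<Omega> f"
    and hom: "\<And>p q. p \<in> \<Omega> \<Longrightarrow> q \<in> \<Omega> \<Longrightarrow> \<exists>U V H K. Ck_inverse_pair k U V H K \<and>
       graph_pt p \<in> U \<and> graph_pt q \<in> V \<and> H (graph_pt p) = graph_pt q \<and>
       (\<forall>x\<in>\<Omega>. graph_pt x \<in> U \<longrightarrow> H (graph_pt x) \<in> graph_pt ` \<Omega>) \<and>
       (\<forall>y\<in>\<Omega>. graph_pt y \<in> V \<longrightarrow> K (graph_pt y) \<in> graph_pt ` \<Omega>)"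
  shows "Suc j \<le> k \<Longrightarrow> Ck_on (Suc j) UNIV \<Omega> f"
proof (induction j)
  case 0
  then show ?case using C1 by simp
next
  case (Suc j)
  then have f: "Ck_on (Suc j) UNIV \<Omega> f" by simp
  define I where "I = {w. set w \<subseteq> (Basis::'a set) \<and> length w = Suc j} \<times> (Basis::'a set)"
  define g where "g = (\<lambda>(w, c) x. partial_deriv w f x \<bullet> c)"
  have fin: "finite I"
    unfolding I_def by (intro finite_cartesian_product finite_lists_length_eq) auto
  have cont_pd: "continuous_on \<Omega> (partial_deriv w f)" if "length w = Suc j" for w
    using Ck_on_partial_deriv[OF open_\<Omega>, of w 0 f] f that by simp
  have comp: "Ck_on (Suc 0) UNIV \<Omega> (g i)" if "i \<in> I" for i
  proof -
    have "\<exists>u'. (\<forall>x\<in>\<Omega>. (g i has_derivative u' x) (at x)) \<and> (\<forall>h. continuous_on \<Omega> (\<lambda>x. u' x h))"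
    proof (rule homogeneous_family_C1[OF open_\<Omega> fin _ _ that])
      show "continuous_on \<Omega> (g i)" if "i \<in> I" for i
        using that cont_pd by (auto simp: I_def g_def intro!: continuous_intros)
      fix p q assume pq: "p \<in> \<Omega>" "q \<in> \<Omega>"
      obtain U V H K where "Ck_inverse_pair k U V H K"
        and HK: "graph_pt p \<in> U" "graph_pt q \<in> V" "H (graph_pt p) = graph_pt q"
          "\<And>x. x \<in> \<Omega> \<Longrightarrow> graph_pt x \<in> U \<Longrightarrow> H (graph_pt x) \<in> graph_pt ` \<Omega>"
          "\<And>y. y \<in> \<Omega> \<Longrightarrow> graph_pt y \<in> V \<Longrightarrow> K (graph_pt y) \<in> graph_pt ` \<Omega>"
        using hom[OF pq] by blast
      then have pair: "Ck_inverse_pair (Suc (Suc j)) U V H K"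
        using Suc.prems Ck_on_mono unfolding Ck_inverse_pair_def by blast
      have "K (H (graph_pt p)) = graph_pt p" using pair HK(1) by (simp add: Ck_inverse_pair_def)
      then have Kq: "K (graph_pt q) = graph_pt p" by (simp add: HK(3))
      show "\<exists>a b. carries I g p q a \<and> carries I g q p b \<and>
          eventually (\<lambda>x. b (a x) = x) (nhds p) \<and> eventually (\<lambda>y. a (b y) = y) (nhds q)"
        using carries_base_map[OF f pair pq HK(1,3,4,5)]
          carries_base_map[OF f Ck_inverse_pair_sym[OF pair] pq(2,1) HK(2) Kq HK(5,4)]
        unfolding I_def g_def by blast
    qed
    then show ?thesis by (simp add: Ck_on_Suc_open[OF open_\<Omega>])
  qed
  have "Ck_on (Suc 0) UNIV \<Omega> (partial_deriv w f)" if w: "set w \<subseteq> Basis" "length w = Suc j" for w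
  proof -
    have "Ck_on (Suc 0) UNIV \<Omega> (\<lambda>x. \<Sum>c\<in>Basis. g (w, c) x *\<^sub>R c)"
      by (intro Ck_on_sum Ck_on_bounded_linear_compose[OF _ bounded_linear_scaleR_left] comp)
         (simp add: I_def w)
    then show ?thesis by (simp add: g_def euclidean_representation)
  qed
  then show ?case
    using Ck_on_Suc_of_partial_deriv[OF open_\<Omega> f, of "[]" "Suc j"] by simp
qed

end

section \<open>A C^1 submanifold as a graph over its tangent space\<close>

text \<open>Applying \<open>C\<close> to the remainder of \<open>G\<close> bounds the remainder of
  \<open>h\<close> by a small multiple of the increment of \<open>h\<close> itself. Accuracy 1/2
  shows that \<open>h\<close> is Lipschitz near \<open>y\<close>, after which that increment can be
  replaced by the increment of the argument.\<close>

lemma strict_diff_inverse: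
  fixes h :: "'a::real_normed_vector \<Rightarrow> 'b::real_normed_vector"
  assumes C: "bounded_linear C" "\<And>v. C (A v) = v"
    and G: "negligible_wrt (nhds (x, x)) (osc {} g) (\<lambda>z. G (fst z) - G (snd z) - A (fst z - snd z))"
    and h: "isCont h y" "h y = x" "eventually (\<lambda>y. G (h y) = y) (nhds y)"
  shows "rel_diff {} g' h y"
proof -
  obtain K where K: "K > 0" "\<And>v. norm (C v) \<le> norm v * K"
    using bounded_linear.pos_bounded[OF C(1)] by blast
  interpret C: bounded_linear C by fact
  have inv: "eventually (\<lambda>z. G (h (fst z)) = fst z \<and> G (h (snd z)) = snd z) (nhds (y, y))"
    unfolding nhds_prod eventually_prod_same using h(3) by auto
  have small: "eventually (\<lambda>z. norm (h (fst z) - h (snd z) - C (fst z - snd z)) \<le> d * norm (h (fst z) - h (snd z))) (nhds (y, y))"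
    if d: "d > 0" for d
  proof -
    have dK: "d / K > 0" using d K(1) by simp
    show ?thesis
      using inv eventually_compose_filterlim[OF negligible_wrtD[OF G dK] filterlim_diag_map[OF h(1,2)]]
    proof eventually_elim
      case (elim z)
      have "h (fst z) - h (snd z) - C (fst z - snd z) = - C (G (h (fst z)) - G (h (snd z)) - A (h (fst z) - h (snd z)))"
        using elim(1) by (simp add: C.diff C(2))
      also have "norm \<dots> \<le> norm (G (h (fst z)) - G (h (snd z)) - A (h (fst z) - h (snd z))) * K"
        by (simp only: norm_minus_cancel K(2))
      also have "\<dots> \<le> d / K * norm (h (fst z) - h (snd z)) * K"
        using elim(2) K(1) by (intro mult_right_mono) (auto simp: osc_def)
      finally show ?case using K(1) by simp
    qed
  qed
  have "negligible_wrt (nhds (y, y)) (osc {} g') (\<lambda>z. h (fst z) - h (snd z) - C (fst z - snd z))"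
    unfolding negligible_wrt_def
  proof (intro allI impI)
    fix e :: real assume e: "e > 0"
    define d where "d = e / (2 * K)"
    have d: "d > 0" using e K(1) by (simp add: d_def)
    have half: "(1/2::real) > 0" by simp
    show "eventually (\<lambda>z. norm (h (fst z) - h (snd z) - C (fst z - snd z)) \<le> e * osc {} g' z) (nhds (y, y))"
      using small[OF half] small[OF d]
    proof eventually_elim
      case (elim z)
      have "norm (h (fst z) - h (snd z)) \<le> norm (C (fst z - snd z)) + 1/2 * norm (h (fst z) - h (snd z))"
        using norm_triangle_ineq2[of "h (fst z) - h (snd z)" "C (fst z - snd z)"] elim(1) by linarith
      then have "norm (h (fst z) - h (snd z)) \<le> 2 * K * norm (fst z - snd z)"
        using K(2)[of "fst z - snd z"] by (simp add: mult.commute)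
      then have "d * norm (h (fst z) - h (snd z)) \<le> d * (2 * K * norm (fst z - snd z))"
        using d by (intro mult_left_mono) auto
      also have "\<dots> = e * norm (fst z - snd z)" using K(1) by (simp add: d_def)
      finally show ?case using elim(2) by (simp add: osc_def)
    qed
  qed
  then show ?thesis unfolding rel_diff_def expands_def
    by (intro exI[of _ C] exI) (simp add: C(1))
qed

lemma Ck_inverse_pair_restrict:
  assumes "Ck_inverse_pair k U V H K" "open S" "open T"
  shows "Ck_inverse_pair k (U \<inter> S \<inter> H -` T) (V \<inter> T \<inter> K -` S) H K"
proof -
  have "open (U \<inter> H -` T)" "open (V \<inter> K -` S)"
    using assms by (auto simp: Ck_inverse_pair_def intro!: continuous_open_preimage Ck_on_continuous)
  then have "open ((U \<inter> H -` T) \<inter> S)" "open ((V \<inter> K -` S) \<inter> T)"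
    using assms(2,3) by blast+
  moreover have "(U \<inter> H -` T) \<inter> S = U \<inter> S \<inter> H -` T" "(V \<inter> K -` S) \<inter> T = V \<inter> T \<inter> K -` S" by blast+
  moreover have "Ck_on k UNIV (U \<inter> S \<inter> H -` T) H" "Ck_on k UNIV (V \<inter> T \<inter> K -` S) K"
    using assms(1) by (auto simp: Ck_inverse_pair_def elim!: Ck_on_subset)
  ultimately show ?thesis
    using assms(1) unfolding Ck_inverse_pair_def by auto
qed

lemma exists_linear_projection:
  fixes E :: "'a::euclidean_space set"
  assumes "subspace E"
  obtains P :: "'a \<Rightarrow> 'a" where "bounded_linear P" "range P \<subseteq> E" "\<And>v. v \<in> E \<Longrightarrow> P v = v"
proof -
  have "linear (\<lambda>x::'a. x)" by (rule linear_ident)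
  then obtain P :: "'a \<Rightarrow> 'a" where "linear P" "range P \<subseteq> E" "\<forall>v\<in>E. P v = v"
    using real_vector.linear_exists_left_inverse_on[of "\<lambda>x::'a. x" E] assms by (auto simp: inj_on_def)
  then show thesis by (intro that[of P]) (auto simp: linear_conv_bounded_linear)
qed

text \<open>
  With \<open>\<xi>\<close> normalised by the inverse \<open>D\<close> of its derivative at \<open>p0\<close>, the map
  \<open>G z = P z + (D (\<xi> z) - P (D (\<xi> z)))\<close> has derivative \<open>id\<close> at \<open>p0\<close>, and \<open>N\<close> is the set where
  \<open>G z = P z\<close>; hence \<open>N\<close> is the graph of \<open>G\<inverse> \<circ> P - P\<close>.
\<close>

theorem homogeneous_imp_Ck_graph:
  fixes N L :: "'a::euclidean_space set"
  assumes p0: "p0 \<in> N" "p0 \<in> V0" and L: "subspace L"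
    and pair: "Ck_inverse_pair (Suc 0) V0 W0 \<xi> \<tau>"
    and flat: "\<And>z. z \<in> V0 \<Longrightarrow> z \<in> N \<longleftrightarrow> \<xi> z \<in> L"
    and hom: "\<And>p q. p \<in> N \<inter> V0 \<Longrightarrow> q \<in> N \<inter> V0 \<Longrightarrow> \<exists>U V H K. Ck_inverse_pair (Suc k) U V H K \<and>
       p \<in> U \<and> q \<in> V \<and> H p = q \<and> (\<forall>z\<in>U \<inter> N. H z \<in> N) \<and> (\<forall>z\<in>V \<inter> N. K z \<in> N)"
  obtains D P f \<Omega> O' where "(\<tau> has_derivative D) (at (\<xi> p0))" "inj D" "linear D"
    "bounded_linear P" "range P \<subseteq> D ` L" "\<And>v. v \<in> D ` L \<Longrightarrow> P v = v"
    "open \<Omega>" "\<And>x. P x \<in> \<Omega> \<longleftrightarrow> x \<in> \<Omega>" "\<And>x. f (P x) = f x" "\<And>x. x \<in> \<Omega> \<Longrightarrow> P (f x) = 0"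
    "Ck_on (Suc k) UNIV \<Omega> f" "open O'" "p0 \<in> O'" "O' \<subseteq> V0" "O' \<subseteq> \<Omega>"
    "\<And>z. z \<in> O' \<Longrightarrow> z \<in> N \<longleftrightarrow> z = P z + f z" "\<And>x. x \<in> \<Omega> \<Longrightarrow> P x + f x \<in> N"
proof -
  have V0: "open V0" "open W0" and \<xi>\<tau>: "\<xi> ` V0 \<subseteq> W0" "\<tau> ` W0 \<subseteq> V0" "\<And>z. z \<in> V0 \<Longrightarrow> \<tau> (\<xi> z) = z" "\<And>z. z \<in> W0 \<Longrightarrow> \<xi> (\<tau> z) = z"
    and C1: "Ck_on (Suc 0) UNIV V0 \<xi>" "Ck_on (Suc 0) UNIV W0 \<tau>"
    using pair by (auto simp: Ck_inverse_pair_def)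
  obtain \<xi>' where \<xi>': "\<forall>x\<in>V0. (\<xi> has_derivative \<xi>' x) (at x)" "\<forall>v. continuous_on V0 (\<lambda>x. \<xi>' x v)"
    using C1(1) by (auto simp: Ck_on_Suc_open[OF V0(1)])
  obtain \<tau>' where \<tau>': "\<forall>x\<in>W0. (\<tau> has_derivative \<tau>' x) (at x)"
    using C1(2) by (auto simp: Ck_on_Suc_open[OF V0(2)])
  define D where "D = \<tau>' (\<xi> p0)"
  have D: "(\<tau> has_derivative D) (at (\<xi> p0))" unfolding D_def using \<tau>' \<xi>\<tau>(1) p0(2) by blast
  have M: "(\<xi> has_derivative \<xi>' p0) (at p0)" using \<xi>'(1) p0(2) by blast
  have x0: "\<xi> p0 \<in> W0" using \<xi>\<tau>(1) p0(2) by blast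
  have DM: "D (\<xi>' p0 h) = h" for h
  proof -
    have "((\<lambda>x. \<tau> (\<xi> x)) has_derivative (\<lambda>h. D (\<xi>' p0 h))) (at p0)"
      by (rule has_derivative_compose[OF M D])
    then have "((\<lambda>x. x) has_derivative (\<lambda>h. D (\<xi>' p0 h))) (at p0)"
      by (rule has_derivative_transform_within_open[OF _ V0(1) p0(2)]) (rule \<xi>\<tau>(3))
    then have "(\<lambda>h. D (\<xi>' p0 h)) = (\<lambda>h. h)" by (rule has_derivative_unique[OF _ has_derivative_ident])
    then show ?thesis by meson
  qed
  have MD: "\<xi>' p0 (D h) = h" for h
  proof -
    have "(\<xi> has_derivative \<xi>' p0) (at (\<tau> (\<xi> p0)))" using M p0(2) \<xi>\<tau>(3) by simp
    then have "((\<lambda>x. \<xi> (\<tau> x)) has_derivative (\<lambda>h. \<xi>' p0 (D h))) (at (\<xi> p0))"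
      by (rule has_derivative_compose[OF D])
    then have "((\<lambda>x. x) has_derivative (\<lambda>h. \<xi>' p0 (D h))) (at (\<xi> p0))"
      by (rule has_derivative_transform_within_open[OF _ V0(2) x0]) (rule \<xi>\<tau>(4))
    then have "(\<lambda>h. \<xi>' p0 (D h)) = (\<lambda>h. h)" by (rule has_derivative_unique[OF _ has_derivative_ident])
    then show ?thesis by meson
  qed
  have injD: "inj D" by (metis MD injI)
  have blD: "bounded_linear D" using D by (rule has_derivative_bounded_linear)
  then have linD: "linear D" by (rule bounded_linear.linear)
  \<comment> \<open>The image of \<open>L\<close> under \<open>D\<close> is the tangent space of
    \<open>N\<close> at \<open>p0\<close>, and \<open>P\<close> projects onto it along some
    complement.\<close>
  have "subspace (D ` L)" using linD L by (rule linear_subspace_image)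
  then obtain P :: "'a \<Rightarrow> 'a" where P: "bounded_linear P" "range P \<subseteq> D ` L" "\<And>v. v \<in> D ` L \<Longrightarrow> P v = v"
    by (rule exists_linear_projection) blast
  interpret P: bounded_linear P by (rule P)
  have PP: "P (P x) = P x" for x using P(2,3) by blast
  define G where "G = (\<lambda>z. P z + (D (\<xi> z) - P (D (\<xi> z))))"
  define G' where "G' = (\<lambda>x h. P h + (D (\<xi>' x h) - P (D (\<xi>' x h))))"
  have derG: "(G has_derivative G' x) (at x)" if "x \<in> V0" for x
    unfolding G_def G'_def using \<xi>'(1) that
    by (intro has_derivative_add has_derivative_diff bounded_linear_imp_has_derivative P(1)
        bounded_linear.has_derivative[OF P(1)] bounded_linear.has_derivative[OF blD]) blast+
  have contG': "continuous_on V0 (\<lambda>x. G' x v)" for v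
    unfolding G'_def using \<xi>'(2)
    by (intro continuous_intros bounded_linear.continuous_on[OF P(1)] bounded_linear.continuous_on[OF blD]) blast+
  have G'_blinfun: "blinfun_apply (Blinfun (G' x)) = G' x" if "x \<in> V0" for x
    using derG[OF that] by (intro bounded_linear_Blinfun_apply) (rule has_derivative_bounded_linear)
  have "continuous_on V0 (\<lambda>x. Blinfun (G' x))"
  proof (rule continuous_on_blinfun_componentwise)
    fix i :: 'a
    show "continuous_on V0 (\<lambda>x. blinfun_apply (Blinfun (G' x)) i)"
      using contG'[of i] by (rule continuous_on_eq) (simp add: G'_blinfun)
  qed
  moreover have "G' p0 = (\<lambda>h. h)" by (simp add: G'_def DM fun_eq_iff)
  then have "id_blinfun o\<^sub>L Blinfun (G' p0) = id_blinfun"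
    by (intro blinfun_eqI) (simp add: bounded_linear_Blinfun_apply[OF bounded_linear_ident])
  ultimately obtain U' V g g' where inv: "open U'" "U' \<subseteq> V0" "p0 \<in> U'" "open V" "G p0 \<in> V" "homeomorphism U' V G g"
    "\<And>y. y \<in> V \<Longrightarrow> (g has_derivative (g' y)) (at y)"
    "\<And>y. y \<in> V \<Longrightarrow> g' y = inv (blinfun_apply (Blinfun (G' (g y))))"
    "\<And>y. y \<in> V \<Longrightarrow> bij (blinfun_apply (Blinfun (G' (g y))))"
    using inverse_function_theorem[OF V0(1), of G "\<lambda>x. Blinfun (G' x)" p0 id_blinfun] derG G'_blinfun p0(2)
    by (metis (no_types, lifting))
  have gV: "g y \<in> U'" "G (g y) = y" if "y \<in> V" for y
    using inv(6) that by (auto simp: homeomorphism_def)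
  have gG: "g (G z) = z" if "z \<in> U'" for z
    using inv(6) that by (auto simp: homeomorphism_def)
  \<comment> \<open>The inverse function theorem supplies a derivative of \<open>g\<close> at each
    point; strict differentiability of the inverse makes that derivative continuous.\<close>
  have Ck_g: "Ck_on (Suc 0) UNIV V g"
  proof -
    have "rel_diff {} (\<lambda>_ _. 0) g y" if y: "y \<in> V" for y
    proof (rule strict_diff_inverse)
      have gy: "g y \<in> V0" using gV(1)[OF y] inv(2) by blast
      show "bounded_linear (g' y)" using inv(7)[OF y] by (rule has_derivative_bounded_linear)
      show "g' y (G' (g y) v) = v" for v
        using inv(8,9)[OF y] by (simp add: G'_blinfun[OF gy] bij_is_inj)
      show "negligible_wrt (nhds (g y, g y)) (osc {} (\<lambda>_ _. 0)) (\<lambda>z. G (fst z) - G (snd z) - G' (g y) (fst z - snd z))"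
        by (rule C1_imp_negligible_remainder[OF V0(1) derG contG' gy])
      show "isCont g y" using inv(7)[OF y] by (rule has_derivative_continuous)
      show "eventually (\<lambda>y. G (g y) = y) (nhds y)"
        using eventually_nhds_in_open[OF inv(4) y] by eventually_elim (rule gV(2))
    qed simp
    from strict_diff_imp_C1[OF inv(4) this] show ?thesis
      by (simp add: Ck_on_Suc_open[OF inv(4)])
  qed
  define \<Omega> where "\<Omega> = P -` V"
  \<comment> \<open>A point of \<open>N\<close> near \<open>p0\<close> satisfies
    \<open>z = g (P z)\<close>; subtracting \<open>P z\<close> leaves its component in the kernel of
    \<open>P\<close>.\<close>
  define f where "f = (\<lambda>x. g (P x) - P x)"
  have \<Omega>: "open \<Omega>" unfolding \<Omega>_def using inv(4) P.continuous_on[OF continuous_on_id] by (simp add: open_vimage)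
  have PG: "P (G z) = P z" for z by (simp add: G_def P.add P.diff PP)
  have G_iff: "z \<in> N \<longleftrightarrow> G z = P z" if "z \<in> V0" for z
  proof -
    have "G z = P z \<longleftrightarrow> D (\<xi> z) = P (D (\<xi> z))" by (simp add: G_def)
    also have "\<dots> \<longleftrightarrow> D (\<xi> z) \<in> D ` L" using P(2,3) by (metis range_subsetD)
    also have "\<dots> \<longleftrightarrow> \<xi> z \<in> L" using injD by (simp add: inj_image_mem_iff)
    finally show ?thesis using flat[OF that] by simp
  qed
  have \<Omega>_g: "g (P x) \<in> U'" "G (g (P x)) = P x" "P (g (P x)) = P x" if "x \<in> \<Omega>" for x
  proof -
    show 1: "g (P x) \<in> U'" "G (g (P x)) = P x" using gV that by (auto simp: \<Omega>_def)
    show "P (g (P x)) = P x" using PG[of "g (P x)"] by (simp add: 1 PP)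
  qed
  interpret gr: graph_over P f \<Omega>
  proof
    show "x \<in> \<Omega> \<Longrightarrow> P (f x) = 0" for x by (simp add: f_def P.diff PP \<Omega>_g)
  qed (use \<Omega> in \<open>auto simp: PP f_def \<Omega>_def\<close>)
  have gp: "gr.graph_pt x = g (P x)" for x unfolding gr.graph_pt_def by (simp add: f_def)
  have graph_in: "g (P x) \<in> N" if "x \<in> \<Omega>" for x
    using G_iff[of "g (P x)"] \<Omega>_g[OF that] inv(2) by auto
  have graph_eq: "z \<in> \<Omega> \<and> g (P z) = z" if "z \<in> N" "z \<in> U'" for z
  proof -
    have "G z = P z" using G_iff that inv(2) by blast
    moreover have "G z \<in> V" using inv(6) that(2) by (auto simp: homeomorphism_def)
    ultimately show ?thesis using gG[OF that(2)] by (simp add: \<Omega>_def)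
  qed
  then have image: "gr.graph_pt ` \<Omega> = N \<inter> U'"
    using graph_in \<Omega>_g(1) by (auto simp: gp image_iff) (metis)
  have C1_f: "Ck_on (Suc 0) UNIV \<Omega> f"
    unfolding f_def
    by (intro Ck_on_diff Ck_on_compose[OF \<Omega> inv(4) _ _ Ck_g] Ck_on_bounded_linear P(1)) (auto simp: \<Omega>_def)
  have Ck_f: "Ck_on (Suc k) UNIV \<Omega> f"
  proof (rule gr.homogeneous_graph_Ck[OF C1_f _ order_refl])
    fix p q assume pq: "p \<in> \<Omega>" "q \<in> \<Omega>"
    then have in_N: "gr.graph_pt p \<in> N \<inter> U'" "gr.graph_pt q \<in> N \<inter> U'" using image by blast+
    then obtain U V H K where UV: "Ck_inverse_pair (Suc k) U V H K"
      "gr.graph_pt p \<in> U" "gr.graph_pt q \<in> V" "H (gr.graph_pt p) = gr.graph_pt q"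
      "\<forall>z\<in>U \<inter> N. H z \<in> N" "\<forall>z\<in>V \<inter> N. K z \<in> N"
      using hom[of "gr.graph_pt p" "gr.graph_pt q"] inv(2) by blast
    have "K (gr.graph_pt q) = gr.graph_pt p"
      using UV(1,2,4) by (metis Ck_inverse_pair_def)
    \<comment> \<open>The graph equals \<open>N\<close> only inside \<open>U'\<close>, so the local
      diffeomorphism is cut down until both it and its inverse stay in \<open>U'\<close>.\<close>
    then have "gr.graph_pt p \<in> U \<inter> U' \<inter> H -` U'" "gr.graph_pt q \<in> V \<inter> U' \<inter> K -` U'"
      using UV(2,3,4) in_N by auto
    moreover have "\<forall>x\<in>\<Omega>. gr.graph_pt x \<in> U \<inter> U' \<inter> H -` U' \<longrightarrow> H (gr.graph_pt x) \<in> gr.graph_pt ` \<Omega>"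
      "\<forall>x\<in>\<Omega>. gr.graph_pt x \<in> V \<inter> U' \<inter> K -` U' \<longrightarrow> K (gr.graph_pt x) \<in> gr.graph_pt ` \<Omega>"
      using UV(5,6) graph_in unfolding image by (auto simp: gp)
    ultimately show "\<exists>U V H K. Ck_inverse_pair (Suc k) U V H K \<and>
       gr.graph_pt p \<in> U \<and> gr.graph_pt q \<in> V \<and> H (gr.graph_pt p) = gr.graph_pt q \<and>
       (\<forall>x\<in>\<Omega>. gr.graph_pt x \<in> U \<longrightarrow> H (gr.graph_pt x) \<in> gr.graph_pt ` \<Omega>) \<and>
       (\<forall>y\<in>\<Omega>. gr.graph_pt y \<in> V \<longrightarrow> K (gr.graph_pt y) \<in> gr.graph_pt ` \<Omega>)"
      using Ck_inverse_pair_restrict[OF UV(1) inv(1) inv(1)] UV(4) by blast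
  qed
  have N_iff: "z \<in> N \<longleftrightarrow> z = P z + f z" if "z \<in> U' \<inter> \<Omega>" for z
    using graph_in[of z] graph_eq[of z] that by (auto simp: f_def)
  have p0': "p0 \<in> U' \<inter> \<Omega>" using graph_eq p0(1) inv(3) by blast
  have graph_N: "P x + f x \<in> N" if "x \<in> \<Omega>" for x using graph_in[OF that] by (simp add: f_def)
  have O': "open (U' \<inter> \<Omega>)" "U' \<inter> \<Omega> \<subseteq> V0" "U' \<inter> \<Omega> \<subseteq> \<Omega>" using inv(1,2) \<Omega> by auto
  show thesis
    by (rule that[where D = D and P = P and f = f and \<Omega> = \<Omega> and O' = "U' \<inter> \<Omega>",
          OF D injD linD P \<Omega> gr.P_in_\<Omega> gr.f_P gr.P_f Ck_f O'(1) p0' O'(2,3) N_iff graph_N])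
qed

subsection \<open>Charts and transition to the model space\<close>

lemma Ck_on_mono_subspace:
  "Ck_on k E S f \<Longrightarrow> E' \<subseteq> E \<Longrightarrow> Ck_on k E' S f"
proof (induction k arbitrary: f)
  case (Suc k)
  then obtain f' where "\<forall>x\<in>S. (f has_derivative f' x) (at x within S)" "\<forall>v\<in>E. Ck_on k E S (\<lambda>x. f' x v)"
    by (auto simp: Ck_on.simps(2))
  with Suc show ?case by (subst Ck_on.simps(2)) blast
qed simp

text \<open>Charts take values in the subspace \<open>E\<close>, while the calculus above needs open
  sets of the whole space. Composition with \<open>\<pi>\<close> translates between the two.\<close>

locale projection =
  fixes E :: "'e::euclidean_space set" and \<pi> :: "'e \<Rightarrow> 'e"
  assumes \<pi>: "bounded_linear \<pi>" and range_\<pi>: "\<pi> x \<in> E" and \<pi>_id: "x \<in> E \<Longrightarrow> \<pi> x = x"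
begin

sublocale \<pi>: bounded_linear \<pi> by (rule \<pi>)

lemma \<pi>\<pi> [simp]: "\<pi> (\<pi> x) = \<pi> x"
  using range_\<pi> \<pi>_id by blast

lemma open_vimage_\<pi>:
  assumes "openin (top_of_set E) S"
  shows "open (\<pi> -` S)"
proof -
  obtain T where T: "open T" "S = E \<inter> T" using assms by (auto simp: openin_open)
  have "\<pi> -` S = \<pi> -` T" using T(2) range_\<pi> by auto
  then show ?thesis using T(1) \<pi>.continuous_on[OF continuous_on_id] by (simp add: open_vimage)
qed

lemma Ck_on_extend:
  assumes "openin (top_of_set E) S"
  shows "Ck_on k E S f \<longleftrightarrow> Ck_on k UNIV (\<pi> -` S) (\<lambda>x. f (\<pi> x))"
proof (induction k arbitrary: f)
  have SE: "S \<subseteq> E" using assms by (rule openin_imp_subset)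
  have op: "open (\<pi> -` S)" using assms by (rule open_vimage_\<pi>)
  {
    case 0
    have "continuous_on (\<pi> -` S) (\<lambda>x. f (\<pi> x))" if "continuous_on S f"
      by (rule continuous_on_compose2[OF that \<pi>.continuous_on[OF continuous_on_id]]) auto
    moreover have "continuous_on S f" if "continuous_on (\<pi> -` S) (\<lambda>x. f (\<pi> x))"
    proof -
      have "continuous_on S (\<lambda>x. f (\<pi> x))"
        using that SE \<pi>_id by (auto intro: continuous_on_subset)
      then show ?thesis by (rule continuous_on_eq) (use SE \<pi>_id in auto)
    qed
    ultimately show ?case by auto
  next
    case (Suc k)
    show ?case
    proof
      assume "Ck_on (Suc k) E S f"
      then obtain f' where f': "\<forall>x\<in>S. (f has_derivative f' x) (at x within S)" "\<forall>v\<in>E. Ck_on k E S (\<lambda>x. f' x v)"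
        by (auto simp: Ck_on.simps(2))
      have "((\<lambda>x. f (\<pi> x)) has_derivative (\<lambda>v. f' (\<pi> x) (\<pi> v))) (at x within \<pi> -` S)" if "\<pi> x \<in> S" for x
        by (rule has_derivative_in_compose[OF bounded_linear_imp_has_derivative[OF \<pi>]])
           (use f'(1) that in \<open>auto intro: has_derivative_subset\<close>)
      moreover have "Ck_on k UNIV (\<pi> -` S) (\<lambda>x. f' (\<pi> x) (\<pi> v))" for v
        using f'(2) Suc[of "\<lambda>x. f' x (\<pi> v)"] range_\<pi> by blast
      ultimately show "Ck_on (Suc k) UNIV (\<pi> -` S) (\<lambda>x. f (\<pi> x))"
        unfolding Ck_on.simps by (intro exI[of _ "\<lambda>x v. f' (\<pi> x) (\<pi> v)"]) auto
    next
      assume "Ck_on (Suc k) UNIV (\<pi> -` S) (\<lambda>x. f (\<pi> x))"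
      then obtain F' where F': "\<forall>x\<in>\<pi> -` S. ((\<lambda>x. f (\<pi> x)) has_derivative F' x) (at x)" "\<forall>v. Ck_on k UNIV (\<pi> -` S) (\<lambda>x. F' x v)"
        unfolding Ck_on_Suc_open[OF op] by blast
      have "(f has_derivative F' x) (at x within S)" if x: "x \<in> S" for x
      proof -
        have "x \<in> \<pi> -` S" using x SE \<pi>_id by auto
        then have "((\<lambda>x. f (\<pi> x)) has_derivative F' x) (at x within S)"
          using F'(1) has_derivative_at_withinI by blast
        then show ?thesis
          by (rule has_derivative_transform[OF x, rotated]) (use SE \<pi>_id in auto)
      qed
      \<comment> \<open>A function that factors through \<open>\<pi>\<close> has a derivative that
        factors through \<open>\<pi>\<close> in the base point, for directions in \<open>E\<close>;
        only so does the induction hypothesis apply to it.\<close>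
      moreover have "Ck_on k E S (\<lambda>x. F' x v)" if v: "v \<in> E" for v
        unfolding Suc
      proof (rule Ck_on_cong[OF F'(2)[rule_format, of v]])
        fix x assume x: "x \<in> \<pi> -` S"
        then have "((\<lambda>x. f (\<pi> x)) has_derivative F' (\<pi> x)) (at (\<pi> x))" using F'(1) by simp
        then have "((\<lambda>x. f (\<pi> (\<pi> x))) has_derivative (\<lambda>h. F' (\<pi> x) (\<pi> h))) (at x)"
          by (rule has_derivative_compose[OF bounded_linear_imp_has_derivative[OF \<pi>]])
        then have "((\<lambda>x. f (\<pi> x)) has_derivative (\<lambda>h. F' (\<pi> x) (\<pi> h))) (at x)" by simp
        then have "F' x = (\<lambda>h. F' (\<pi> x) (\<pi> h))"
          using F'(1) x has_derivative_unique by blast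
        then show "F' x v = F' (\<pi> x) v" by (simp add: \<pi>_id[OF v])
      qed
      ultimately show "Ck_on (Suc k) E S f"
        unfolding Ck_on.simps by blast
    qed
  }
qed

lemma Ck_on_compose_subspace:
  assumes S: "openin (top_of_set E) S" and T: "openin (top_of_set E) T" and "f ` S \<subseteq> T"
    and "Ck_on k E S f" "Ck_on k E T g"
  shows "Ck_on k E S (\<lambda>x. g (f x))"
proof -
  have fT: "f (\<pi> x) \<in> T" "\<pi> (f (\<pi> x)) = f (\<pi> x)" if "x \<in> \<pi> -` S" for x
    using that assms(3) openin_imp_subset[OF T] \<pi>_id by auto
  have "Ck_on k UNIV (\<pi> -` S) (\<lambda>x. g (\<pi> (f (\<pi> x))))"
    using assms(4,5) unfolding Ck_on_extend[OF S] Ck_on_extend[OF T]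
    by (intro Ck_on_compose[where g = "\<lambda>x. g (\<pi> x)", OF open_vimage_\<pi>[OF S] open_vimage_\<pi>[OF T]])
       (auto simp: fT)
  then show ?thesis unfolding Ck_on_extend[OF S]
    by (rule Ck_on_cong) (simp add: fT)
qed

text \<open>Acting as the identity on the kernel component keeps the extension of an invertible map
  invertible.\<close>

definition extension :: "('e \<Rightarrow> 'e) \<Rightarrow> 'e \<Rightarrow> 'e" where
  "extension F x = F (\<pi> x) + (x - \<pi> x)"

lemma extension_on: "x \<in> E \<Longrightarrow> extension F x = F x"
  by (simp add: extension_def \<pi>_id)

lemma \<pi>_extension: "F (\<pi> x) \<in> E \<Longrightarrow> \<pi> (extension F x) = F (\<pi> x)"
  by (simp add: extension_def \<pi>.add \<pi>.diff \<pi>_id)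

lemma Ck_inverse_pair_extension:
  assumes S: "openin (top_of_set E) S" and T: "openin (top_of_set E) T"
    and F: "Ck_on k E S F" "F ` S \<subseteq> T" and F': "Ck_on k E T F'" "F' ` T \<subseteq> S"
    and inv: "\<And>z. z \<in> S \<Longrightarrow> F' (F z) = z" "\<And>z. z \<in> T \<Longrightarrow> F (F' z) = z"
  shows "Ck_inverse_pair k (\<pi> -` S) (\<pi> -` T) (extension F) (extension F')"
proof -
  have "S \<subseteq> E" "T \<subseteq> E" using S T openin_imp_subset by blast+
  then have \<pi>F: "\<pi> (extension F x) = F (\<pi> x)" if "\<pi> x \<in> S" for x
    using F(2) that by (intro \<pi>_extension) blast
  have \<pi>F': "\<pi> (extension F' x) = F' (\<pi> x)" if "\<pi> x \<in> T" for x
    using F'(2) that \<open>S \<subseteq> E\<close> by (intro \<pi>_extension) blast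
  have "Ck_on k UNIV (\<pi> -` R) (extension h)" if R: "openin (top_of_set E) R" and h: "Ck_on k E R h" for R h
    using h unfolding extension_def[abs_def] Ck_on_extend[OF R]
    by (intro Ck_on_add Ck_on_diff Ck_on_bounded_linear[OF \<pi>] Ck_on_bounded_linear[OF bounded_linear_ident])
  then have "Ck_on k UNIV (\<pi> -` S) (extension F)" "Ck_on k UNIV (\<pi> -` T) (extension F')"
    using S T F(1) F'(1) by blast+
  moreover have "extension F' (extension F z) = z" if "\<pi> z \<in> S" for z
    using inv(1)[OF that] by (simp add: extension_def[of F'] \<pi>F[OF that]) (simp add: extension_def)
  moreover have "extension F (extension F' z) = z" if "\<pi> z \<in> T" for z
    using inv(2)[OF that] by (simp add: extension_def[of F] \<pi>F'[OF that]) (simp add: extension_def)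
  ultimately show ?thesis
    using open_vimage_\<pi>[OF S] open_vimage_\<pi>[OF T] F(2) F'(2)
    by (auto simp: Ck_inverse_pair_def \<pi>F \<pi>F')
qed

end

lemma is_chartD:
  assumes "is_chart X E (W, \<psi>)"
  shows "openin X W" "W \<subseteq> topspace X" "inj_on \<psi> W" "\<psi> ` W \<subseteq> E"
    "openin X S \<Longrightarrow> S \<subseteq> W \<Longrightarrow> openin (top_of_set E) (\<psi> ` S)"
    "openin (top_of_set E) T \<Longrightarrow> openin X {x \<in> W. \<psi> x \<in> T}"
proof -
  have W: "openin X W" and im: "openin (top_of_set E) (\<psi> ` W)"
    and hom: "homeomorphic_map (subtopology X W) (top_of_set (\<psi> ` W)) \<psi>"
    using assms by (auto simp: is_chart_def)
  show "openin X W" by (rule W)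
  show sub: "W \<subseteq> topspace X" using W by (rule openin_subset)
  have top: "topspace (subtopology X W) = W" using sub by (auto simp: topspace_subtopology)
  show "inj_on \<psi> W" using homeomorphic_imp_injective_map[OF hom] unfolding top .
  show "\<psi> ` W \<subseteq> E" using im by (rule openin_imp_subset)
  show "openin (top_of_set E) (\<psi> ` S)" if "openin X S" "S \<subseteq> W"
  proof -
    have "openin (subtopology X W) S" using that W by (simp add: openin_open_subtopology)
    then have "openin (top_of_set (\<psi> ` W)) (\<psi> ` S)"
      using homeomorphic_imp_open_map[OF hom] by (simp add: open_map_def)
    then show ?thesis using im by (rule openin_trans)
  qed
  show "openin X {x \<in> W. \<psi> x \<in> T}" if "openin (top_of_set E) T"
  proof -
    have "openin (top_of_set (\<psi> ` W)) (\<psi> ` W \<inter> T)"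
      using that im by (meson openin_Int openin_imp_subset openin_subset_trans inf_le1)
    then have "openin (subtopology X W) {x \<in> topspace (subtopology X W). \<psi> x \<in> \<psi> ` W \<inter> T}"
      by (rule openin_continuous_map_preimage[OF homeomorphic_imp_continuous_map[OF hom]])
    moreover have "{x \<in> topspace (subtopology X W). \<psi> x \<in> \<psi> ` W \<inter> T} = {x \<in> W. \<psi> x \<in> T}"
      unfolding top by blast
    ultimately have "openin (subtopology X W) {x \<in> W. \<psi> x \<in> T}" by simp
    then show ?thesis using W by (simp add: openin_open_subtopology)
  qed
qed

section \<open>Local diffeomorphisms and straightening charts in coordinates\<close>

text \<open>One chart serves for source and target. \<open>S\<close> and \<open>T\<close> are the
  parts of \<open>U\<close> and \<open>V\<close> on which \<open>H\<close> and its inverse begin and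
  end in \<open>W\<close>; \<open>H\<close> maps \<open>S\<close> onto \<open>T\<close>.\<close>

lemma Ck_diffeo_inverse_pair:
  fixes E :: "'e::euclidean_space set"
  assumes proj: "projection E \<pi>" and "(W, \<psi>) \<in> A" and chart: "is_chart X E (W, \<psi>)"
    and op: "openin X U" "openin X V" and diffeo: "Ck_diffeo k E X A U V H"
  defines "S \<equiv> {z \<in> U \<inter> W. H z \<in> W}" and "T \<equiv> {z \<in> V \<inter> W. inv_into U H z \<in> W}"
  shows "Ck_inverse_pair k (\<pi> -` (\<psi> ` S)) (\<pi> -` (\<psi> ` T))
    (projection.extension \<pi> (\<psi> \<circ> H \<circ> inv_into W \<psi>))
    (projection.extension \<pi> (\<psi> \<circ> inv_into U H \<circ> inv_into W \<psi>))"
proof -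
  interpret projection E \<pi> by (rule proj)
  note W = is_chartD[OF chart]
  have bij: "bij_betw H U V" and maps: "Ck_map k E X A U V H" "Ck_map k E X A V U (inv_into U H)"
    using diffeo by (auto simp: Ck_diffeo_def)
  have H: "H z \<in> V" "inv_into U H (H z) = z" if "z \<in> U" for z
    using bij that by (auto simp: bij_betw_def)
  have H': "inv_into U H z \<in> U" "H (inv_into U H z) = z" if "z \<in> V" for z
    using bij that by (auto simp: bij_betw_def inv_into_into f_inv_into_f)
  have open_pre: "openin X {z \<in> U' \<inter> W. h z \<in> W}" if m: "Ck_map k E X A U' V' h" and op: "openin X U'" "openin X V'" for U' V' h
  proof -
    have top: "topspace (subtopology X R) = R" if "openin X R" for R
      using openin_subset[OF that] by (auto simp: topspace_subtopology)
    have c: "continuous_map (subtopology X U') (subtopology X V') h" using m by (simp add: Ck_map_def)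
    have "openin (subtopology X V') (V' \<inter> W)" using op(2) W(1) by (simp add: openin_open_subtopology openin_Int)
    then have "openin (subtopology X U') {z \<in> topspace (subtopology X U'). h z \<in> V' \<inter> W}"
      by (rule openin_continuous_map_preimage[OF c])
    then have "openin X {z \<in> U'. h z \<in> V' \<inter> W}" unfolding top[OF op(1)] openin_open_subtopology[OF op(1)] by blast
    then have "openin X ({z \<in> U'. h z \<in> V' \<inter> W} \<inter> W)" using W(1) by (rule openin_Int)
    moreover have "h z \<in> V'" if "z \<in> U'" for z
      using continuous_map_image_subset_topspace[OF c] that unfolding top[OF op(1)] top[OF op(2)] by blast
    then have "{z \<in> U'. h z \<in> V' \<inter> W} \<inter> W = {z \<in> U' \<inter> W. h z \<in> W}" by blast
    ultimately show ?thesis by simp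
  qed
  have inv\<psi>: "inv_into W \<psi> (\<psi> x) = x" if "x \<in> W" for x using W(3) that by simp
  have S: "openin (top_of_set E) (\<psi> ` S)" and T: "openin (top_of_set E) (\<psi> ` T)"
    unfolding S_def T_def using open_pre[OF maps(1) op] open_pre[OF maps(2) op(2,1)] by (auto intro!: W(5))
  have Ck: "Ck_on k E (\<psi> ` S) (\<psi> \<circ> H \<circ> inv_into W \<psi>)" "Ck_on k E (\<psi> ` T) (\<psi> \<circ> inv_into U H \<circ> inv_into W \<psi>)"
    using maps \<open>(W, \<psi>) \<in> A\<close> unfolding Ck_map_def S_def T_def by blast+
  show ?thesis
    by (rule Ck_inverse_pair_extension[OF S T Ck(1) _ Ck(2)])
       (auto simp: S_def T_def inv\<psi> H H')
qed

text \<open>The shear z - f z straightens the graph. It moves points only within the kernel of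
  \<open>P\<close>, along which \<open>f\<close> is constant, so w + f w is its explicit inverse and
  both are as smooth as \<open>f\<close>.\<close>

lemma graph_chart_in_Ck_charts:
  fixes E :: "'e::euclidean_space set" and f P :: "'e \<Rightarrow> 'e"
  assumes mf: "Ck_manifold k E X A" and W\<psi>: "(W, \<psi>) \<in> A"
    and P: "bounded_linear P" "\<And>x. P x \<in> \<Omega> \<longleftrightarrow> x \<in> \<Omega>" "\<And>x. f (P x) = f x" "\<And>x. x \<in> \<Omega> \<Longrightarrow> P (f x) = 0"
    and f: "open \<Omega>" "Ck_on k UNIV \<Omega> f" "\<And>x. x \<in> \<Omega> \<Longrightarrow> f x \<in> E"
    and O': "open O'" "O' \<subseteq> \<Omega>" "O' \<inter> E \<subseteq> \<psi> ` W"
  shows "({x \<in> W. \<psi> x \<in> O'}, \<lambda>x. \<psi> x - f (\<psi> x)) \<in> Ck_charts k E X A"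
proof -
  have sub: "subspace E" and charts: "\<And>c. c \<in> A \<Longrightarrow> is_chart X E c"
    and compat: "\<And>c c'. c \<in> A \<Longrightarrow> c' \<in> A \<Longrightarrow> Ck_compatible k E c c'"
    using mf by (auto simp: Ck_manifold_def)
  obtain \<pi> where "bounded_linear \<pi>" "range \<pi> \<subseteq> E" "\<And>v. v \<in> E \<Longrightarrow> \<pi> v = v"
    using exists_linear_projection[OF sub] by blast
  then interpret projection E \<pi> by (auto simp: projection_def)
  interpret P: bounded_linear P by (rule P)
  note W = is_chartD[OF charts[OF W\<psi>]]
  define \<theta> where "\<theta> = (\<lambda>z. z - f z)"
  define \<eta> where "\<eta> = (\<lambda>w. w + f w)"
  define W1 where "W1 = {x \<in> W. \<psi> x \<in> O'}"
  define \<omega> where "\<omega> = (\<lambda>x. \<theta> (\<psi> x))"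
  have P\<theta>: "\<theta> z \<in> \<Omega>" "f (\<theta> z) = f z" if "z \<in> \<Omega>" for z
  proof -
    have eq: "P (\<theta> z) = P z" using P(4)[OF that] by (simp add: \<theta>_def P.diff)
    show "\<theta> z \<in> \<Omega>" using P(2)[of "\<theta> z"] P(2)[of z] eq that by simp
    show "f (\<theta> z) = f z" using P(3)[of "\<theta> z"] P(3)[of z] eq by simp
  qed
  have P\<eta>: "\<eta> z \<in> \<Omega>" "f (\<eta> z) = f z" if "z \<in> \<Omega>" for z
  proof -
    have eq: "P (\<eta> z) = P z" using P(4)[OF that] by (simp add: \<eta>_def P.add)
    show "\<eta> z \<in> \<Omega>" using P(2)[of "\<eta> z"] P(2)[of z] eq that by simp
    show "f (\<eta> z) = f z" using P(3)[of "\<eta> z"] P(3)[of z] eq by simp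
  qed
  have \<eta>\<theta>: "\<eta> (\<theta> z) = z" "\<theta> (\<eta> z) = z" if "z \<in> \<Omega>" for z
  proof -
    have "\<eta> (\<theta> z) = \<theta> z + f (\<theta> z)" by (simp add: \<eta>_def)
    also have "\<dots> = z" unfolding P\<theta>(2)[OF that] by (simp add: \<theta>_def)
    finally show "\<eta> (\<theta> z) = z" .
    have "\<theta> (\<eta> z) = \<eta> z - f (\<eta> z)" by (simp add: \<theta>_def)
    also have "\<dots> = z" unfolding P\<eta>(2)[OF that] by (simp add: \<eta>_def)
    finally show "\<theta> (\<eta> z) = z" .
  qed
  have \<theta>E: "\<theta> z \<in> E" "\<eta> z \<in> E" if "z \<in> \<Omega>" "z \<in> E" for z
    using f(3)[OF that(1)] that(2) sub by (auto simp: \<theta>_def \<eta>_def subspace_diff subspace_add)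
  have Ck_f: "Ck_on k E S f" if "S \<subseteq> \<Omega>" for S
    by (rule Ck_on_mono_subspace[OF Ck_on_subset[OF f(2) that]]) simp
  have Ck_\<theta>: "Ck_on k E S \<theta>" "Ck_on k E S \<eta>" if "S \<subseteq> \<Omega>" for S
    unfolding \<theta>_def \<eta>_def
    by (intro Ck_on_diff Ck_on_add Ck_f that Ck_on_bounded_linear[OF bounded_linear_ident])+
  have cont: "continuous_on S \<theta>" "continuous_on S \<eta>" if "S \<subseteq> \<Omega>" for S
    using Ck_\<theta>[OF that] Ck_on_continuous by blast+
  have open_\<theta>: "openin (top_of_set E) (\<theta> ` Q)" if Q: "openin (top_of_set E) Q" "Q \<subseteq> \<Omega>" for Q
  proof -
    have "Q \<subseteq> E" using Q(1) by (rule openin_imp_subset)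
    obtain R where R: "open R" "Q = E \<inter> R" using Q(1) by (auto simp: openin_open)
    have "\<theta> ` Q = E \<inter> (\<Omega> \<inter> \<eta> -` R)"
    proof (intro equalityI subsetI)
      fix w assume "w \<in> \<theta> ` Q"
      then obtain z where z: "z \<in> Q" "w = \<theta> z" by blast
      then have "z \<in> \<Omega>" "z \<in> E" "z \<in> R" using Q(2) R(2) by auto
      then show "w \<in> E \<inter> (\<Omega> \<inter> \<eta> -` R)" using P\<theta>(1) \<theta>E(1) \<eta>\<theta>(1) z(2) by simp
    next
      fix w assume w: "w \<in> E \<inter> (\<Omega> \<inter> \<eta> -` R)"
      then have "\<eta> w \<in> Q" using \<theta>E(2) R(2) by blast
      moreover have "w = \<theta> (\<eta> w)" using w \<eta>\<theta>(2) by simp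
      ultimately show "w \<in> \<theta> ` Q" by blast
    qed
    moreover have "open (\<Omega> \<inter> \<eta> -` R)"
      using cont(2)[OF order_refl] f(1) R(1) by (rule continuous_open_preimage)
    ultimately show ?thesis by (auto simp: openin_open)
  qed
  have W1: "openin X W1" "W1 \<subseteq> W"
  proof -
    have "W1 = {x \<in> W. \<psi> x \<in> E \<inter> O'}" using W(4) by (auto simp: W1_def)
    moreover have "openin (top_of_set E) (E \<inter> O')" using O'(1) by (rule openin_open_Int)
    ultimately show "openin X W1" by (simp only: W(6))
    show "W1 \<subseteq> W" by (auto simp: W1_def)
  qed
  have \<psi>1: "\<psi> x \<in> O'" "\<psi> x \<in> \<Omega>" "\<psi> x \<in> E" if "x \<in> W1" for x
    using that O'(2) W(4) by (auto simp: W1_def)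
  have open_\<omega>: "openin (top_of_set E) (\<omega> ` S)" if "openin X S" "S \<subseteq> W1" for S
  proof -
    have "openin (top_of_set E) (\<theta> ` (\<psi> ` S))"
      using that W1(2) \<psi>1(2) by (intro open_\<theta> W(5)) auto
    then show ?thesis by (simp add: \<omega>_def image_image)
  qed
  have inj: "inj_on \<omega> W1"
  proof (rule inj_onI)
    fix x y assume xy: "x \<in> W1" "y \<in> W1" "\<omega> x = \<omega> y"
    then have "\<psi> x = \<psi> y" using \<eta>\<theta>(1) \<psi>1(2) unfolding \<omega>_def by metis
    then show "x = y" using xy W(3) W1(2) by (meson inj_onD subsetD)
  qed
  have top1: "topspace (subtopology X W1) = W1"
    using W1(1) openin_subset by (auto simp: topspace_subtopology)
  have "homeomorphic_map (subtopology X W1) (top_of_set (\<omega> ` W1)) \<omega>"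
  proof (rule bijective_open_imp_homeomorphic_map)
    have "homeomorphic_map (subtopology X W) (top_of_set (\<psi> ` W)) \<psi>"
      using charts[OF W\<psi>] by (simp add: is_chart_def)
    then have "continuous_map (subtopology X W) euclidean \<psi>"
      using homeomorphic_imp_continuous_map continuous_map_into_fulltopology by blast
    then have "continuous_map (subtopology X W1) euclidean \<psi>"
      using W1(2) continuous_map_from_subtopology_mono by blast
    then have "continuous_map (subtopology X W1) (top_of_set O') \<psi>"
      using \<psi>1(1) by (auto simp: continuous_map_in_subtopology top1)
    moreover have "continuous_map (top_of_set O') euclidean \<theta>" using cont(1)[OF O'(2)] by simp
    ultimately have "continuous_map (subtopology X W1) euclidean \<omega>"
      unfolding \<omega>_def using continuous_map_compose[of _ _ \<psi> _ \<theta>] by (simp add: o_def)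
    then show "continuous_map (subtopology X W1) (top_of_set (\<omega> ` W1)) \<omega>"
      by (auto simp: continuous_map_in_subtopology top1)
    show "open_map (subtopology X W1) (top_of_set (\<omega> ` W1)) \<omega>"
      unfolding open_map_def
    proof (intro allI impI)
      fix S assume "openin (subtopology X W1) S"
      then have "openin X S" "S \<subseteq> W1" using W1(1) by (auto simp: openin_open_subtopology)
      then have "openin (top_of_set E) (\<omega> ` S)" by (rule open_\<omega>)
      moreover have "\<omega> ` S \<subseteq> \<omega> ` W1" "\<omega> ` W1 \<subseteq> E"
        using \<open>S \<subseteq> W1\<close> \<psi>1(2,3) \<theta>E(1) by (auto simp: \<omega>_def)
      ultimately show "openin (top_of_set (\<omega> ` W1)) (\<omega> ` S)" by (rule openin_subset_trans)
    qed
    show "\<omega> ` topspace (subtopology X W1) = topspace (top_of_set (\<omega> ` W1))" unfolding top1 by simp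
    show "inj_on \<omega> (topspace (subtopology X W1))" unfolding top1 by (rule inj)
  qed
  then have chart: "is_chart X E (W1, \<omega>)"
    using W1(1) open_\<omega>[OF W1(1) order_refl] by (simp add: is_chart_def)
  have "Ck_compatible k E (W1, \<omega>) (W', \<psi>')" if c': "(W', \<psi>') \<in> A" for W' \<psi>'
  proof -
    note W' = is_chartD[OF charts[OF c']]
    have c: "Ck_on k E (\<psi> ` (W \<inter> W')) (\<psi>' \<circ> inv_into W \<psi>)" "Ck_on k E (\<psi>' ` (W \<inter> W')) (\<psi> \<circ> inv_into W' \<psi>')"
      using compat[OF W\<psi> c'] by (simp_all add: Ck_compatible_def)
    have op: "openin X (W1 \<inter> W')" "openin X (W \<inter> W')" using W1(1) W(1) W'(1) by auto
    have "Ck_on k E (\<omega> ` (W1 \<inter> W')) (\<lambda>w. (\<psi>' \<circ> inv_into W \<psi>) (\<eta> w))"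
    proof (rule Ck_on_compose_subspace[OF _ _ _ _ c(1)])
      show "openin (top_of_set E) (\<omega> ` (W1 \<inter> W'))" using op(1) by (intro open_\<omega>) auto
      show "openin (top_of_set E) (\<psi> ` (W \<inter> W'))" using op(2) by (intro W(5)) auto
      show "\<eta> ` \<omega> ` (W1 \<inter> W') \<subseteq> \<psi> ` (W \<inter> W')"
        using \<eta>\<theta>(1) \<psi>1(2) W1(2) by (auto simp: \<omega>_def)
      show "Ck_on k E (\<omega> ` (W1 \<inter> W')) \<eta>"
        using P\<theta>(1) \<psi>1(2) by (intro Ck_\<theta>(2)) (auto simp: \<omega>_def)
    qed
    then have "Ck_on k E (\<omega> ` (W1 \<inter> W')) (\<psi>' \<circ> inv_into W1 \<omega>)"
      by (rule Ck_on_cong) (use inj W(3) W1(2) \<eta>\<theta>(1) \<psi>1(2) in \<open>auto simp: \<omega>_def[symmetric] inv_into_f_f subsetD, auto simp: \<omega>_def subsetD\<close>)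
    moreover have "Ck_on k E (\<psi>' ` (W1 \<inter> W')) (\<lambda>z. \<theta> ((\<psi> \<circ> inv_into W' \<psi>') z))"
    proof (rule Ck_on_compose_subspace[OF _ _ _ Ck_on_subset[OF c(2)] Ck_\<theta>(1)])
      show "openin (top_of_set E) (\<psi>' ` (W1 \<inter> W'))" using op(1) by (intro W'(5)) auto
      show "openin (top_of_set E) (\<psi> ` W1)" using W1 by (intro W(5))
      show "(\<psi> \<circ> inv_into W' \<psi>') ` \<psi>' ` (W1 \<inter> W') \<subseteq> \<psi> ` W1"
        using W'(3) by auto
      show "\<psi>' ` (W1 \<inter> W') \<subseteq> \<psi>' ` (W \<inter> W')" using W1(2) by blast
      show "\<psi> ` W1 \<subseteq> \<Omega>" using \<psi>1(2) by blast
    qed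
    then have "Ck_on k E (\<psi>' ` (W1 \<inter> W')) (\<omega> \<circ> inv_into W' \<psi>')"
      by (simp add: \<omega>_def o_def)
    ultimately show ?thesis by (simp add: Ck_compatible_def)
  qed
  then have "(W1, \<omega>) \<in> Ck_charts k E X A" using chart by (auto simp: Ck_charts_def)
  then show ?thesis by (simp add: W1_def \<omega>_def \<theta>_def)
qed

theorem theoremB:
  fixes k d :: nat
    and E :: "'e::euclidean_space set"
    and X :: "'m topology"
    and A :: "('m, 'e) chart set"
    and N :: "'m set"
  assumes "k \<ge> 2"
    and "Ck_manifold k E X A"
    and "Ck_submanifold 1 d E X A N"
    and "Ck_homogeneous k E X A N"
  shows "Ck_submanifold k d E X A N"
  unfolding Ck_submanifold_def
proof (intro conjI ballI)
  have NX: "N \<subseteq> topspace X" using assms(3) by (simp add: Ck_submanifold_def)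
  then show "N \<subseteq> topspace X" .
  have sub: "subspace E" and charts: "\<And>c. c \<in> A \<Longrightarrow> is_chart X E c"
    using assms(2) by (auto simp: Ck_manifold_def)
  obtain k' where k: "k = Suc k'" using assms(1) by (cases k) auto
  obtain \<pi> where "bounded_linear \<pi>" "range \<pi> \<subseteq> E" "\<And>v. v \<in> E \<Longrightarrow> \<pi> v = v"
    using exists_linear_projection[OF sub] by blast
  then have proj: "projection E \<pi>" by (auto simp: projection_def)
  then interpret projection E \<pi> .
  fix p assume p: "p \<in> N"
  obtain W \<psi> where W\<psi>: "(W, \<psi>) \<in> A" "p \<in> W"
    using p NX assms(2) by (auto simp: Ck_manifold_def)
  note chartW = charts[OF W\<psi>(1)]
  note W = is_chartD[OF chartW]
  obtain U \<phi> L where U\<phi>: "(U, \<phi>) \<in> Ck_charts 1 E X A" "p \<in> U"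
    and L: "subspace L" "L \<subseteq> E" "dim L = d" "\<phi> ` (U \<inter> N) = \<phi> ` U \<inter> L"
    using assms(3) p by (fastforce simp: Ck_submanifold_def)
  have chartU: "is_chart X E (U, \<phi>)" and compat: "Ck_compatible 1 E (U, \<phi>) (W, \<psi>)"
    using U\<phi>(1) W\<psi>(1) by (auto simp: Ck_charts_def)
  note U = is_chartD[OF chartU]
  have inv\<psi>: "inv_into W \<psi> (\<psi> x) = x" if "x \<in> W" for x using W(3) that by simp
  have inv\<phi>: "inv_into U \<phi> (\<phi> x) = x" if "x \<in> U" for x using U(3) that by simp
  \<comment> \<open>From here on everything happens in the coordinates of one chart of the atlas:
    \<open>N'\<close> is the picture of \<open>N\<close>, and the C^1 submanifold chart becomes the
    coordinate change \<open>F\<close>, extended off \<open>E\<close>.\<close>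
  define N' where "N' = \<psi> ` (N \<inter> W)"
  define V0 where "V0 = \<pi> -` (\<psi> ` (U \<inter> W))"
  define W0 where "W0 = \<pi> -` (\<phi> ` (U \<inter> W))"
  define F where "F = \<phi> \<circ> inv_into W \<psi>"
  define F' where "F' = \<psi> \<circ> inv_into U \<phi>"
  have opUW: "openin X (U \<inter> W)" using U(1) W(1) by blast
  have op: "openin (top_of_set E) (\<psi> ` (U \<inter> W))" "openin (top_of_set E) (\<phi> ` (U \<inter> W))"
    using opUW by (auto intro!: W(5) U(5))
  have pair: "Ck_inverse_pair (Suc 0) V0 W0 (extension F) (extension F')"
    unfolding V0_def W0_def
    by (rule Ck_inverse_pair_extension[OF op])
       (use compat in \<open>auto simp: Ck_compatible_def F_def F'_def inv\<psi> inv\<phi>\<close>)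
  have \<psi>E: "\<pi> (\<psi> x) = \<psi> x" if "x \<in> W" for x using W(4) that by (intro \<pi>_id) blast
  have N'E: "N' \<subseteq> E" using W(4) by (auto simp: N'_def)
  have F\<psi>: "extension F (\<psi> x) = \<phi> x" if "x \<in> W" for x
    using W(4) that by (subst extension_on) (auto simp: F_def inv\<psi>)
  have flat: "z \<in> N' \<longleftrightarrow> extension F z \<in> L" if z: "z \<in> V0" for z
  proof
    assume "z \<in> N'"
    then obtain x where x: "x \<in> N" "x \<in> W" "z = \<psi> x" by (auto simp: N'_def)
    obtain y where y: "y \<in> U" "y \<in> W" "\<psi> y = \<psi> x" using z x \<psi>E by (auto simp: V0_def)
    then have "y = x" using W(3) x(2) by (meson inj_onD)
    then have "\<phi> x \<in> L" using L(4) x(1) y(1) by blast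
    then show "extension F z \<in> L" using F\<psi>[OF x(2)] x(3) by simp
  \<comment> \<open>Since \<open>L\<close> lies in \<open>E\<close>, membership of
    \<open>extension F z\<close> in \<open>L\<close> makes its kernel component vanish. That
    component is \<open>z - \<pi> z\<close>, so z is a genuine chart point.\<close>
  next
    assume *: "extension F z \<in> L"
    obtain x where x: "x \<in> U" "x \<in> W" "\<pi> z = \<psi> x" using z by (auto simp: V0_def)
    have Fz: "F (\<pi> z) = \<phi> x" by (simp add: x F_def inv\<psi>)
    then have "\<pi> (extension F z) = F (\<pi> z)" using U(4) x(1) by (intro \<pi>_extension) auto
    moreover have "\<pi> (extension F z) = extension F z" using * L(2) by (intro \<pi>_id) blast
    ultimately have "extension F z = F (\<pi> z)" by simp
    then have z_eq: "z = \<psi> x" and "\<phi> x \<in> L" using * Fz x(3) by (simp_all add: extension_def)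
    then have "\<phi> x \<in> \<phi> ` (U \<inter> N)" using L(4) x(1) by blast
    then have "x \<in> N" using U(3) x(1) by (auto dest: inj_onD)
    then show "z \<in> N'" using z_eq x(2) by (auto simp: N'_def)
  qed
  have hom: "\<exists>U V H K. Ck_inverse_pair (Suc k') U V H K \<and>
       p \<in> U \<and> q \<in> V \<and> H p = q \<and> (\<forall>z\<in>U \<inter> N'. H z \<in> N') \<and> (\<forall>z\<in>V \<inter> N'. K z \<in> N')"
    if pq: "p \<in> N' \<inter> V0" "q \<in> N' \<inter> V0" for p q
  proof -
    obtain x y where x: "x \<in> N" "x \<in> W" "p = \<psi> x" and y: "y \<in> N" "y \<in> W" "q = \<psi> y"
      using pq by (auto simp: N'_def)
    obtain U1 V1 H where UVH: "openin X U1" "openin X V1" "x \<in> U1" "y \<in> V1"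
      "Ck_diffeo k E X A U1 V1 H" "H x = y" "H ` (U1 \<inter> N) = V1 \<inter> N"
      using assms(4) x(1) y(1) unfolding Ck_homogeneous_def by blast
    define S where "S = {z \<in> U1 \<inter> W. H z \<in> W}"
    define T where "T = {z \<in> V1 \<inter> W. inv_into U1 H z \<in> W}"
    define h where "h = extension (\<psi> \<circ> H \<circ> inv_into W \<psi>)"
    define h' where "h' = extension (\<psi> \<circ> inv_into U1 H \<circ> inv_into W \<psi>)"
    have "Ck_inverse_pair k (\<pi> -` (\<psi> ` S)) (\<pi> -` (\<psi> ` T)) h h'"
      unfolding S_def T_def h_def h'_def
      by (rule Ck_diffeo_inverse_pair[OF proj W\<psi>(1) chartW UVH(1,2,5)])
    moreover have bij: "inj_on H U1" "H ` U1 = V1" using UVH(5) by (auto simp: Ck_diffeo_def bij_betw_def)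
    have xy: "inv_into U1 H y = x" using bij(1) UVH(3,6) by auto
    have "p \<in> \<pi> -` (\<psi> ` S)" "q \<in> \<pi> -` (\<psi> ` T)"
      using x y UVH(3,4,6) xy \<psi>E by (auto simp: S_def T_def)
    moreover have h: "h (\<psi> z) = \<psi> (H z)" "h' (\<psi> z) = \<psi> (inv_into U1 H z)" if "z \<in> W" for z
      unfolding h_def h'_def using W(4) that by (subst extension_on; auto simp: inv\<psi>)+
    then have "h p = q" using x y UVH(6) by simp
    moreover have "h z \<in> N'" if z: "z \<in> \<pi> -` (\<psi> ` S) \<inter> N'" for z
    proof -
      obtain w where w: "w \<in> N" "w \<in> W" "z = \<psi> w" using z by (auto simp: N'_def)
      obtain s where "s \<in> S" "\<psi> s = \<psi> w" using z w \<psi>E by auto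
      then have "w \<in> S" using W(3) w(2) by (auto simp: S_def dest: inj_onD)
      then have "H w \<in> N" "H w \<in> W" using UVH(7) w(1) by (auto simp: S_def)
      then show ?thesis using h(1)[OF w(2)] w(3) by (auto simp: N'_def)
    qed
    moreover have "h' z \<in> N'" if z: "z \<in> \<pi> -` (\<psi> ` T) \<inter> N'" for z
    proof -
      obtain w where w: "w \<in> N" "w \<in> W" "z = \<psi> w" using z by (auto simp: N'_def)
      obtain s where "s \<in> T" "\<psi> s = \<psi> w" using z w \<psi>E by auto
      then have wT: "w \<in> T" using W(3) w(2) by (auto simp: T_def dest: inj_onD)
      then have "w \<in> H ` (U1 \<inter> N)" using UVH(7) w(1) by (auto simp: T_def)
      then have "inv_into U1 H w \<in> N" using bij(1) by auto
      then show ?thesis using wT h(2)[OF w(2)] w(3) by (auto simp: N'_def T_def)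
    qed
    ultimately show ?thesis unfolding k by blast
  qed
  have p0: "\<psi> p \<in> N'" "\<psi> p \<in> V0" using p W\<psi>(2) U\<phi>(2) \<psi>E by (auto simp: N'_def V0_def)
  obtain D P f \<Omega> O' where
    D: "(extension F' has_derivative D) (at (extension F (\<psi> p)))" "inj D" "linear D"
    and P: "bounded_linear P" "range P \<subseteq> D ` L" "\<And>v. v \<in> D ` L \<Longrightarrow> P v = v"
    and \<Omega>: "open \<Omega>" "\<And>x. P x \<in> \<Omega> \<longleftrightarrow> x \<in> \<Omega>" "\<And>x. f (P x) = f x" "\<And>x. x \<in> \<Omega> \<Longrightarrow> P (f x) = 0"
      "Ck_on (Suc k') UNIV \<Omega> f"
    and O': "open O'" "\<psi> p \<in> O'" "O' \<subseteq> V0" "O' \<subseteq> \<Omega>"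
    and graph: "\<And>z. z \<in> O' \<Longrightarrow> z \<in> N' \<longleftrightarrow> z = P z + f z" "\<And>x. x \<in> \<Omega> \<Longrightarrow> P x + f x \<in> N'"
    by (rule homogeneous_imp_Ck_graph[OF p0 L(1) pair flat hom]) (assumption | (erule that, assumption+))+
  interpret P: bounded_linear P by (rule P)
  have DL: "subspace (D ` L)" using D(3) L(1) by (rule linear_subspace_image)
  \<comment> \<open>The extension of \<open>F'\<close> leaves the component x - \<pi> x unchanged,
    hence so does its derivative \<open>D\<close>; vectors of \<open>L\<close> have no such
    component, and neither do their images.\<close>
  have DL_E: "D ` L \<subseteq> E"
  proof
    fix w assume "w \<in> D ` L"
    then obtain v where v: "v \<in> L" "w = D v" by blast
    have x0: "extension F (\<psi> p) \<in> W0" "open W0"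
      using pair p0(2) by (auto simp: Ck_inverse_pair_def)
    have "((\<lambda>x. extension F' x - \<pi> (extension F' x)) has_derivative (\<lambda>h. D h - \<pi> (D h))) (at (extension F (\<psi> p)))"
      by (intro has_derivative_diff D(1) bounded_linear.has_derivative[OF \<pi>])
    then have "((\<lambda>x. x - \<pi> x) has_derivative (\<lambda>h. D h - \<pi> (D h))) (at (extension F (\<psi> p)))"
    proof (rule has_derivative_transform_within_open[OF _ x0(2,1)])
      fix x assume "x \<in> W0"
      then have "F' (\<pi> x) \<in> E" using W(4) by (auto simp: W0_def F'_def inv\<phi>)
      then show "extension F' x - \<pi> (extension F' x) = x - \<pi> x"
        by (simp add: \<pi>_extension) (simp add: extension_def)
    qed
    moreover have "((\<lambda>x. x - \<pi> x) has_derivative (\<lambda>h. h - \<pi> h)) (at (extension F (\<psi> p)))"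
      by (intro has_derivative_diff has_derivative_ident bounded_linear_imp_has_derivative \<pi>)
    ultimately have "(\<lambda>h. D h - \<pi> (D h)) = (\<lambda>h. h - \<pi> h)" by (rule has_derivative_unique)
    then have "D v - \<pi> (D v) = v - \<pi> v" by meson
    also have "\<dots> = 0" using v(1) L(2) \<pi>_id by auto
    finally show "w \<in> E" using range_\<pi>[of "D v"] v(2) by simp
  qed
  \<comment> \<open>Graph points lie in \<open>N'\<close> and thus in \<open>E\<close>, and
    \<open>P x\<close> is tangent to \<open>N'\<close>, hence in \<open>E\<close> as well; their
    difference is \<open>f x\<close>.\<close>
  have fE: "f x \<in> E" if "x \<in> \<Omega>" for x
  proof -
    have "P x + f x \<in> E" "P x \<in> E" using graph(2)[OF that] N'E P(2) DL_E by blast+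
    then have "(P x + f x) - P x \<in> E" using sub subspace_diff by blast
    then show ?thesis by simp
  qed
  have "O' \<inter> E \<subseteq> \<psi> ` W" using O'(3) \<pi>_id by (fastforce simp: V0_def)
  then have chart: "({x \<in> W. \<psi> x \<in> O'}, \<lambda>x. \<psi> x - f (\<psi> x)) \<in> Ck_charts k E X A"
    using \<Omega>(5) by (intro graph_chart_in_Ck_charts[where f = f and P = P and \<Omega> = \<Omega>, OF assms(2) W\<psi>(1) P(1) \<Omega>(2,3,4,1) _ fE O'(1,4)])
      (simp_all add: k)
  define W1 where "W1 = {x \<in> W. \<psi> x \<in> O'}"
  define \<omega> where "\<omega> = (\<lambda>x. \<psi> x - f (\<psi> x))"
  have N_iff: "x \<in> N \<longleftrightarrow> \<psi> x = P (\<psi> x) + f (\<psi> x)" if "x \<in> W1" for x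
  proof -
    have "x \<in> N \<longleftrightarrow> \<psi> x \<in> N'" using that W(3) by (auto simp: N'_def W1_def dest: inj_onD)
    then show ?thesis using graph(1) that by (simp add: W1_def)
  qed
  \<comment> \<open>Subtracting \<open>f\<close> does not change the \<open>P\<close>-component, so
    being fixed by \<open>P\<close> after the shear is the graph equation before it.\<close>
  have "\<omega> x \<in> D ` L \<longleftrightarrow> x \<in> N" if x: "x \<in> W1" for x
  proof -
    have "\<psi> x \<in> \<Omega>" using x O'(4) by (auto simp: W1_def)
    then have "P (\<omega> x) = P (\<psi> x)" by (simp add: \<omega>_def P.diff \<Omega>(4))
    moreover have "\<omega> x \<in> D ` L \<longleftrightarrow> P (\<omega> x) = \<omega> x" using P(2,3) by (metis range_subsetD)
    ultimately show ?thesis using N_iff[OF x] by (auto simp: \<omega>_def algebra_simps)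
  qed
  then have "\<omega> ` (W1 \<inter> N) = \<omega> ` W1 \<inter> D ` L" by blast
  moreover have "dim (D ` L) = d"
    using dim_image_eq[OF D(3), of L] D(2) L(3) by (simp add: inj_on_subset)
  moreover have "p \<in> W1" using W\<psi>(2) O'(2) by (simp add: W1_def)
  ultimately show "\<exists>(U, \<phi>)\<in>Ck_charts k E X A. p \<in> U \<and>
        (\<exists>L. subspace L \<and> L \<subseteq> E \<and> dim L = d \<and> \<phi> ` (U \<inter> N) = \<phi> ` U \<inter> L)"
    using chart DL DL_E unfolding W1_def[symmetric] \<omega>_def[symmetric] by (intro bexI[of _ "(W1, \<omega>)"]) auto
qed

end
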